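(* Let $p\in(0,1]$. Then the class $$\mathcal{S}^p=\{\psi\in L^p(\mathbb{R}^d):S_\psi\text{ maps }\ell^p(\mathbb{Z}_+\times\mathbb{Z}^d)\text{ onto }L^p(\mathbb{R}^d)\}$$ is dense, open, and path connected in $L^p(\mathbb{R}^d)$.
   Context: Fix a dimension $d\in\mathbb{N}$. Functions and sequences are complex valued. $\mathbb{Z}_+=\{j\in\mathbb{Z}:j>0\}$. Fix invertible real $d\times d$ matrices $a_j$ ($j\in\mathbb{Z}_+$) with $\|a_j^{-1}\|\to0$ as $j\to\infty$ (operator norm), and an invertible real $d\times d$ matrix $b$. $\|f\|_p=(\int_{\mathbb{R}^d}|f|^p\,dx)^{1/p}$, and $L^p(\mathbb{R}^d)$ has the metric $d_p(f,g)=\|f-g\|_p^p$. $\ell^p(\mathbb{Z}_+\times\mathbb{Z}^d)$ is the space of sequences $c=\{c_{j,k}\}_{j>0,k\in\mathbb{Z}^d}$ with $\sum_{j>0}\sum_{k}|c_{j,k}|^p<\infty$. For $\psi\in L^p(\mathbb{R}^d)$, $\psi_{j,k}(x)=|\det a_j|^{1/p}\psi(a_jx-bk)$, and the synthesis operator is $S_\psi c=\sum_{j>0}\sum_{k\in\mathbb{Z}^d}c_{j,k}\psi_{j,k}$ (the series converges absolutely a.e. to a function in $L^p$ for $c\in\ell^p(\mathbb{Z}_+\times\mathbb{Z}^d)$). *)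

theory Defs
  imports "HOL-Analysis.Analysis"
begin

definition Lp_funs :: "real \<Rightarrow> ('a::euclidean_space \<Rightarrow> complex) set" where
  "Lp_funs p = {f \<in> borel_measurable lebesgue. integrable lebesgue (\<lambda>x. norm (f x) powr p)}"

definition Lp_norm :: "real \<Rightarrow> ('a::euclidean_space \<Rightarrow> complex) \<Rightarrow> real" where
  "Lp_norm p f = (\<integral>x. norm (f x) powr p \<partial>lebesgue) powr (1 / p)"

definition Lp_rel :: "real \<Rightarrow> (('a::euclidean_space \<Rightarrow> complex) \<times> ('a \<Rightarrow> complex)) set" where
  "Lp_rel p = {(f, g). f \<in> Lp_funs p \<and> g \<in> Lp_funs p \<and> (AE x in lebesgue. f x = g x)}"

text \<open>For a function \<open>f\<close> outside \<open>Lp_funs p\<close> the class below is the empty set, which is not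
  an element of \<open>Lp p\<close>.\<close>

definition Lp_class ::
    "real \<Rightarrow> ('a::euclidean_space \<Rightarrow> complex) \<Rightarrow> ('a \<Rightarrow> complex) set" where
  "Lp_class p f = Lp_rel p `` {f}"

definition Lp :: "real \<Rightarrow> ('a::euclidean_space \<Rightarrow> complex) set set" where
  "Lp p = Lp_funs p // Lp_rel p"

definition Lp_rep :: "('a::euclidean_space \<Rightarrow> complex) set \<Rightarrow> 'a \<Rightarrow> complex" where
  "Lp_rep F = (SOME f. f \<in> F)"

definition Lp_dist ::
    "real \<Rightarrow> ('a::euclidean_space \<Rightarrow> complex) set \<Rightarrow> ('a \<Rightarrow> complex) set \<Rightarrow> real" where
  "Lp_dist p F G = Lp_norm p (\<lambda>x. Lp_rep F x - Lp_rep G x) powr p"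

definition Lp_topology :: "real \<Rightarrow> ('a::euclidean_space \<Rightarrow> complex) set topology" where
  "Lp_topology p = Metric_space.mtopology (Lp p) (Lp_dist p)"

definition index_set :: "(nat \<times> (int ^ 'n)) set" where
  "index_set = {0<..} \<times> UNIV"

text \<open>The values of a sequence outside \<open>index_set\<close> (at scale \<open>0\<close>) are unconstrained; they do not
  enter \<open>synthesis\<close>.\<close>

definition lp_seqs :: "real \<Rightarrow> (nat \<times> (int ^ 'n) \<Rightarrow> complex) set" where
  "lp_seqs p = {c. (\<lambda>i. norm (c i) powr p) summable_on index_set}"

definition int_vec :: "int ^ 'n \<Rightarrow> real ^ 'n" where
  "int_vec k = (\<chi> i. real_of_int (k $ i))"

definition dilate_translate ::
    "real \<Rightarrow> (nat \<Rightarrow> real ^ 'n ^ 'n) \<Rightarrow> real ^ 'n ^ 'n \<Rightarrow> (real ^ 'n::finite \<Rightarrow> complex) \<Rightarrow>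
      nat \<times> (int ^ 'n) \<Rightarrow> real ^ 'n \<Rightarrow> complex" where
  "dilate_translate p a b \<psi> = (\<lambda>(j, k) x.
     of_real (\<bar>det (a j)\<bar> powr (1 / p)) * \<psi> (a j *v x - b *v int_vec k))"

text \<open>For complex numbers, unconditional summability over \<open>index_set\<close> is absolute summability;
  at points where it fails, the value of the infinite sum is \<open>0\<close>.\<close>

definition synthesis_fun ::
    "real \<Rightarrow> (nat \<Rightarrow> real ^ 'n ^ 'n) \<Rightarrow> real ^ 'n ^ 'n \<Rightarrow> (real ^ 'n::finite \<Rightarrow> complex) \<Rightarrow>
      (nat \<times> (int ^ 'n) \<Rightarrow> complex) \<Rightarrow> real ^ 'n \<Rightarrow> complex" where
  "synthesis_fun p a b \<psi> c x = (\<Sum>\<^sub>\<infinity>i\<in>index_set. c i * dilate_translate p a b \<psi> i x)"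

definition synthesis ::
    "real \<Rightarrow> (nat \<Rightarrow> real ^ 'n ^ 'n) \<Rightarrow> real ^ 'n ^ 'n \<Rightarrow> (real ^ 'n::finite \<Rightarrow> complex) set \<Rightarrow>
      (nat \<times> (int ^ 'n) \<Rightarrow> complex) \<Rightarrow> (real ^ 'n \<Rightarrow> complex) set" where
  "synthesis p a b \<Psi> c = Lp_class p (synthesis_fun p a b (Lp_rep \<Psi>) c)"

definition synthesis_onto ::
    "real \<Rightarrow> (nat \<Rightarrow> real ^ 'n ^ 'n) \<Rightarrow> real ^ 'n ^ 'n \<Rightarrow> (real ^ 'n::finite \<Rightarrow> complex) set set" where
  "synthesis_onto p a b = {\<Psi> \<in> Lp p. synthesis p a b \<Psi> ` lp_seqs p = Lp p}"


text \<open>Independence of the choice of representatives (in particular of \<open>synthesis_fun\<close>, up to null sets), and \<open>Lp_dist p\<close> is a metric for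
  \<open>0 < p \<le> 1\<close>.\<close>

lemma equiv_Lp_rel: "equiv (Lp_funs p) (Lp_rel p)"
proof (rule equivI)
  show "Lp_rel p \<subseteq> Lp_funs p \<times> Lp_funs p" by (auto simp: Lp_rel_def)
  show "refl_on (Lp_funs p) (Lp_rel p)" by (auto simp: refl_on_def Lp_rel_def)
  show "sym (Lp_rel p)"
    by (rule symI) (auto simp: Lp_rel_def elim: eventually_mono)
  show "trans (Lp_rel p)"
    by (rule transI) (auto simp: Lp_rel_def elim: eventually_elim2)
qed

lemma Lp_class_mem: "f \<in> Lp_funs p \<Longrightarrow> Lp_class p f \<in> Lp p"
  by (simp add: Lp_class_def Lp_def quotientI)

lemma Lp_class_eq_iff:
  "f \<in> Lp_funs p \<Longrightarrow> g \<in> Lp_funs p \<Longrightarrow> Lp_class p f = Lp_class p g \<longleftrightarrow> (AE x in lebesgue. f x = g x)"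
  using eq_equiv_class_iff[OF equiv_Lp_rel, of f p g] by (auto simp: Lp_class_def Lp_rel_def)

lemma Lp_rep_mem: "F \<in> Lp p \<Longrightarrow> Lp_rep F \<in> F"
  unfolding Lp_def Lp_rep_def
  by (metis equiv_Lp_rel in_quotient_imp_non_empty some_in_eq)

lemma Lp_rep_funs: "F \<in> Lp p \<Longrightarrow> Lp_rep F \<in> Lp_funs p"
  using Lp_rep_mem in_quotient_imp_subset[OF equiv_Lp_rel] unfolding Lp_def by blast

lemma Lp_class_rep: "F \<in> Lp p \<Longrightarrow> Lp_class p (Lp_rep F) = F"
  unfolding Lp_class_def using Lp_rep_mem Lp_def equiv_Lp_rel
  by (metis Image_singleton_iff equiv_class_eq quotientE)

lemma Lp_rep_class_AE:
  assumes "f \<in> Lp_funs p"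
  shows "AE x in lebesgue. Lp_rep (Lp_class p f) x = f x"
  using Lp_class_eq_iff[OF Lp_rep_funs[OF Lp_class_mem[OF assms]] assms]
    Lp_class_rep[OF Lp_class_mem[OF assms]] by simp

lemma Lp_dist_eq:
  assumes "0 < p"
  shows "Lp_dist p F G = (\<integral>x. norm (Lp_rep F x - Lp_rep G x) powr p \<partial>lebesgue)"
proof -
  have "(I powr (1 / p)) powr p = I" if "0 \<le> I" for I :: real
    using assms that by (simp only: powr_powr) simp
  then show ?thesis
    unfolding Lp_dist_def Lp_norm_def by (simp add: integral_nonneg_AE)
qed

lemma Lp_dist_class:
  assumes "0 < p" and f: "f \<in> Lp_funs p" and g: "g \<in> Lp_funs p"
  shows "Lp_dist p (Lp_class p f) (Lp_class p g) = (\<integral>x. norm (f x - g x) powr p \<partial>lebesgue)"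
proof -
  have [measurable]: "f \<in> borel_measurable lebesgue" "g \<in> borel_measurable lebesgue"
    "Lp_rep (Lp_class p f) \<in> borel_measurable lebesgue"
    "Lp_rep (Lp_class p g) \<in> borel_measurable lebesgue"
    using f g Lp_rep_funs[OF Lp_class_mem[OF f]] Lp_rep_funs[OF Lp_class_mem[OF g]]
    by (auto simp: Lp_funs_def)
  have "AE x in lebesgue. norm (Lp_rep (Lp_class p f) x - Lp_rep (Lp_class p g) x) powr p
      = norm (f x - g x) powr p"
    using Lp_rep_class_AE[OF f] Lp_rep_class_AE[OF g] by eventually_elim simp
  then show ?thesis
    unfolding Lp_dist_eq[OF \<open>0 < p\<close>] by (intro integral_cong_AE) measurable
qed

lemma powr_subadditive:
  fixes x y p :: real
  assumes "0 < p" "p \<le> 1" "0 \<le> x" "0 \<le> y"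
  shows "(x + y) powr p \<le> x powr p + y powr p"
proof (cases "x + y = 0")
  case True
  then show ?thesis using assms by simp
next
  case False
  define s where "s = x + y"
  have s: "s > 0" using False assms by (simp add: s_def)
  have le: "u \<le> u powr p" if "0 \<le> u" "u \<le> 1" for u :: real
    using powr_mono'[of p 1 u] that assms by (cases "u = 0") auto
  have "1 = x / s + y / s" using s by (simp add: s_def add_divide_distrib[symmetric])
  also have "\<dots> \<le> (x / s) powr p + (y / s) powr p"
    using s assms by (intro add_mono le) (auto simp: s_def)
  also have "\<dots> = (x powr p + y powr p) / s powr p"
    using s assms by (simp add: powr_divide add_divide_distrib)
  finally show ?thesis using s by (simp add: s_def field_simps)
qed

lemma Lp_funs_diff:
  assumes p: "0 < p" "p \<le> 1" and f: "f \<in> Lp_funs p" and g: "g \<in> Lp_funs p"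
  shows "(\<lambda>x. f x - g x) \<in> Lp_funs p"
proof -
  have m[measurable]: "f \<in> borel_measurable lebesgue" "g \<in> borel_measurable lebesgue"
    using f g by (auto simp: Lp_funs_def)
  have le: "norm (f x - g x) powr p \<le> norm (f x) powr p + norm (g x) powr p" for x
  proof -
    have "norm (f x - g x) powr p \<le> (norm (f x) + norm (g x)) powr p"
      using p by (intro powr_mono2 norm_triangle_ineq4) auto
    also have "\<dots> \<le> norm (f x) powr p + norm (g x) powr p"
      using p by (intro powr_subadditive) auto
    finally show ?thesis .
  qed
  have "integrable lebesgue (\<lambda>x. norm (f x) powr p + norm (g x) powr p)"
    using f g by (simp add: Lp_funs_def)
  then have "integrable lebesgue (\<lambda>x. norm (f x - g x) powr p)"
  proof (rule Bochner_Integration.integrable_bound)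
    show "(\<lambda>x. norm (f x - g x) powr p) \<in> borel_measurable lebesgue" by measurable
    show "AE x in lebesgue. norm (norm (f x - g x) powr p)
        \<le> norm (norm (f x) powr p + norm (g x) powr p)"
      using le by (intro AE_I2) simp
  qed
  moreover have "(\<lambda>x. f x - g x) \<in> borel_measurable lebesgue" by measurable
  ultimately show ?thesis by (simp add: Lp_funs_def)
qed

lemma Metric_space_Lp:
  assumes p: "0 < p" "p \<le> 1"
  shows "Metric_space (Lp p :: ('a::euclidean_space \<Rightarrow> complex) set set) (Lp_dist p)"
proof
  fix F G :: "('a \<Rightarrow> complex) set"
  show "0 \<le> Lp_dist p F G" by (simp add: Lp_dist_def)
  show "Lp_dist p F G = Lp_dist p G F"
    by (simp add: Lp_dist_def Lp_norm_def norm_minus_commute)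
next
  fix F G :: "('a \<Rightarrow> complex) set"
  assume F: "F \<in> Lp p" and G: "G \<in> Lp p"
  note FG = Lp_rep_funs[OF F] Lp_rep_funs[OF G]
  have "Lp_dist p F G = 0 \<longleftrightarrow> (AE x in lebesgue. norm (Lp_rep F x - Lp_rep G x) powr p = 0)"
    unfolding Lp_dist_eq[OF p(1)]
    using Lp_funs_diff[OF p FG] by (intro integral_nonneg_eq_0_iff_AE) (auto simp: Lp_funs_def)
  also have "\<dots> \<longleftrightarrow> (AE x in lebesgue. Lp_rep F x = Lp_rep G x)" by simp
  also have "\<dots> \<longleftrightarrow> F = G"
    using Lp_class_eq_iff[OF FG] Lp_class_rep[OF F] Lp_class_rep[OF G] by simp
  finally show "Lp_dist p F G = 0 \<longleftrightarrow> F = G" .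
next
  fix F G H :: "('a \<Rightarrow> complex) set"
  assume F: "F \<in> Lp p" and G: "G \<in> Lp p" and H: "H \<in> Lp p"
  let ?f = "Lp_rep F" and ?g = "Lp_rep G" and ?h = "Lp_rep H"
  have int: "integrable lebesgue (\<lambda>x. norm (?f x - ?g x) powr p)"
    "integrable lebesgue (\<lambda>x. norm (?g x - ?h x) powr p)"
    "integrable lebesgue (\<lambda>x. norm (?f x - ?h x) powr p)"
    using Lp_funs_diff[OF p Lp_rep_funs[OF F] Lp_rep_funs[OF G]]
      Lp_funs_diff[OF p Lp_rep_funs[OF G] Lp_rep_funs[OF H]]
      Lp_funs_diff[OF p Lp_rep_funs[OF F] Lp_rep_funs[OF H]]
    by (simp_all add: Lp_funs_def)
  have le: "norm (?f x - ?h x) powr p \<le> norm (?f x - ?g x) powr p + norm (?g x - ?h x) powr p" for x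
  proof -
    have "norm (?f x - ?h x) powr p \<le> (norm (?f x - ?g x) + norm (?g x - ?h x)) powr p"
      using p norm_triangle_ineq[of "?f x - ?g x" "?g x - ?h x"] by (intro powr_mono2) auto
    also have "\<dots> \<le> norm (?f x - ?g x) powr p + norm (?g x - ?h x) powr p"
      using p by (intro powr_subadditive) auto
    finally show ?thesis .
  qed
  have "(\<integral>x. norm (?f x - ?h x) powr p \<partial>lebesgue)
      \<le> (\<integral>x. norm (?f x - ?g x) powr p + norm (?g x - ?h x) powr p \<partial>lebesgue)"
    by (intro integral_mono int le Bochner_Integration.integrable_add)
  then show "Lp_dist p F H \<le> Lp_dist p F G + Lp_dist p G H"
    using int by (simp add: Lp_dist_eq[OF p(1)])
qed

lemma topspace_Lp_topology: "0 < p \<Longrightarrow> p \<le> 1 \<Longrightarrow> topspace (Lp_topology p) = Lp p"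
  by (simp add: Lp_topology_def Metric_space.topspace_mtopology[OF Metric_space_Lp])

lemma AE_lebesgue_affine:
  fixes A :: "real ^ 'n ^ 'n" and v :: "real ^ 'n::finite"
  assumes A: "invertible A" and P: "AE y in lebesgue. P y"
  shows "AE x in lebesgue. P (A *v x - v)"
proof -
  obtain N where N: "negligible N" "{y. \<not> P y} \<subseteq> N"
    using P by (auto simp: eventually_ae_filter_negligible)
  obtain B where B: "B ** A = mat 1"
    using A by (auto simp: invertible_def)
  let ?N = "(*v) B ` ((+) v ` N)"
  have "negligible ?N"
    using N(1) by (intro negligible_differentiable_image_negligible[OF order_refl]
        negligible_translation linear_imp_differentiable_on matrix_vector_mul_linear)
  moreover have "{x. \<not> P (A *v x - v)} \<subseteq> ?N"
  proof safe
    fix x assume "\<not> P (A *v x - v)"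
    then have "A *v x - v \<in> N" using N(2) by auto
    then have "A *v x \<in> (+) v ` N" by (intro image_eqI[of _ _ "A *v x - v"]) auto
    moreover have "x = B *v (A *v x)"
      by (simp add: matrix_vector_mul_assoc B)
    ultimately show "x \<in> ?N" by (rule image_eqI[rotated])
  qed
  ultimately show ?thesis by (auto simp: eventually_ae_filter_negligible)
qed

lemma countable_index_set: "countable (index_set :: (nat \<times> (int ^ 'n::finite)) set)"
proof -
  have "inj (\<lambda>k :: int ^ 'n. \<lambda>i. k $ i)" by (auto simp: inj_def vec_eq_iff fun_eq_iff)
  moreover have "countable (UNIV :: ('n \<Rightarrow> int) set)" by simp
  ultimately have "countable (UNIV :: (int ^ 'n) set)"
    by (meson countable_image_inj_on countable_subset subset_UNIV)
  then show ?thesis unfolding index_set_def by (intro countable_SIGMA) auto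
qed

lemma synthesis_fun_cong_AE:
  fixes a :: "nat \<Rightarrow> real ^ 'n ^ 'n::finite"
  assumes a: "\<And>j. j > 0 \<Longrightarrow> invertible (a j)" and eq: "AE x in lebesgue. \<psi> x = \<phi> x"
  shows "AE x in lebesgue. synthesis_fun p a b \<psi> c x = synthesis_fun p a b \<phi> c x"
proof -
  have "AE x in lebesgue. dilate_translate p a b \<psi> i x = dilate_translate p a b \<phi> i x"
    if i_in: "i \<in> index_set" for i
  proof -
    obtain j k where i: "i = (j, k)" "j > 0" using i_in by (auto simp: index_set_def)
    show ?thesis
      using AE_lebesgue_affine[OF a[OF i(2)] eq, of "b *v int_vec k"]
      by (rule eventually_mono) (simp add: i dilate_translate_def)
  qed
  then have "AE x in lebesgue. \<forall>i\<in>index_set.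
      dilate_translate p a b \<psi> i x = dilate_translate p a b \<phi> i x"
    by (simp add: AE_ball_countable[OF countable_index_set])
  then show ?thesis
    by eventually_elim (auto simp: synthesis_fun_def intro!: infsum_cong)
qed

end

theory Submission
  imports Defs
begin

text \<open>
  Call \<open>\<psi>\<close> approximately onto if every \<open>f\<close> has coefficients \<open>c\<close> with \<open>\<parallel>c\<parallel>\<^sup>p \<le> C \<parallel>f\<parallel>\<^sup>p\<close> and
  \<open>\<parallel>f - S c\<parallel>\<^sup>p \<le> \<delta> \<parallel>f\<parallel>\<^sup>p\<close>, where \<open>\<delta> < 1\<close>. Since \<open>\<parallel>S c\<parallel>\<^sup>p \<le> \<parallel>c\<parallel>\<^sup>p \<parallel>\<psi>\<parallel>\<^sup>p\<close>, iterating shows that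
  such \<open>\<psi>\<close> are onto, and Baire's theorem in the complete space \<open>L\<^sup>p\<close> gives the converse. The
  approximate property survives small perturbations of \<open>\<psi>\<close>, which is openness.

  A bounded \<open>\<psi>\<close> of bounded support with nonzero integral is approximately onto: sampling a continuous
  \<open>h\<close> on a fine lattice produces \<open>S c \<approx> z h P(a\<^sub>j \<cdot>)\<close> with \<open>P\<close> the periodization of \<open>\<psi>\<close>, and for a suitable
  small complex \<open>z\<close> the mean of \<open>\<bar>1 - z P\<bar>\<^sup>p\<close> is below \<open>1\<close>. These functions are dense. A segment inside a
  ball joins any \<open>\<psi>\<close> to one of them, and two of them are joined by a segment of constant integral
  followed by a rescaling through nonzero complex numbers.
\<close>

section \<open>Linear change of variables\<close>


text \<open>For \<open>p < 1\<close> the space is not locally convex, so duality gives no access to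
  surjectivity. What is available is subadditivity of \<open>t powr p\<close>: it makes the p-th
  power of the norm a translation-invariant metric and bounds a synthesis without any decay or
  cancellation of \<open>\<psi>\<close>. Openness needs surjectivity in quantitative form, since
  bare surjectivity says nothing about nearby functions; hence the detour through Baire.

  The dilated periodization oscillates faster and faster as \<open>j\<close> grows, so against a
  fixed \<open>h\<close> only its distribution over one period matters. The proof does not pass to
  this limit: \<open>h\<close> is replaced by samples that are constant on lattice cells, and then
  the p-th power integral factors exactly into a sum over cells and an integral over one cell.

  A nonzero integral is not a stable condition for \<open>p < 1\<close>, where the integral is not
  continuous in the metric. It serves to produce members of the class and to move between them: the
  nonzero complex numbers are path connected, the nonzero reals are not, so complex coefficients
  matter for the last path.\<close>

lemma measure_shear_cbox:
  fixes a b :: "real^'n"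
  assumes "m \<noteq> n"
  shows "measure lebesgue ((\<lambda>x. \<chi> i. if i = m then x$m + x$n else x$i) ` cbox a b)
    = measure lebesgue (cbox a b)"
proof (cases "cbox a b = {}")
  case False
  let ?f = "\<lambda>x::real^'n. \<chi> i. if i = m then x$m + x$n else x$i"
  \<comment> \<open>A linear map sends translates to translates, so the lower corner may be moved to
    \<open>0\<close>, where the sign condition of \<open>measure_shear_interval\<close>
    holds.\<close>
  have ab: "cbox a b = (+) a ` cbox 0 (b - a)"
    using cbox_translation[of a 0 "b - a"] by simp
  have "?f ` cbox a b = (+) (?f a) ` ?f ` cbox 0 (b - a)"
    unfolding ab image_image by (intro image_cong refl) (auto simp: vec_eq_iff)
  then have "measure lebesgue (?f ` cbox a b) = measure lebesgue (?f ` cbox 0 (b - a))"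
    by (simp only: measure_translation)
  also have "\<dots> = measure lebesgue (cbox 0 (b - a))"
    using False ab by (intro measure_shear_interval assms) auto
  also have "\<dots> = measure lebesgue (cbox a b)"
    by (simp only: ab measure_translation)
  finally show ?thesis .
qed simp

lemma measure_swap_cbox:
  fixes a b :: "real^'n"
  shows "measure lebesgue ((\<lambda>x. \<chi> i. x $ Transposition.transpose m n i) ` cbox a b)
    = measure lebesgue (cbox a b)"
proof (cases "cbox a b = {}")
  case False
  let ?t = "Transposition.transpose m n" and ?h = "\<lambda>x::real^'n. \<chi> i. x $ Transposition.transpose m n i"
  have inv: "?h (?h x) = x" for x
    by (simp add: vec_eq_iff)
  have perm: "(\<forall>i. P (?t i)) \<longleftrightarrow> (\<forall>i. P i)" for P
    by (metis transpose_involutory)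
  have "?h ` cbox a b = cbox (?h a) (?h b)"
  proof (rule equalityI; rule subsetI)
    fix y assume "y \<in> cbox (?h a) (?h b)"
    then have "?h y \<in> cbox a b"
      using perm[of "\<lambda>i. a $ i \<le> y $ ?t i \<and> y $ ?t i \<le> b $ i"] by (simp add: mem_box_cart)
    then show "y \<in> ?h ` cbox a b" by (intro image_eqI[of _ _ "?h y"]) (auto simp: inv)
  qed (auto simp: mem_box_cart)
  moreover have "(\<Prod>i\<in>UNIV. b $ ?t i - a $ ?t i) = (\<Prod>i\<in>UNIV. b $ i - a $ i)"
    by (rule prod.reindex_bij_betw) simp
  moreover have "cbox (?h a) (?h b) \<noteq> {}"
    using False calculation(1) by (metis image_is_empty)
  ultimately show ?thesis using False by (simp add: content_cbox_cart)
qed simp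

text \<open>The library has this for well-ordered index types only.\<close>

lemma measure_linear_image_det:
  fixes f :: "real^'n \<Rightarrow> real^'n"
  assumes "linear f" and "S \<in> lmeasurable"
  shows "f ` S \<in> lmeasurable \<and> measure lebesgue (f ` S) = \<bar>det (matrix f)\<bar> * measure lebesgue S"
proof -
  let ?P = "\<lambda>f::real^'n \<Rightarrow> real^'n. \<forall>S\<in>lmeasurable. f ` S \<in> lmeasurable \<and>
    measure lebesgue (f ` S) = \<bar>det (matrix f)\<bar> * measure lebesgue S"
  \<comment> \<open>For the volume-preserving generators, the swap and the shear, boxes suffice:
    \<open>measure_linear_sufficient\<close> passes from boxes to all measurable sets.\<close>
  have unimodular: "?P f" if "linear f" "\<bar>det (matrix f)\<bar> = 1"
    "\<And>a b. measure lebesgue (f ` cbox a b) = measure lebesgue (cbox a b)" for f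
  proof (intro ballI)
    fix S :: "(real^'n) set" assume "S \<in> lmeasurable"
    then have "f ` S \<in> lmeasurable \<and> 1 * measure lebesgue S = measure lebesgue (f ` S)"
      using measure_linear_sufficient[OF that(1), of S 1] that(3) by auto
    then show "f ` S \<in> lmeasurable \<and> measure lebesgue (f ` S) = \<bar>det (matrix f)\<bar> * measure lebesgue S"
      by (simp only: that(2) mult_1)
  qed
  have "?P f"
  proof (rule induct_linear_elementary[OF \<open>linear f\<close>])
    fix f g :: "real^'n \<Rightarrow> real^'n"
    assume "linear f" "linear g" "?P f" "?P g"
    then show "?P (f \<circ> g)"
      unfolding image_comp[symmetric] by (simp add: matrix_compose det_mul abs_mult)
  next
    fix f :: "real^'n \<Rightarrow> real^'n" and i
    assume f: "linear f" and "\<And>x. f x $ i = 0"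
    then have ninj: "\<not> inj f"
      by (metis linear_injective_imp_surjective one_neq_zero surjE vec_component)
    have "negligible (f ` S)" for S
      using negligible_linear_singular_image[OF f ninj] .
    moreover have "det (matrix f) = 0"
      using det_nz_iff_inj[OF f] ninj by blast
    ultimately show "?P f"
      by (simp add: negligible_iff_measure)
  next
    fix c :: "'n \<Rightarrow> real"
    show "?P (\<lambda>x. \<chi> i. c i * x $ i)"
      by (simp add: measurable_stretch measure_stretch matrix_def axis_def det_diagonal)
  next
    fix m n :: 'n assume "m \<noteq> n"
    let ?h = "\<lambda>x::real^'n. \<chi> i. x $ Transposition.transpose m n i"
    have "matrix ?h = (\<chi> i. mat 1 $ Transposition.transpose m n i)"
      by (simp add: matrix_def axis_def mat_def vec_eq_iff)
    then have "\<bar>det (matrix ?h)\<bar> = 1"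
      by (simp add: det_permute_rows permutes_swap_id sign_swap_id abs_mult)
    moreover have "linear ?h" by (rule linearI) (simp_all add: vec_eq_iff)
    ultimately show "?P ?h" by (intro unimodular measure_swap_cbox)
  next
    fix m n :: 'n assume mn: "m \<noteq> n"
    let ?h = "\<lambda>x::real^'n. \<chi> i. if i = m then x$m + x$n else x$i"
    have "matrix ?h = (\<chi> k. if k = m then row m (mat 1) + 1 *s row n (mat 1) else row k (mat 1))"
      using mn by (auto simp: matrix_def axis_def mat_def vec_eq_iff row_def)
    then have "\<bar>det (matrix ?h)\<bar> = 1"
      by (simp only: det_row_operation[OF mn]) simp
    moreover have "linear ?h" by (rule linearI) (simp_all add: vec_eq_iff algebra_simps)
    ultimately show "?P ?h" by (intro unimodular measure_shear_cbox mn)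
  qed
  with assms show ?thesis by blast
qed

lemma matrix_inv_mult:
  fixes A :: "real^'n^'n"
  assumes "invertible A"
  shows "A ** matrix_inv A = mat 1" "matrix_inv A ** A = mat 1"
  using someI_ex[OF assms[unfolded invertible_def]] unfolding matrix_inv_def by simp_all

lemma matrix_inv_mult_vec:
  fixes A :: "real^'n^'n"
  assumes "invertible A"
  shows "matrix_inv A *v (A *v x) = x" "A *v (matrix_inv A *v x) = x"
  using matrix_inv_mult[OF assms] by (simp_all add: matrix_vector_mul_assoc)

lemma det_matrix_inv:
  fixes A :: "real^'n^'n"
  assumes "invertible A"
  shows "det (matrix_inv A) = 1 / det A"
proof -
  have "det A * det (matrix_inv A) = 1"
    using matrix_inv_mult(1)[OF assms] by (metis det_I det_mul)
  moreover from this have "det A \<noteq> 0" by auto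
  ultimately show ?thesis
    by (simp add: field_simps)
qed

text \<open>Both measures agree on open boxes, which determine \<open>lborel\<close>: the preimage
  of a box is its translate by \<open>v\<close> carried along by \<open>matrix_inv A\<close>, and
  the determinant of the inverse cancels the scaling factor.\<close>

lemma distr_lborel_affine:
  fixes A :: "real^'n^'n"
  assumes A: "invertible A"
  shows "lborel = scale_measure (ennreal \<bar>det A\<bar>) (distr lborel borel (\<lambda>x. A *v x - v))"
proof (rule lborel_eqI)
  let ?T = "\<lambda>x. A *v x - v"
  have det: "det A \<noteq> 0" using A invertible_det_nz by blast
  fix l u :: "real^'n" assume le: "\<And>i. i \<in> Basis \<Longrightarrow> l \<bullet> i \<le> u \<bullet> i"
  have T[measurable]: "?T \<in> borel_measurable borel"
    by (intro borel_measurable_continuous_onI continuous_intros)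
  have vimage: "?T -` box l u = (*v) (matrix_inv A) ` ((+) v ` box l u)"
  proof (rule equalityI; rule subsetI)
    fix x assume "x \<in> ?T -` box l u"
    then show "x \<in> (*v) (matrix_inv A) ` ((+) v ` box l u)"
      by (intro image_eqI[of _ _ "A *v x"] image_eqI[of _ _ "A *v x - v"]) (auto simp: matrix_inv_mult_vec[OF A])
  qed (auto simp: matrix_inv_mult_vec[OF A])
  have "(+) v ` box l u \<in> lmeasurable" by (simp add: measurable_translation)
  from measure_linear_image_det[OF matrix_vector_mul_linear this, of "matrix_inv A"]
  have lm: "?T -` box l u \<in> lmeasurable"
    and m: "measure lebesgue (?T -` box l u) = \<bar>1 / det A\<bar> * measure lebesgue (box l u)"
    by (simp_all add: vimage measure_translation det_matrix_inv[OF A])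
  have sb: "?T -` box l u \<in> sets borel"
    using measurable_sets[OF T, of "box l u"] by simp
  have "emeasure lborel (?T -` box l u) = emeasure lebesgue (?T -` box l u)"
    using sb by simp
  also have "\<dots> = ennreal (\<bar>1 / det A\<bar> * measure lebesgue (box l u))"
    using lm by (simp add: emeasure_eq_measure2 m)
  finally have em: "emeasure lborel (?T -` box l u) = ennreal (\<bar>1 / det A\<bar> * measure lebesgue (box l u))" .
  have "emeasure (scale_measure (ennreal \<bar>det A\<bar>) (distr lborel borel ?T)) (box l u)
      = ennreal \<bar>det A\<bar> * emeasure lborel (?T -` box l u)"
    by (simp add: emeasure_distr)
  also have "\<dots> = ennreal (measure lebesgue (box l u))"
    unfolding em using det by (subst ennreal_mult[symmetric]) (auto simp: abs_mult[symmetric])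
  also have "\<dots> = (\<Prod>b\<in>Basis. (u - l) \<bullet> b)"
    using le by simp
  finally show "emeasure (scale_measure (ennreal \<bar>det A\<bar>) (distr lborel borel ?T)) (box l u)
      = (\<Prod>b\<in>Basis. (u - l) \<bullet> b)" .
qed simp

section \<open>The functional \<open>\<parallel>f\<parallel>\<^sup>p\<close>\<close>


text \<open>Measurability between completions takes more than continuity: preimages of null sets
  must be null as well, which is what \<open>AE_lebesgue_affine\<close> says in terms of almost
  every point.\<close>

lemma affine_measurable_lebesgue:
  fixes A :: "real^'n^'n"
  assumes A: "invertible A"
  shows "(\<lambda>x. A *v x - v) \<in> lebesgue \<rightarrow>\<^sub>M lebesgue"
proof (rule completion.measurable_completion2)
  let ?T = "\<lambda>x. A *v x - v"
  have T: "?T \<in> borel_measurable borel"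
    by (intro borel_measurable_continuous_onI continuous_intros)
  then show Tl: "?T \<in> lebesgue \<rightarrow>\<^sub>M lborel"
    by (simp add: measurable_completion)
  show "null_sets lborel \<subseteq> null_sets (distr lebesgue lborel ?T)"
  proof
    fix S :: "(real^'n) set" assume S: "S \<in> null_sets lborel"
    then have "AE y in lebesgue. y \<notin> S"
      by (simp add: AE_completion AE_not_in)
    from AE_lebesgue_affine[OF A this, of v] have "AE x in lebesgue. ?T x \<notin> S" .
    then have "AE y in distr lebesgue lborel ?T. y \<notin> S"
      using Tl S by (subst AE_distr_iff) (auto simp: null_sets_def)
    then show "S \<in> null_sets (distr lebesgue lborel ?T)"
      using S by (subst AE_iff_null_sets) (auto simp: null_sets_def)
  qed
qed

text \<open>The change of variables for \<open>lborel\<close> applies to a Borel function equal to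
  \<open>g\<close> almost everywhere; invertibility of \<open>A\<close> keeps the exceptional set
  null after the substitution.\<close>

lemma nn_integral_lebesgue_affine:
  fixes A :: "real^'n^'n" and g :: "real^'n \<Rightarrow> ennreal"
  assumes A: "invertible A" and g: "g \<in> borel_measurable lebesgue"
  shows "ennreal \<bar>det A\<bar> * (\<integral>\<^sup>+x. g (A *v x - v) \<partial>lebesgue) = (\<integral>\<^sup>+x. g x \<partial>lebesgue)"
proof -
  let ?T = "\<lambda>x. A *v x - v"
  have T: "?T \<in> borel_measurable borel"
    by (intro borel_measurable_continuous_onI continuous_intros)
  obtain g' where g': "g' \<in> borel_measurable lborel" "AE x in lborel. g x = g' x"
    using completion_ex_borel_measurable[OF g] by blast
  then have AE: "AE x in lebesgue. g x = g' x" by (simp add: AE_completion)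
  have "(\<integral>\<^sup>+x. g x \<partial>lebesgue) = (\<integral>\<^sup>+x. g' x \<partial>lborel)"
    using nn_integral_cong_AE[OF AE] by (simp add: nn_integral_completion)
  also have "\<dots> = ennreal \<bar>det A\<bar> * (\<integral>\<^sup>+x. g' x \<partial>distr lborel borel ?T)"
    using g' by (subst distr_lborel_affine[OF A, of v]) (subst nn_integral_scale_measure, auto)
  also have "(\<integral>\<^sup>+x. g' x \<partial>distr lborel borel ?T) = (\<integral>\<^sup>+x. g' (?T x) \<partial>lebesgue)"
    using g' T by (subst nn_integral_distr) (auto simp: nn_integral_completion)
  also have "\<dots> = (\<integral>\<^sup>+x. g (?T x) \<partial>lebesgue)"
    using AE_lebesgue_affine[OF A AE, of v] by (intro nn_integral_cong_AE) auto
  finally show ?thesis by simp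
qed

text \<open>The p-th power of the p-norm, extended real valued: estimates for infinite sums can be
  written before finiteness is known, and for \<open>p \<le> 1\<close> it is this quantity that is
  subadditive.\<close>

definition Lp_int :: "real \<Rightarrow> ('a::euclidean_space \<Rightarrow> complex) \<Rightarrow> ennreal" where
  "Lp_int p f = (\<integral>\<^sup>+x. ennreal (norm (f x) powr p) \<partial>lebesgue)"

lemma Lp_funs_iff: "f \<in> Lp_funs p \<longleftrightarrow> f \<in> borel_measurable lebesgue \<and> Lp_int p f < \<infinity>"
  by (auto simp: Lp_funs_def Lp_int_def integrable_iff_bounded)

lemma Lp_funs_measurable [measurable_dest]: "f \<in> Lp_funs p \<Longrightarrow> f \<in> borel_measurable lebesgue"
  by (simp add: Lp_funs_iff)

lemma Lp_int_finite: "f \<in> Lp_funs p \<Longrightarrow> Lp_int p f < \<infinity>"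
  by (simp add: Lp_funs_iff)

lemma Lp_int_eq_integral:
  "f \<in> Lp_funs p \<Longrightarrow> Lp_int p f = ennreal (\<integral>x. norm (f x) powr p \<partial>lebesgue)"
  unfolding Lp_int_def by (intro nn_integral_eq_integral) (auto simp: Lp_funs_def)

lemma Lp_int_cong_AE: "AE x in lebesgue. f x = g x \<Longrightarrow> Lp_int p f = Lp_int p g"
  unfolding Lp_int_def by (intro nn_integral_cong_AE) (auto elim: eventually_mono)

lemma Lp_int_mono:
  "0 \<le> p \<Longrightarrow> (\<And>x. norm (f x) \<le> norm (g x)) \<Longrightarrow> Lp_int p f \<le> Lp_int p g"
  unfolding Lp_int_def by (intro nn_integral_mono) (auto intro!: ennreal_leI powr_mono2)

lemma Lp_int_cmult:
  assumes [measurable]: "f \<in> borel_measurable lebesgue"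
  shows "Lp_int p (\<lambda>x. z * f x) = ennreal (norm z powr p) * Lp_int p f"
  unfolding Lp_int_def by (subst nn_integral_cmult[symmetric]) (auto simp: norm_mult powr_mult ennreal_mult)

lemma Lp_int_uminus: "Lp_int p (\<lambda>x. - f x) = Lp_int p f"
  by (simp add: Lp_int_def)

lemma Lp_int_minus_commute: "Lp_int p (\<lambda>x. f x - g x) = Lp_int p (\<lambda>x. g x - f x)"
  by (simp add: Lp_int_def norm_minus_commute)

section \<open>Subadditivity for finite and infinite sums\<close>

lemma norm_add_powr_le:
  fixes x y :: complex
  assumes "0 < p" "p \<le> 1"
  shows "norm (x + y) powr p \<le> norm x powr p + norm y powr p"
proof -
  have "norm (x + y) powr p \<le> (norm x + norm y) powr p"
    using assms by (intro powr_mono2 norm_triangle_ineq) auto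
  also have "\<dots> \<le> norm x powr p + norm y powr p"
    using assms by (intro powr_subadditive) auto
  finally show ?thesis .
qed

lemma norm_sum_powr_le:
  fixes f :: "'i \<Rightarrow> complex"
  assumes "0 < p" "p \<le> 1"
  shows "norm (\<Sum>i\<in>F. f i) powr p \<le> (\<Sum>i\<in>F. norm (f i) powr p)"
proof (induction F rule: infinite_finite_induct)
  case (insert i F)
  then show ?case
    using norm_add_powr_le[OF assms, of "f i" "sum f F"] by simp
qed auto

lemma Lp_int_add_le:
  assumes "0 < p" "p \<le> 1" and [measurable]: "f \<in> borel_measurable lebesgue" "g \<in> borel_measurable lebesgue"
  shows "Lp_int p (\<lambda>x. f x + g x) \<le> Lp_int p f + Lp_int p g"
proof -
  have "Lp_int p (\<lambda>x. f x + g x) \<le> (\<integral>\<^sup>+x. ennreal (norm (f x) powr p) + ennreal (norm (g x) powr p) \<partial>lebesgue)"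
    unfolding Lp_int_def using norm_add_powr_le[OF assms(1,2)]
    by (intro nn_integral_mono) (auto simp flip: ennreal_plus intro!: ennreal_leI)
  also have "\<dots> = Lp_int p f + Lp_int p g"
    unfolding Lp_int_def by (intro nn_integral_add) auto
  finally show ?thesis .
qed

lemma Lp_int_triangle:
  assumes "0 < p" "p \<le> 1" and [measurable]: "f \<in> borel_measurable lebesgue"
    "g \<in> borel_measurable lebesgue" "h \<in> borel_measurable lebesgue"
  shows "Lp_int p (\<lambda>x. f x - h x) \<le> Lp_int p (\<lambda>x. f x - g x) + Lp_int p (\<lambda>x. g x - h x)"
  using Lp_int_add_le[OF assms(1,2), of "\<lambda>x. f x - g x" "\<lambda>x. g x - h x"] by simp

lemma Lp_int_sum_le:
  assumes "0 < p" "p \<le> 1" and "\<And>i. i \<in> F \<Longrightarrow> f i \<in> borel_measurable lebesgue"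
  shows "Lp_int p (\<lambda>x. \<Sum>i\<in>F. f i x) \<le> (\<Sum>i\<in>F. Lp_int p (f i))"
proof -
  have "Lp_int p (\<lambda>x. \<Sum>i\<in>F. f i x) \<le> (\<integral>\<^sup>+x. (\<Sum>i\<in>F. ennreal (norm (f i x) powr p)) \<partial>lebesgue)"
    unfolding Lp_int_def using norm_sum_powr_le[OF assms(1,2)]
    by (intro nn_integral_mono) (auto intro!: ennreal_leI)
  also have "\<dots> = (\<Sum>i\<in>F. Lp_int p (f i))"
    unfolding Lp_int_def using assms(3) by (intro nn_integral_sum) measurable
  finally show ?thesis .
qed

text \<open>Finite subsums satisfy the bound by subadditivity and converge to the sum. Without
  summability \<open>infsum\<close> is \<open>0\<close>, and the bound is trivial.\<close>

lemma norm_infsum_powr_le: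
  fixes f :: "'i \<Rightarrow> complex"
  assumes p: "0 < p" "p \<le> 1"
  shows "ennreal (norm (infsum f A) powr p) \<le> (\<integral>\<^sup>+i. ennreal (norm (f i) powr p) \<partial>count_space A)"
proof (cases "f summable_on A")
  case True
  have fin: "ennreal (norm (sum f F) powr p) \<le> (\<integral>\<^sup>+i. ennreal (norm (f i) powr p) \<partial>count_space A)"
    if "finite F" "F \<subseteq> A" for F
  proof -
    have "ennreal (norm (sum f F) powr p) \<le> ennreal (\<Sum>i\<in>F. norm (f i) powr p)"
      by (intro ennreal_leI norm_sum_powr_le p)
    also have "\<dots> = (\<integral>\<^sup>+i. ennreal (norm (f i) powr p) \<partial>count_space F)"
      using that by (simp add: nn_integral_count_space_finite)
    also have "\<dots> = (\<integral>\<^sup>+i. ennreal (norm (f i) powr p) * indicator F i \<partial>count_space A)"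
      using that by (subst nn_integral_restrict_space[symmetric]) (auto simp: restrict_count_space inf.absorb1 inf.absorb2)
    also have "\<dots> \<le> (\<integral>\<^sup>+i. ennreal (norm (f i) powr p) \<partial>count_space A)"
      by (intro nn_integral_mono) (auto split: split_indicator)
    finally show ?thesis .
  qed
  have "((\<lambda>F. ennreal (norm (sum f F) powr p)) \<longlongrightarrow> ennreal (norm (infsum f A) powr p)) (finite_subsets_at_top A)"
    using p by (intro tendsto_ennrealI tendsto_powr' tendsto_norm infsum_tendsto True tendsto_const) auto
  moreover have "\<forall>\<^sub>F F in finite_subsets_at_top A. ennreal (norm (sum f F) powr p)
      \<le> (\<integral>\<^sup>+i. ennreal (norm (f i) powr p) \<partial>count_space A)"
    by (rule eventually_finite_subsets_at_top_weakI) (use fin in auto)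
  ultimately show ?thesis
    by (rule tendsto_upperbound) simp
qed (simp add: infsum_not_exists)

text \<open>Here \<open>p \<le> 1\<close> enters: the p-th power of a finite sum of norms is at most
  the sum of the p-th powers, so finite p-mass forces absolute summability.\<close>

lemma summable_on_of_powr:
  fixes f :: "'i \<Rightarrow> complex"
  assumes p: "0 < p" "p \<le> 1" and fin: "(\<integral>\<^sup>+i. ennreal (norm (f i) powr p) \<partial>count_space A) < \<infinity>"
  shows "f summable_on A"
proof -
  obtain r where r: "(\<integral>\<^sup>+i. ennreal (norm (f i) powr p) \<partial>count_space A) = ennreal r" "0 \<le> r"
    using fin by (cases "\<integral>\<^sup>+i. ennreal (norm (f i) powr p) \<partial>count_space A") auto
  have "(\<Sum>i\<in>F. norm (f i)) \<le> r powr (1/p)" if F: "finite F" "F \<subseteq> A" for F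
  proof -
    have "ennreal (\<Sum>i\<in>F. norm (f i) powr p) = (\<integral>\<^sup>+i. ennreal (norm (f i) powr p) * indicator F i \<partial>count_space A)"
      using F by (subst nn_integral_restrict_space[symmetric])
        (auto simp: restrict_count_space inf.absorb1 inf.absorb2 nn_integral_count_space_finite)
    also have "\<dots> \<le> ennreal r"
      unfolding r(1)[symmetric] by (intro nn_integral_mono) (auto split: split_indicator)
    finally have le: "(\<Sum>i\<in>F. norm (f i) powr p) \<le> r"
      using r(2) by simp
    have "(\<Sum>i\<in>F. norm (f i)) powr p \<le> r"
      using norm_sum_powr_le[OF p, of "\<lambda>i. of_real (norm (f i))" F] le
      by (simp flip: of_real_sum add: sum_nonneg)
    then have "((\<Sum>i\<in>F. norm (f i)) powr p) powr (1/p) \<le> r powr (1/p)"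
      using p by (intro powr_mono2) auto
    then show ?thesis
      using p by (simp add: powr_powr sum_nonneg)
  qed
  then have "(\<lambda>i. norm (f i)) summable_on A"
    by (intro nonneg_bdd_above_summable_on bdd_aboveI2) auto
  then show ?thesis by (rule abs_summable_summable)
qed

text \<open>Both sides take the default value \<open>0\<close> where summability fails. The identity
  makes measurability of parametrised integrals available for infinite sums.\<close>

lemma infsum_eq_count_space_integral:
  fixes f :: "'i \<Rightarrow> complex"
  shows "infsum f A = (\<integral>i. f i \<partial>count_space A)"
proof (cases "f summable_on A")
  case True
  then have "(\<lambda>x. norm (f x)) summable_on A"
    by (simp add: summable_on_iff_abs_summable_on_complex)
  then show ?thesis
    using infsetsum_infsum[of f A] by (simp add: abs_summable_equivalent infsetsum_def)
next
  case False
  then have "\<not> integrable (count_space A) f"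
    by (simp add: summable_on_iff_abs_summable_on_complex abs_summable_equivalent abs_summable_on_def)
  then show ?thesis
    using False by (simp add: infsum_not_exists not_integrable_integral_eq)
qed

lemma borel_measurable_infsum:
  fixes f :: "'i \<Rightarrow> 'a \<Rightarrow> complex"
  assumes A: "countable A" and f: "\<And>i. i \<in> A \<Longrightarrow> f i \<in> borel_measurable M"
  shows "(\<lambda>x. \<Sum>\<^sub>\<infinity>i\<in>A. f i x) \<in> borel_measurable M"
proof -
  interpret sigma_finite_measure "count_space A"
    using A by (rule sigma_finite_measure_count_space_countable)
  have "(\<lambda>(i, x). f i x) \<in> borel_measurable (count_space A \<Otimes>\<^sub>M M)"
    using f by (intro measurable_pair_measure_countable1 A) auto
  from measurable_compose[OF measurable_pair_swap' this]
  have "case_prod (\<lambda>x i. f i x) \<in> borel_measurable (M \<Otimes>\<^sub>M count_space A)"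
    by (simp add: case_prod_unfold)
  then show ?thesis
    unfolding infsum_eq_count_space_integral by (rule borel_measurable_lebesgue_integral)
qed

lemma Lp_int_infsum_le:
  fixes f :: "'i \<Rightarrow> 'a::euclidean_space \<Rightarrow> complex"
  assumes p: "0 < p" "p \<le> 1" and A: "countable A"
    and f[measurable]: "\<And>i. i \<in> A \<Longrightarrow> f i \<in> borel_measurable lebesgue"
  shows "Lp_int p (\<lambda>x. \<Sum>\<^sub>\<infinity>i\<in>A. f i x) \<le> (\<integral>\<^sup>+i. Lp_int p (f i) \<partial>count_space A)"
proof -
  have "Lp_int p (\<lambda>x. \<Sum>\<^sub>\<infinity>i\<in>A. f i x)
      \<le> (\<integral>\<^sup>+x. \<integral>\<^sup>+i. ennreal (norm (f i x) powr p) \<partial>count_space A \<partial>lebesgue)"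
    unfolding Lp_int_def by (intro nn_integral_mono norm_infsum_powr_le p)
  also have "\<dots> = (\<integral>\<^sup>+i. Lp_int p (f i) \<partial>count_space A)"
    unfolding Lp_int_def using A by (intro nn_integral_count_space_nn_integral) auto
  finally show ?thesis .
qed

text \<open>By Tonelli the p-masses at the points \<open>x\<close> have finite integral, hence are
  finite almost everywhere, and finite p-mass implies summability.\<close>

lemma AE_summable_on_of_Lp_int:
  fixes f :: "'i \<Rightarrow> 'a::euclidean_space \<Rightarrow> complex"
  assumes p: "0 < p" "p \<le> 1" and A: "countable A"
    and f[measurable]: "\<And>i. i \<in> A \<Longrightarrow> f i \<in> borel_measurable lebesgue"
    and fin: "(\<integral>\<^sup>+i. Lp_int p (f i) \<partial>count_space A) < \<infinity>"
  shows "AE x in lebesgue. (\<lambda>i. f i x) summable_on A"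
proof -
  have eq: "(\<integral>\<^sup>+x. \<integral>\<^sup>+i. ennreal (norm (f i x) powr p) \<partial>count_space A \<partial>lebesgue)
      = (\<integral>\<^sup>+i. Lp_int p (f i) \<partial>count_space A)"
    unfolding Lp_int_def using A by (intro nn_integral_count_space_nn_integral) auto
  interpret sigma_finite_measure "count_space A"
    using A by (rule sigma_finite_measure_count_space_countable)
  have "(\<lambda>(i, x). ennreal (norm (f i x) powr p)) \<in> borel_measurable (count_space A \<Otimes>\<^sub>M lebesgue)"
    using f by (intro measurable_pair_measure_countable1 A) auto
  from measurable_compose[OF measurable_pair_swap' this]
  have m: "case_prod (\<lambda>x i. ennreal (norm (f i x) powr p)) \<in> borel_measurable (lebesgue \<Otimes>\<^sub>M count_space A)"
    by (simp add: case_prod_unfold)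
  have "AE x in lebesgue. (\<integral>\<^sup>+i. ennreal (norm (f i x) powr p) \<partial>count_space A) \<noteq> \<infinity>"
    using fin by (intro nn_integral_PInf_AE borel_measurable_nn_integral m) (auto simp: eq)
  then show ?thesis
    by eventually_elim (rule summable_on_of_powr[OF p], simp add: less_top)
qed

section \<open>The synthesis operator\<close>


definition seq_int :: "real \<Rightarrow> (nat \<times> (int ^ 'n) \<Rightarrow> complex) \<Rightarrow> ennreal" where
  "seq_int p c = (\<integral>\<^sup>+i. ennreal (norm (c i) powr p) \<partial>count_space index_set)"

lemma lp_seqs_iff: "c \<in> lp_seqs p \<longleftrightarrow> seq_int p c < \<infinity>"
proof -
  have "c \<in> lp_seqs p \<longleftrightarrow> (\<lambda>i. norm (norm (c i) powr p)) summable_on index_set"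
    by (simp add: lp_seqs_def)
  also have "\<dots> \<longleftrightarrow> integrable (count_space index_set) (\<lambda>i. norm (c i) powr p)"
    unfolding abs_summable_equivalent abs_summable_on_def ..
  also have "\<dots> \<longleftrightarrow> seq_int p c < \<infinity>"
    by (simp add: integrable_iff_bounded seq_int_def)
  finally show ?thesis .
qed

lemma seq_int_cmult: "seq_int p (\<lambda>i. z * c i) = ennreal (norm z powr p) * seq_int p c"
  unfolding seq_int_def by (subst nn_integral_cmult[symmetric]) (auto simp: norm_mult powr_mult ennreal_mult)

lemma seq_int_diff_le:
  assumes "0 < p" "p \<le> 1"
  shows "seq_int p (\<lambda>i. c i - d i) \<le> seq_int p c + seq_int p d"
proof -
  have "norm (c i - d i) powr p \<le> norm (c i) powr p + norm (d i) powr p" for i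
    using norm_add_powr_le[OF assms, of "c i" "- d i"] by simp
  then have "seq_int p (\<lambda>i. c i - d i)
      \<le> (\<integral>\<^sup>+i. ennreal (norm (c i) powr p) + ennreal (norm (d i) powr p) \<partial>count_space index_set)"
    unfolding seq_int_def by (intro nn_integral_mono) (auto simp flip: ennreal_plus intro!: ennreal_leI)
  also have "\<dots> = seq_int p c + seq_int p d"
    unfolding seq_int_def by (intro nn_integral_add) auto
  finally show ?thesis .
qed

lemma synthesis_fun_cmult: "synthesis_fun p a b \<psi> (\<lambda>i. z * c i) x = z * synthesis_fun p a b \<psi> c x"
  by (simp add: synthesis_fun_def mult.assoc infsum_cmult_right')

locale affine_system =
  fixes a :: "nat \<Rightarrow> real ^ 'n ^ 'n" and b :: "real ^ 'n ^ 'n" and p :: real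
  assumes inv: "\<And>j. j > 0 \<Longrightarrow> invertible (a j)"
    and p: "0 < p" "p \<le> 1"
begin

abbreviation S :: "(real ^ 'n \<Rightarrow> complex) \<Rightarrow> (nat \<times> (int ^ 'n) \<Rightarrow> complex) \<Rightarrow> real ^ 'n \<Rightarrow> complex"
  where "S \<equiv> synthesis_fun p a b"

lemma dilate_translate_measurable:
  assumes "i \<in> index_set" "\<psi> \<in> borel_measurable lebesgue"
  shows "dilate_translate p a b \<psi> i \<in> borel_measurable lebesgue"
proof -
  obtain j k where i: "i = (j, k)" "j > 0"
    using assms by (auto simp: index_set_def)
  have "(\<lambda>x. \<psi> (a j *v x - b *v int_vec k)) \<in> borel_measurable lebesgue"
    using measurable_compose[OF affine_measurable_lebesgue[OF inv[OF i(2)]] assms(2)] .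
  then show ?thesis by (simp add: i dilate_translate_def)
qed

text \<open>The factor \<open>\<bar>det (a j)\<bar> powr (1 / p)\<close> in the dilates cancels the
  Jacobian, so every dilated translate has the size of \<open>\<psi>\<close>.\<close>

lemma Lp_int_dilate_translate:
  assumes "i \<in> index_set" and [measurable]: "\<psi> \<in> borel_measurable lebesgue"
  shows "Lp_int p (dilate_translate p a b \<psi> i) = Lp_int p \<psi>"
proof -
  obtain j k where i: "i = (j, k)" "j > 0"
    using assms by (auto simp: index_set_def)
  have [measurable]: "(\<lambda>x. \<psi> (a j *v x - b *v int_vec k)) \<in> borel_measurable lebesgue"
    using measurable_compose[OF affine_measurable_lebesgue[OF inv[OF i(2)]] assms(2)] .
  have "Lp_int p (dilate_translate p a b \<psi> i)
      = ennreal \<bar>det (a j)\<bar> * Lp_int p (\<lambda>x. \<psi> (a j *v x - b *v int_vec k))"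
    using p by (simp add: i dilate_translate_def Lp_int_cmult powr_powr)
  also have "\<dots> = Lp_int p \<psi>"
    unfolding Lp_int_def
    by (rule nn_integral_lebesgue_affine[OF inv[OF i(2)], of "\<lambda>y. ennreal (norm (\<psi> y) powr p)"]) measurable
  finally show ?thesis .
qed

lemma synthesis_fun_measurable:
  assumes [measurable]: "\<psi> \<in> borel_measurable lebesgue"
  shows "S \<psi> c \<in> borel_measurable lebesgue"
  unfolding synthesis_fun_def
  by (intro borel_measurable_infsum countable_index_set borel_measurable_times
      dilate_translate_measurable assms) auto

lemma nn_integral_term:
  assumes [measurable]: "\<psi> \<in> borel_measurable lebesgue"
  shows "(\<integral>\<^sup>+i. Lp_int p (\<lambda>x. c i * dilate_translate p a b \<psi> i x) \<partial>count_space index_set)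
    = seq_int p c * Lp_int p \<psi>"
proof -
  have "(\<integral>\<^sup>+i. Lp_int p (\<lambda>x. c i * dilate_translate p a b \<psi> i x) \<partial>count_space index_set)
    = (\<integral>\<^sup>+i. ennreal (norm (c i) powr p) * Lp_int p \<psi> \<partial>count_space index_set)"
    by (intro nn_integral_cong)
      (simp add: Lp_int_cmult dilate_translate_measurable Lp_int_dilate_translate assms)
  then show ?thesis
    by (simp add: seq_int_def nn_integral_multc)
qed

lemma Lp_int_synthesis_le:
  assumes [measurable]: "\<psi> \<in> borel_measurable lebesgue"
  shows "Lp_int p (S \<psi> c) \<le> seq_int p c * Lp_int p \<psi>"
  unfolding synthesis_fun_def nn_integral_term[OF assms, symmetric]
  by (intro Lp_int_infsum_le p countable_index_set borel_measurable_times
      dilate_translate_measurable assms) auto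

lemma synthesis_fun_Lp:
  assumes "\<psi> \<in> Lp_funs p" "seq_int p c < \<infinity>"
  shows "S \<psi> c \<in> Lp_funs p"
  using Lp_int_synthesis_le[of \<psi> c] assms
  by (auto simp: Lp_funs_iff synthesis_fun_measurable ennreal_mult_less_top intro: le_less_trans)

lemma AE_synthesis_summable:
  assumes "\<psi> \<in> Lp_funs p" "seq_int p c < \<infinity>"
  shows "AE x in lebesgue. (\<lambda>i. c i * dilate_translate p a b \<psi> i x) summable_on index_set"
proof (rule AE_summable_on_of_Lp_int[OF p countable_index_set])
  show "(\<integral>\<^sup>+i. Lp_int p (\<lambda>x. c i * dilate_translate p a b \<psi> i x) \<partial>count_space index_set) < \<infinity>"
    using assms by (simp add: nn_integral_term Lp_funs_iff ennreal_mult_less_top)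
qed (use assms in \<open>auto intro!: borel_measurable_times dilate_translate_measurable simp: Lp_funs_iff\<close>)

lemma AE_synthesis_add:
  assumes "\<psi> \<in> Lp_funs p" "seq_int p c < \<infinity>" "seq_int p d < \<infinity>"
    and e: "\<And>i. i \<in> index_set \<Longrightarrow> e i = c i + d i"
  shows "AE x in lebesgue. S \<psi> e x = S \<psi> c x + S \<psi> d x"
  using AE_synthesis_summable[OF assms(1,2)] AE_synthesis_summable[OF assms(1,3)]
proof eventually_elim
  case (elim x)
  have "S \<psi> e x = (\<Sum>\<^sub>\<infinity>i\<in>index_set. c i * dilate_translate p a b \<psi> i x + d i * dilate_translate p a b \<psi> i x)"
    unfolding synthesis_fun_def by (intro infsum_cong) (simp add: e algebra_simps)
  with elim show ?case by (simp add: infsum_add synthesis_fun_def)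
qed

lemma AE_synthesis_diff_synthesizer:
  assumes "\<psi> \<in> Lp_funs p" "\<phi> \<in> Lp_funs p" "seq_int p c < \<infinity>"
  shows "AE x in lebesgue. S \<psi> c x = S \<phi> c x + S (\<lambda>y. \<psi> y - \<phi> y) c x"
  using AE_synthesis_summable[OF assms(2,3)]
    AE_synthesis_summable[OF Lp_funs_diff[OF p assms(1,2)] assms(3)]
proof eventually_elim
  case (elim x)
  have "S \<psi> c x = (\<Sum>\<^sub>\<infinity>i\<in>index_set. c i * dilate_translate p a b \<phi> i x
      + c i * dilate_translate p a b (\<lambda>y. \<psi> y - \<phi> y) i x)"
    unfolding synthesis_fun_def
    by (intro infsum_cong) (simp add: dilate_translate_def case_prod_unfold algebra_simps)
  with elim show ?case by (simp add: infsum_add synthesis_fun_def)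
qed

text \<open>Surjectivity on the level of representatives; \<open>synthesis_onto_iff\<close> makes
  the link with equivalence classes.\<close>

definition onto :: "(real ^ 'n \<Rightarrow> complex) \<Rightarrow> bool" where
  "onto \<psi> \<longleftrightarrow> (\<forall>f\<in>Lp_funs p. \<exists>c. seq_int p c < \<infinity> \<and> (AE x in lebesgue. S \<psi> c x = f x))"

definition approx_onto :: "(real ^ 'n \<Rightarrow> complex) \<Rightarrow> bool" where
  "approx_onto \<psi> \<longleftrightarrow> (\<exists>C \<delta>. 0 \<le> C \<and> 0 \<le> \<delta> \<and> \<delta> < 1 \<and> (\<forall>f\<in>Lp_funs p. \<exists>c.
     seq_int p c \<le> ennreal C * Lp_int p f \<and>
     Lp_int p (\<lambda>x. f x - S \<psi> c x) \<le> ennreal \<delta> * Lp_int p f))"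

section \<open>Successive approximation and stability under perturbation\<close>

lemma seq_int_infsum_le:
  "countable A \<Longrightarrow> seq_int p (\<lambda>i. \<Sum>\<^sub>\<infinity>m\<in>A. c m i) \<le> (\<integral>\<^sup>+m. seq_int p (c m) \<partial>count_space A)"
  unfolding seq_int_def
  by (subst nn_integral_count_space_nn_integral[symmetric])
    (auto intro!: nn_integral_mono norm_infsum_powr_le p)

text \<open>The coefficients of the successive approximations of the remainders add up to coefficients
  of \<open>f\<close> itself.\<close>

lemma approx_onto_imp_onto:
  assumes \<psi>: "\<psi> \<in> Lp_funs p" and approx: "approx_onto \<psi>"
  shows "onto \<psi>"
  unfolding onto_def
proof
  fix f :: "real ^ 'n \<Rightarrow> complex" assume f: "f \<in> Lp_funs p"
  obtain C \<delta> where C: "0 \<le> C" and \<delta>: "0 \<le> \<delta>" "\<delta> < 1"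
    and ex: "\<forall>f\<in>Lp_funs p. \<exists>c. seq_int p c \<le> ennreal C * Lp_int p f \<and>
      Lp_int p (\<lambda>x. f x - S \<psi> c x) \<le> ennreal \<delta> * Lp_int p f"
    using approx unfolding approx_onto_def by blast
  then obtain pick where pick: "\<And>f. f \<in> Lp_funs p \<Longrightarrow> seq_int p (pick f) \<le> ennreal C * Lp_int p f"
      "\<And>f. f \<in> Lp_funs p \<Longrightarrow> Lp_int p (\<lambda>x. f x - S \<psi> (pick f) x) \<le> ennreal \<delta> * Lp_int p f"
    by metis
  \<comment> \<open>\<open>r n\<close> is what is left of \<open>f\<close> after \<open>n\<close>
    rounds of approximation.\<close>
  define r where "r = rec_nat f (\<lambda>_ g x. g x - S \<psi> (pick g) x)"
  have r0: "r 0 = f" and rS: "r (Suc n) = (\<lambda>x. r n x - S \<psi> (pick (r n)) x)" for n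
    by (simp_all add: r_def)
  obtain I where I: "Lp_int p f = ennreal I" "0 \<le> I"
    using Lp_int_finite[OF f] by (cases "Lp_int p f") auto
  obtain P where P: "Lp_int p \<psi> = ennreal P" "0 \<le> P"
    using Lp_int_finite[OF \<psi>] by (cases "Lp_int p \<psi>") auto
  have r: "r n \<in> Lp_funs p \<and> Lp_int p (r n) \<le> ennreal (\<delta> ^ n * I)" for n
  proof (induction n)
    case 0
    then show ?case by (simp add: r0 f I)
  next
    case (Suc n)
    have "Lp_int p (r (Suc n)) \<le> ennreal \<delta> * Lp_int p (r n)"
      unfolding rS using Suc by (intro pick) auto
    also have "\<dots> \<le> ennreal \<delta> * ennreal (\<delta> ^ n * I)"
      using Suc by (intro mult_left_mono) auto
    also have "\<dots> = ennreal (\<delta> ^ Suc n * I)"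
      using \<delta> I by (simp add: ennreal_mult'[symmetric] mult.assoc)
    finally have le: "Lp_int p (r (Suc n)) \<le> ennreal (\<delta> ^ Suc n * I)" .
    moreover have "r (Suc n) \<in> borel_measurable lebesgue"
      unfolding rS using Suc \<psi>
      by (intro borel_measurable_diff synthesis_fun_measurable) (auto simp: Lp_funs_iff)
    ultimately show ?case
      by (auto simp: Lp_funs_iff intro: le_less_trans)
  qed
  define c where "c n = pick (r n)" for n
  have c: "seq_int p (c n) \<le> ennreal (C * (\<delta> ^ n * I))" for n
  proof -
    have "seq_int p (c n) \<le> ennreal C * Lp_int p (r n)"
      unfolding c_def using r by (intro pick) auto
    also have "\<dots> \<le> ennreal C * ennreal (\<delta> ^ n * I)"
      using r by (intro mult_left_mono) auto
    finally show ?thesis using C by (simp add: ennreal_mult'[symmetric])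
  qed
  \<comment> \<open>\<open>d n\<close> collects the coefficients of all rounds from \<open>n\<close>
    on. Splitting off one round at a time gives
    \<open>f - S \<psi> (d 0) = r n - S \<psi> (d n)\<close> from additivity of \<open>S\<close> for
    two sequences, so \<open>S\<close> is never exchanged with an infinite sum of sequences.\<close>
  define d where "d n i = (\<Sum>\<^sub>\<infinity>m\<in>{n..}. c m i)" for n i
  have tail: "(\<integral>\<^sup>+m. seq_int p (c m) \<partial>count_space {n..}) \<le> ennreal (C * I * \<delta> ^ n / (1 - \<delta>))" for n
  proof -
    have "(\<integral>\<^sup>+m. seq_int p (c m) \<partial>count_space {n..}) = (\<integral>\<^sup>+m. seq_int p (c (m + n)) \<partial>count_space UNIV)"
      by (rule nn_integral_bij_count_space[symmetric], rule bij_betwI[of _ _ _ "\<lambda>m. m - n"]) auto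
    also have "\<dots> \<le> (\<integral>\<^sup>+m. ennreal (C * I * \<delta> ^ n * \<delta> ^ m) \<partial>count_space UNIV)"
      by (intro nn_integral_mono order_trans[OF c]) (simp add: power_add mult_ac)
    also have "\<dots> = ennreal (C * I * \<delta> ^ n * (1 / (1 - \<delta>)))"
      unfolding nn_integral_count_space_nat using C I \<delta>
      by (intro suminf_ennreal_eq sums_mult geometric_sums) auto
    finally show ?thesis by simp
  qed
  have d: "seq_int p (d n) \<le> ennreal (C * I * \<delta> ^ n / (1 - \<delta>))" for n
    unfolding d_def by (rule order_trans[OF seq_int_infsum_le tail]) simp
  then have dfin: "seq_int p (d n) < \<infinity>" for n
    by (rule le_less_trans) simp
  have d_split: "d n i = c n i + d (Suc n) i" if i: "i \<in> index_set" for n i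
  proof -
    have "(\<integral>\<^sup>+m. ennreal (norm (c m i) powr p) \<partial>count_space {Suc n..})
        \<le> (\<integral>\<^sup>+m. seq_int p (c m) \<partial>count_space {Suc n..})"
      unfolding seq_int_def using i by (intro nn_integral_mono nn_integral_ge_point)
    also have "\<dots> < \<infinity>" using tail by (rule le_less_trans) simp
    finally have "(\<lambda>m. c m i) summable_on {Suc n..}"
      by (rule summable_on_of_powr[OF p])
    moreover have "{n..} = insert n {Suc n..}" by auto
    ultimately show ?thesis
      by (simp add: d_def infsum_insert)
  qed
  have AE: "AE x in lebesgue. f x - S \<psi> (d 0) x = r n x - S \<psi> (d n) x" for n
  proof (induction n)
    case (Suc n)
    have "seq_int p (c n) < \<infinity>" using c by (rule le_less_trans) simp
    then have "AE x in lebesgue. S \<psi> (d n) x = S \<psi> (c n) x + S \<psi> (d (Suc n)) x"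
      by (rule AE_synthesis_add[OF \<psi> _ dfin d_split])
    with Suc show ?case
      by eventually_elim (simp add: rS c_def)
  qed (simp add: r0)
  have meas [measurable]: "f \<in> borel_measurable lebesgue" "S \<psi> (d n) \<in> borel_measurable lebesgue"
    "r n \<in> borel_measurable lebesgue" for n
    using f r \<psi> by (auto simp: Lp_funs_iff intro!: synthesis_fun_measurable)
  \<comment> \<open>The left side does not depend on \<open>n\<close>, while remainder and tail both
    decay like \<open>\<delta> ^ n\<close>; hence it vanishes.\<close>
  have "Lp_int p (\<lambda>x. f x - S \<psi> (d 0) x) \<le> ennreal (\<delta> ^ n * (I + C * I / (1 - \<delta>) * P))" for n
  proof -
    have "Lp_int p (\<lambda>x. f x - S \<psi> (d 0) x) = Lp_int p (\<lambda>x. r n x + - S \<psi> (d n) x)"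
      using AE[of n] by (intro Lp_int_cong_AE) simp
    also have "\<dots> \<le> Lp_int p (r n) + Lp_int p (\<lambda>x. - S \<psi> (d n) x)"
      by (intro Lp_int_add_le p) measurable
    also have "\<dots> \<le> ennreal (\<delta> ^ n * I) + seq_int p (d n) * Lp_int p \<psi>"
      using r \<psi> unfolding Lp_int_uminus by (intro add_mono Lp_int_synthesis_le) (auto simp: Lp_funs_iff)
    also have "\<dots> \<le> ennreal (\<delta> ^ n * I) + ennreal (C * I * \<delta> ^ n / (1 - \<delta>)) * ennreal P"
      unfolding P by (intro add_mono mult_right_mono d) auto
    also have "\<dots> = ennreal (\<delta> ^ n * (I + C * I / (1 - \<delta>) * P))"
      using C I P \<delta> by (simp flip: ennreal_mult' ennreal_plus add: algebra_simps)
    finally show ?thesis .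
  qed
  moreover have "(\<lambda>n. ennreal (\<delta> ^ n * (I + C * I / (1 - \<delta>) * P))) \<longlonglongrightarrow> ennreal (0 * (I + C * I / (1 - \<delta>) * P))"
    using \<delta> by (intro tendsto_ennrealI tendsto_mult tendsto_const LIMSEQ_power_zero) simp
  ultimately have "Lp_int p (\<lambda>x. f x - S \<psi> (d 0) x) \<le> ennreal (0 * (I + C * I / (1 - \<delta>) * P))"
    by (intro LIMSEQ_le_const) auto
  then have "AE x in lebesgue. ennreal (norm (f x - S \<psi> (d 0) x) powr p) = 0"
    unfolding Lp_int_def by (subst nn_integral_0_iff_AE[symmetric]) auto
  then have "AE x in lebesgue. S \<psi> (d 0) x = f x"
    by eventually_elim simp
  with dfin show "\<exists>c. seq_int p c < \<infinity> \<and> (AE x in lebesgue. S \<psi> c x = f x)"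
    by blast
qed

text \<open>The coefficients chosen for \<open>\<psi>\<close> serve \<open>\<phi>\<close> as well:
  \<open>S\<close> is linear in the synthesizer, so the exchange adds at most
  \<open>C * \<epsilon>\<close> to the contraction factor, and \<open>\<epsilon>\<close> is taken
  small enough to keep the total below \<open>1\<close>.\<close>

lemma approx_onto_stable:
  assumes \<psi>: "\<psi> \<in> Lp_funs p" and approx: "approx_onto \<psi>"
  obtains \<epsilon> where "0 < \<epsilon>"
    "\<And>\<phi>. \<phi> \<in> Lp_funs p \<Longrightarrow> Lp_int p (\<lambda>x. \<psi> x - \<phi> x) \<le> ennreal \<epsilon> \<Longrightarrow> approx_onto \<phi>"
proof -
  obtain C \<delta> where C: "0 \<le> C" and \<delta>: "0 \<le> \<delta>" "\<delta> < 1"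
    and ex: "\<forall>f\<in>Lp_funs p. \<exists>c. seq_int p c \<le> ennreal C * Lp_int p f \<and>
      Lp_int p (\<lambda>x. f x - S \<psi> c x) \<le> ennreal \<delta> * Lp_int p f"
    using approx unfolding approx_onto_def by blast
  define \<epsilon> where "\<epsilon> = (1 - \<delta>) / (C + 1)"
  have \<epsilon>: "0 < \<epsilon>" "\<delta> + C * \<epsilon> < 1"
    using C \<delta> by (auto simp: \<epsilon>_def field_simps)
  show thesis
  proof (rule that[OF \<epsilon>(1)])
    fix \<phi> assume \<phi>: "\<phi> \<in> Lp_funs p" and close: "Lp_int p (\<lambda>x. \<psi> x - \<phi> x) \<le> ennreal \<epsilon>"
    note [measurable] = Lp_funs_measurable[OF \<psi>] Lp_funs_measurable[OF \<phi>]
    have "\<exists>c. seq_int p c \<le> ennreal C * Lp_int p f \<and>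
        Lp_int p (\<lambda>x. f x - S \<phi> c x) \<le> ennreal (\<delta> + C * \<epsilon>) * Lp_int p f" if f: "f \<in> Lp_funs p" for f :: "real ^ 'n \<Rightarrow> complex"
    proof -
      note [measurable] = Lp_funs_measurable[OF f]
      obtain c where c: "seq_int p c \<le> ennreal C * Lp_int p f"
          "Lp_int p (\<lambda>x. f x - S \<psi> c x) \<le> ennreal \<delta> * Lp_int p f"
        using ex f by blast
      then have cfin: "seq_int p c < \<infinity>"
        using Lp_int_finite[OF f] by (auto simp: ennreal_mult_less_top intro: le_less_trans)
      have [measurable]: "S \<psi> c \<in> borel_measurable lebesgue" "S (\<lambda>y. \<psi> y - \<phi> y) c \<in> borel_measurable lebesgue"
        by (intro synthesis_fun_measurable; measurable)+
      have "Lp_int p (\<lambda>x. f x - S \<phi> c x) = Lp_int p (\<lambda>x. (f x - S \<psi> c x) + S (\<lambda>y. \<psi> y - \<phi> y) c x)"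
        using AE_synthesis_diff_synthesizer[OF \<psi> \<phi> cfin]
        by (intro Lp_int_cong_AE) (auto elim!: eventually_mono)
      also have "\<dots> \<le> Lp_int p (\<lambda>x. f x - S \<psi> c x) + Lp_int p (S (\<lambda>y. \<psi> y - \<phi> y) c)"
        by (intro Lp_int_add_le p) measurable
      also have "\<dots> \<le> ennreal \<delta> * Lp_int p f + seq_int p c * Lp_int p (\<lambda>x. \<psi> x - \<phi> x)"
        by (intro add_mono c Lp_int_synthesis_le) measurable
      also have "\<dots> \<le> ennreal \<delta> * Lp_int p f + (ennreal C * Lp_int p f) * ennreal \<epsilon>"
        by (intro add_mono mult_mono c close) auto
      also have "\<dots> = ennreal (\<delta> + C * \<epsilon>) * Lp_int p f"
        using C \<delta> \<epsilon> by (simp add: ennreal_mult' ring_distribs mult_ac)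
      finally show ?thesis using c(1) by blast
    qed
    then show "approx_onto \<phi>"
      unfolding approx_onto_def using C \<delta> \<epsilon> by (intro exI[of _ C] exI[of _ "\<delta> + C * \<epsilon>"]) auto
  qed
qed

end

section \<open>Completeness and the open mapping argument\<close>


lemma ennreal_Lp_dist:
  assumes "0 < p" "p \<le> 1" "F \<in> Lp p" "G \<in> Lp p"
  shows "ennreal (Lp_dist p F G) = Lp_int p (\<lambda>x. Lp_rep F x - Lp_rep G x)"
  using assms by (simp add: Lp_dist_eq Lp_int_eq_integral Lp_funs_diff Lp_rep_funs)

lemma ennreal_Lp_dist_class:
  assumes "0 < p" "p \<le> 1" "f \<in> Lp_funs p" "g \<in> Lp_funs p"
  shows "ennreal (Lp_dist p (Lp_class p f) (Lp_class p g)) = Lp_int p (\<lambda>x. f x - g x)"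
  using assms by (simp add: Lp_dist_class Lp_int_eq_integral Lp_funs_diff)

lemma Lp_dist_class_less_iff:
  assumes "0 < p" "p \<le> 1" "f \<in> Lp_funs p" "g \<in> Lp_funs p"
  shows "Lp_dist p (Lp_class p f) (Lp_class p g) < r \<longleftrightarrow> Lp_int p (\<lambda>x. f x - g x) < ennreal r"
  unfolding ennreal_Lp_dist_class[OF assms, symmetric]
  by (subst ennreal_less_iff) (auto simp: Lp_dist_def)

lemma Lp_funs_add:
  assumes "0 < p" "p \<le> 1" "f \<in> Lp_funs p" "g \<in> Lp_funs p"
  shows "(\<lambda>x. f x + g x) \<in> Lp_funs p"
  using Lp_int_add_le[OF assms(1,2), of f g] assms
  by (auto simp: Lp_funs_iff intro: le_less_trans)

lemma Lp_funs_cmult: "f \<in> Lp_funs p \<Longrightarrow> (\<lambda>x. z * f x) \<in> Lp_funs p"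
  by (auto simp: Lp_funs_iff Lp_int_cmult ennreal_mult_less_top)

lemma nn_integral_count_space_geometric_tail:
  assumes "\<And>m. g m \<le> ennreal ((1/2) ^ m)"
  shows "(\<integral>\<^sup>+m. g m \<partial>count_space {n..}) \<le> ennreal (2 * (1/2) ^ n)"
proof -
  have "(\<integral>\<^sup>+m. g m \<partial>count_space {n..}) = (\<integral>\<^sup>+m. g (m + n) \<partial>count_space UNIV)"
    by (rule nn_integral_bij_count_space[symmetric], rule bij_betwI[of _ _ _ "\<lambda>m. m - n"]) auto
  also have "\<dots> \<le> (\<integral>\<^sup>+m. ennreal ((1/2) ^ n * (1/2) ^ m) \<partial>count_space UNIV)"
    by (intro nn_integral_mono order_trans[OF assms]) (simp add: power_add mult_ac)
  also have "\<dots> = ennreal ((1/2) ^ n * (1 / (1 - 1/2)))"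
    unfolding nn_integral_count_space_nat
    by (intro suminf_ennreal_eq sums_mult geometric_sums) auto
  finally show ?thesis by (simp add: mult.commute)
qed

text \<open>The Riesz-Fischer argument in the p-th power metric: along a subsequence the increments
  have p-masses bounded by a geometric series, so they are summable almost everywhere, and the sum
  produces the limit \<open>h\<close>.\<close>

lemma Lp_mcomplete:
  fixes p :: real
  assumes p: "0 < p" "p \<le> 1"
  shows "Metric_space.mcomplete (Lp p :: ('a::euclidean_space \<Rightarrow> complex) set set) (Lp_dist p)"
proof -
  interpret Metric_space "Lp p :: ('a \<Rightarrow> complex) set set" "Lp_dist p"
    by (rule Metric_space_Lp[OF p])
  show ?thesis
    unfolding mcomplete_def
  proof (intro allI impI)
    fix \<sigma> :: "nat \<Rightarrow> ('a \<Rightarrow> complex) set" assume Cau: "MCauchy \<sigma>"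
    then have \<sigma>: "\<sigma> n \<in> Lp p" for n by (auto simp: MCauchy_def)
    have "\<exists>N. \<forall>m\<ge>N. \<forall>m'\<ge>N. Lp_dist p (\<sigma> m) (\<sigma> m') < (1/2) ^ n" for n
      using Cau unfolding MCauchy_def by (meson zero_less_power half_gt_zero zero_less_one)
    then obtain N where N: "\<And>n m m'. m \<ge> N n \<Longrightarrow> m' \<ge> N n \<Longrightarrow> Lp_dist p (\<sigma> m) (\<sigma> m') < (1/2) ^ n"
      by metis
    have "\<exists>r. \<forall>n. r n \<ge> N n \<and> r n < r (Suc n)"
    proof (rule dependent_nat_choice)
      fix x n show "\<exists>y. N (Suc n) \<le> y \<and> x < y"
        by (rule exI[of _ "N (Suc n) + Suc x"]) simp
    qed auto
    then obtain r where r: "\<And>n. r n \<ge> N n" "\<And>n. r n < r (Suc n)" by blast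
    then have mono: "strict_mono r" by (simp add: strict_mono_Suc_iff)
    define f where "f n = Lp_rep (\<sigma> (r n))" for n
    have f: "f n \<in> Lp_funs p" for n unfolding f_def by (intro Lp_rep_funs \<sigma>)
    note [measurable] = Lp_funs_measurable[OF f]
    define g where "g n x = f (Suc n) x - f n x" for n x
    have [measurable]: "g n \<in> borel_measurable lebesgue" for n unfolding g_def by measurable
    have g: "Lp_int p (g n) \<le> ennreal ((1/2) ^ n)" for n
    proof -
      have "Lp_dist p (\<sigma> (r (Suc n))) (\<sigma> (r n)) \<le> (1/2) ^ n"
        using r by (intro less_imp_le[OF N]) (meson less_imp_le order_trans)+
      then show ?thesis
        unfolding g_def f_def by (subst ennreal_Lp_dist[OF p \<sigma> \<sigma>, symmetric]) (rule ennreal_leI)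
    qed
    define h where "h x = f 0 x + (\<Sum>\<^sub>\<infinity>n\<in>UNIV. g n x)" for x
    have [measurable]: "(\<lambda>x. \<Sum>\<^sub>\<infinity>n\<in>A. g n x) \<in> borel_measurable lebesgue" for A
      by (intro borel_measurable_infsum) auto
    have tail: "Lp_int p (\<lambda>x. \<Sum>\<^sub>\<infinity>m\<in>{n..}. g m x) \<le> ennreal (2 * (1/2) ^ n)" for n
      by (rule order_trans[OF Lp_int_infsum_le[OF p] nn_integral_count_space_geometric_tail[OF g]]) auto
    have "AE x in lebesgue. (\<lambda>n. g n x) summable_on {0..}"
    proof (rule AE_summable_on_of_Lp_int[OF p])
      show "(\<integral>\<^sup>+n. Lp_int p (g n) \<partial>count_space {0..}) < \<infinity>"
        by (rule le_less_trans[OF nn_integral_count_space_geometric_tail[OF g]]) simp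
    qed auto
    \<comment> \<open>Telescoping: the difference between the limit and \<open>f n\<close> is a tail
      of the series of increments, whose size the geometric tail controls.\<close>
    then have AE: "AE x in lebesgue. h x - f n x = (\<Sum>\<^sub>\<infinity>m\<in>{n..}. g m x)" for n
    proof eventually_elim
      case (elim x)
      show ?case
      proof (induction n)
        case 0
        then show ?case by (simp add: h_def atLeast_0)
      next
        case (Suc n)
        have "(\<lambda>m. g m x) summable_on {Suc n..}"
          using elim by (rule summable_on_subset_banach) auto
        moreover have "{n..} = insert n {Suc n..}" by auto
        ultimately have "(\<Sum>\<^sub>\<infinity>m\<in>{n..}. g m x) = g n x + (\<Sum>\<^sub>\<infinity>m\<in>{Suc n..}. g m x)"
          by (simp add: infsum_insert)
        with Suc show ?case by (simp add: g_def algebra_simps)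
      qed
    qed
    then have le: "Lp_int p (\<lambda>x. h x - f n x) \<le> ennreal (2 * (1/2) ^ n)" for n
      using tail[of n] Lp_int_cong_AE[OF AE[of n]] by simp
    have "(\<lambda>x. \<Sum>\<^sub>\<infinity>n\<in>UNIV. g n x) \<in> Lp_funs p"
      using tail[of 0] by (auto simp: Lp_funs_iff atLeast_0 intro: le_less_trans)
    then have h: "h \<in> Lp_funs p"
      unfolding h_def by (intro Lp_funs_add p f)
    have dist: "Lp_dist p (\<sigma> (r n)) (Lp_class p h) \<le> 2 * (1/2) ^ n" for n
    proof -
      have "\<sigma> (r n) = Lp_class p (f n)" unfolding f_def by (simp add: Lp_class_rep \<sigma>)
      then have "ennreal (Lp_dist p (\<sigma> (r n)) (Lp_class p h)) \<le> ennreal (2 * (1/2) ^ n)"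
        using le[of n] by (simp add: ennreal_Lp_dist_class[OF p f h] Lp_int_minus_commute)
      then show ?thesis by (subst (asm) ennreal_le_iff) auto
    qed
    have "limitin mtopology (\<sigma> \<circ> r) (Lp_class p h) sequentially"
      unfolding limitin_metric
    proof (intro conjI allI impI)
      fix \<epsilon> :: real assume "0 < \<epsilon>"
      have "(\<lambda>n. 2 * (1/2) ^ n :: real) \<longlonglongrightarrow> 2 * 0"
        by (intro tendsto_mult tendsto_const LIMSEQ_power_zero) simp
      then have "\<forall>\<^sub>F n in sequentially. 2 * (1/2) ^ n < \<epsilon>"
        using \<open>0 < \<epsilon>\<close> by (intro order_tendstoD) auto
      then show "\<forall>\<^sub>F n in sequentially. (\<sigma> \<circ> r) n \<in> Lp p \<and> Lp_dist p ((\<sigma> \<circ> r) n) (Lp_class p h) < \<epsilon>"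
        by eventually_elim (auto simp: \<sigma> intro: le_less_trans[OF dist])
    qed (simp add: Lp_class_mem h)
    from MCauchy_convergent_subsequence[OF Cau mono this]
    show "\<exists>x. limitin mtopology \<sigma> x sequentially" by blast
  qed
qed

context affine_system
begin

text \<open>By Baire's theorem the closure of the image of some ball of coefficient sequences contains a
  ball; differences of two points of that closure then approximate every small function.\<close>

lemma onto_imp_almost_open:
  assumes \<psi>: "\<psi> \<in> Lp_funs p" and onto: "onto \<psi>"
  obtains r K where "0 < r" "0 \<le> K"
    "\<And>f \<epsilon>. f \<in> Lp_funs p \<Longrightarrow> Lp_int p f < ennreal r \<Longrightarrow> 0 < \<epsilon> \<Longrightarrow>
      \<exists>c. seq_int p c \<le> ennreal K \<and> Lp_int p (\<lambda>x. f x - S \<psi> c x) \<le> ennreal \<epsilon>"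
proof -
  interpret M: Metric_space "Lp p :: (real ^ 'n \<Rightarrow> complex) set set" "Lp_dist p"
    by (rule Metric_space_Lp[OF p])
  \<comment> \<open>Images of the balls of integer radius in the sequence space. Surjectivity makes
    them cover the whole space, so the closure of one of them has an interior point.\<close>
  define T where "T n = (\<lambda>c. Lp_class p (S \<psi> c)) ` {c. seq_int p c \<le> ennreal (real n)}" for n :: nat
  have fin: "seq_int p c < \<infinity>" if "seq_int p c \<le> ennreal K" for c :: "nat \<times> (int ^ 'n) \<Rightarrow> complex" and K
    using that by (rule le_less_trans) simp
  have S_Lp: "S \<psi> c \<in> Lp_funs p" if "seq_int p c \<le> ennreal K" for c K
    using fin[OF that] by (intro synthesis_fun_Lp \<psi>)
  have T: "T n \<subseteq> Lp p" for n
    using S_Lp by (auto simp: T_def Lp_class_mem)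
  have union: "(\<Union>n. M.mtopology closure_of T n) = Lp p"
  proof (rule equalityI; rule subsetI)
    fix F assume F: "F \<in> (Lp p :: (real ^ 'n \<Rightarrow> complex) set set)"
    from onto[unfolded onto_def, rule_format, OF Lp_rep_funs[OF F]]
    obtain c where c: "seq_int p c < \<infinity>" "AE x in lebesgue. S \<psi> c x = Lp_rep F x" by blast
    have "F = Lp_class p (S \<psi> c)"
      using c Lp_class_eq_iff[OF synthesis_fun_Lp[OF \<psi> c(1)] Lp_rep_funs[OF F]] Lp_class_rep[OF F] by simp
    moreover obtain k where k: "seq_int p c = ennreal k"
      using c(1) by (cases "seq_int p c") auto
    obtain n where "k \<le> real n" using real_arch_simple by blast
    ultimately have "F \<in> T n" unfolding T_def using k by (auto intro: ennreal_leI)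
    moreover have "T n \<subseteq> M.mtopology closure_of T n"
      using T by (intro closure_of_subset) simp
    ultimately show "F \<in> (\<Union>n. M.mtopology closure_of T n)" by blast
  next
    fix F assume "F \<in> (\<Union>n. M.mtopology closure_of T n)"
    then show "F \<in> Lp p"
      using closure_of_subset_topspace[of M.mtopology] by fastforce
  qed
  have "Lp_class p (\<lambda>_::real^'n. 0::complex) \<in> Lp p"
    by (intro Lp_class_mem) (simp add: Lp_funs_iff Lp_int_def)
  moreover have "M.mtopology interior_of (\<Union>(range (\<lambda>n. M.mtopology closure_of T n))) = Lp p"
    unfolding union using interior_of_topspace[of M.mtopology] by simp
  ultimately have "M.mtopology interior_of (\<Union>(range (\<lambda>n. M.mtopology closure_of T n))) \<noteq> {}"
    by blast
  moreover have "M.mtopology interior_of (\<Union>(range (\<lambda>n. M.mtopology closure_of T n))) = {}"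
    if "\<And>n. M.mtopology interior_of (M.mtopology closure_of T n) = {}"
    using that by (intro M.metric_Baire_category_alt Lp_mcomplete p) auto
  ultimately have "\<exists>n. M.mtopology interior_of (M.mtopology closure_of T n) \<noteq> {}"
    by blast
  then obtain n F where "F \<in> M.mtopology interior_of (M.mtopology closure_of T n)" by blast
  moreover have "openin M.mtopology (M.mtopology interior_of (M.mtopology closure_of T n))" by simp
  ultimately obtain r where F: "F \<in> Lp p" and r: "0 < r"
    and ball: "M.mball F r \<subseteq> M.mtopology interior_of (M.mtopology closure_of T n)"
    unfolding M.openin_mtopology by blast
  define f0 where "f0 = Lp_rep F"
  have f0: "f0 \<in> Lp_funs p" "F = Lp_class p f0"
    using F by (simp_all add: f0_def Lp_rep_funs Lp_class_rep)
  have approx: "\<exists>c. seq_int p c \<le> ennreal (real n) \<and> Lp_int p (\<lambda>x. g x - S \<psi> c x) < ennreal \<epsilon>"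
    if g: "g \<in> Lp_funs p" "Lp_int p (\<lambda>x. f0 x - g x) < ennreal r" and \<epsilon>: "0 < \<epsilon>" for g \<epsilon>
  proof -
    have "Lp_class p g \<in> M.mball F r"
      using g f0 by (simp add: Lp_class_mem Lp_dist_class_less_iff[OF p])
    then have "Lp_class p g \<in> M.mtopology closure_of T n"
      using ball interior_of_subset[of M.mtopology] by blast
    then obtain G where "G \<in> T n" "Lp_dist p (Lp_class p g) G < \<epsilon>"
      using \<epsilon> unfolding M.metric_closure_of by auto
    then show ?thesis
      using g S_Lp by (auto simp: T_def Lp_dist_class_less_iff[OF p])
  qed
  show thesis
  proof (rule that[OF r, of "2 * real n"])
    fix f :: "real ^ 'n \<Rightarrow> complex" and \<epsilon> :: real
    assume f: "f \<in> Lp_funs p" "Lp_int p f < ennreal r" and \<epsilon>: "0 < \<epsilon>"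
    \<comment> \<open>Both \<open>f0\<close> and \<open>f0 + f\<close> represent points of the ball
      about \<open>F\<close>, and \<open>f\<close> is their difference. Subtracting their
      coefficient sequences at most doubles the bound \<open>n\<close>.\<close>
    obtain c where c: "seq_int p c \<le> ennreal (real n)"
        "Lp_int p (\<lambda>x. f0 x + f x - S \<psi> c x) < ennreal (\<epsilon> / 2)"
      using approx[of "\<lambda>x. f0 x + f x" "\<epsilon> / 2"] f f0(1) \<epsilon> by (auto simp: Lp_int_uminus Lp_funs_add p)
    obtain d where d: "seq_int p d \<le> ennreal (real n)"
        "Lp_int p (\<lambda>x. f0 x - S \<psi> d x) < ennreal (\<epsilon> / 2)"
      using approx[of "\<lambda>x. f0 x" "\<epsilon> / 2"] r f0(1) \<epsilon> p by (auto simp: Lp_int_def)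
    define e where "e i = c i - d i" for i
    have "seq_int p e \<le> ennreal (real n) + ennreal (real n)"
      unfolding e_def by (rule order_trans[OF seq_int_diff_le[OF p] add_mono[OF c(1) d(1)]])
    then have e: "seq_int p e \<le> ennreal (2 * real n)"
      by (simp flip: ennreal_plus)
    have AE: "AE x in lebesgue. S \<psi> c x = S \<psi> e x + S \<psi> d x"
      by (rule AE_synthesis_add[OF \<psi> fin[OF e] fin[OF d(1)]]) (simp add: e_def)
    note [measurable] = Lp_funs_measurable[OF f(1)] Lp_funs_measurable[OF f0(1)]
      Lp_funs_measurable[OF S_Lp[OF c(1)]] Lp_funs_measurable[OF S_Lp[OF d(1)]]
    have "Lp_int p (\<lambda>x. f x - S \<psi> e x)
        = Lp_int p (\<lambda>x. (f0 x + f x - S \<psi> c x) + - (f0 x - S \<psi> d x))"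
      using AE by (intro Lp_int_cong_AE) (auto elim: eventually_mono)
    also have "\<dots> \<le> Lp_int p (\<lambda>x. f0 x + f x - S \<psi> c x) + Lp_int p (\<lambda>x. - (f0 x - S \<psi> d x))"
      by (intro Lp_int_add_le p) measurable
    also have "\<dots> \<le> ennreal (\<epsilon> / 2) + ennreal (\<epsilon> / 2)"
      unfolding Lp_int_uminus using c d by (intro add_mono less_imp_le)
    also have "\<dots> = ennreal \<epsilon>" using \<epsilon> by (simp flip: ennreal_plus)
    finally show "\<exists>c. seq_int p c \<le> ennreal (2 * real n) \<and> Lp_int p (\<lambda>x. f x - S \<psi> c x) \<le> ennreal \<epsilon>"
      using e by blast
  qed simp
qed

text \<open>Homogeneity turns an absolute statement about small functions into a relative one:
  \<open>f\<close> is scaled to size \<open>r / 2\<close>, approximated up to \<open>r / 4\<close>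
  and scaled back, which leaves the factor \<open>1/2\<close>.\<close>

lemma onto_imp_approx_onto:
  assumes \<psi>: "\<psi> \<in> Lp_funs p" and onto: "onto \<psi>"
  shows "approx_onto \<psi>"
proof -
  obtain r K where r: "0 < r" and K: "0 \<le> K" and
    ex: "\<And>f \<epsilon>. f \<in> Lp_funs p \<Longrightarrow> Lp_int p f < ennreal r \<Longrightarrow> 0 < \<epsilon> \<Longrightarrow>
      \<exists>c. seq_int p c \<le> ennreal K \<and> Lp_int p (\<lambda>x. f x - S \<psi> c x) \<le> ennreal \<epsilon>"
    using onto_imp_almost_open[OF \<psi> onto] by blast
  have "\<exists>c. seq_int p c \<le> ennreal (2 * K / r) * Lp_int p f \<and>
      Lp_int p (\<lambda>x. f x - S \<psi> c x) \<le> ennreal (1/2) * Lp_int p f"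
    if f: "f \<in> Lp_funs p" for f :: "real ^ 'n \<Rightarrow> complex"
  proof (cases "Lp_int p f = 0")
    \<comment> \<open>A function of size zero cannot be scaled to size \<open>r / 2\<close>; zero
      coefficients serve it.\<close>
    case True
    have "seq_int p (\<lambda>_. 0) = 0" "S \<psi> (\<lambda>_. 0) x = 0" for x
      by (simp_all add: seq_int_def synthesis_fun_def)
    with True show ?thesis by (intro exI[of _ "\<lambda>_. 0"]) simp
  next
    case False
    note [measurable] = Lp_funs_measurable[OF f]
    obtain I where I: "Lp_int p f = ennreal I" "0 < I"
      using Lp_int_finite[OF f] False by (cases "Lp_int p f") (auto simp: less_le)
    define t where "t = (r / (2 * I)) powr (1/p)"
    have t: "0 < t" "t powr p = r / (2 * I)"
      using r I p by (simp_all add: t_def powr_powr)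
    then have t': "inverse t powr p = 2 * I / r"
      by (simp add: inverse_powr)
    have tf: "(\<lambda>x. complex_of_real t * f x) \<in> Lp_funs p" by (rule Lp_funs_cmult[OF f])
    have "Lp_int p (\<lambda>x. complex_of_real t * f x) = ennreal (r / 2)"
      using t r I by (simp add: Lp_int_cmult ennreal_mult'[symmetric])
    also have "\<dots> < ennreal r" using r by (simp add: ennreal_less_iff)
    finally obtain c where c: "seq_int p c \<le> ennreal K"
        "Lp_int p (\<lambda>x. complex_of_real t * f x - S \<psi> c x) \<le> ennreal (r / 4)"
      using ex[OF tf, of "r / 4"] r by auto
    have [measurable]: "S \<psi> c \<in> borel_measurable lebesgue"
      by (rule synthesis_fun_measurable[OF Lp_funs_measurable[OF \<psi>]])
    let ?z = "complex_of_real (inverse t)"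
    have z: "norm ?z powr p = 2 * I / r" using t t' by (simp only: norm_of_real) simp
    have "seq_int p (\<lambda>i. ?z * c i) \<le> ennreal (2 * I / r) * ennreal K"
      unfolding seq_int_cmult z by (intro mult_left_mono c) auto
    also have "\<dots> = ennreal (2 * K / r) * Lp_int p f"
      using r K I by (simp add: ennreal_mult'[symmetric] ac_simps)
    finally have 1: "seq_int p (\<lambda>i. ?z * c i) \<le> ennreal (2 * K / r) * Lp_int p f" .
    have "f x - S \<psi> (\<lambda>i. ?z * c i) x = ?z * (complex_of_real t * f x - S \<psi> c x)" for x
      using t by (simp add: synthesis_fun_cmult right_diff_distrib)
    then have "Lp_int p (\<lambda>x. f x - S \<psi> (\<lambda>i. ?z * c i) x)
        = ennreal (2 * I / r) * Lp_int p (\<lambda>x. complex_of_real t * f x - S \<psi> c x)"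
      by (simp only: Lp_int_cmult[where z = ?z] borel_measurable_diff borel_measurable_times
        borel_measurable_const z) (subst Lp_int_cmult, measurable, simp only: z)
    also have "\<dots> \<le> ennreal (2 * I / r) * ennreal (r / 4)"
      by (intro mult_left_mono c) auto
    also have "\<dots> = ennreal (1/2) * Lp_int p f"
      using r I by (simp add: ennreal_mult'[symmetric] I(1) del: ennreal_half)
    finally show ?thesis using 1 by blast
  qed
  then show ?thesis
    unfolding approx_onto_def using r K by (intro exI[of _ "2 * K / r"] exI[of _ "1/2"]) auto
qed

lemma onto_iff_approx_onto: "\<psi> \<in> Lp_funs p \<Longrightarrow> onto \<psi> \<longleftrightarrow> approx_onto \<psi>"
  using onto_imp_approx_onto approx_onto_imp_onto by blast

end

section \<open>Unit cubes and approximation\<close>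


text \<open>Half open, so that the integer translates partition the space and every point has
  exactly one integer part and one fractional part.\<close>

definition unit_cube :: "(real ^ 'n) set" where
  "unit_cube = {u. \<forall>i. 0 \<le> u $ i \<and> u $ i < 1}"

definition floor_vec :: "real ^ 'n \<Rightarrow> int ^ 'n" where
  "floor_vec x = (\<chi> i. \<lfloor>x $ i\<rfloor>)"

lemma floor_vec_eq_iff: "floor_vec x = k \<longleftrightarrow> x - int_vec k \<in> unit_cube"
  by (auto simp: floor_vec_def unit_cube_def int_vec_def vec_eq_iff floor_eq_iff less_diff_eq diff_less_eq add.commute)

lemma frac_in_unit_cube: "x - int_vec (floor_vec x) \<in> unit_cube"
  using floor_vec_eq_iff[of x "floor_vec x"] by simp

lemma int_vec_diff: "int_vec (k - l) = int_vec k - int_vec l"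
  by (simp add: int_vec_def vec_eq_iff)

lemma norm_unit_cube_le: "u \<in> unit_cube \<Longrightarrow> norm (u :: real ^ 'n) \<le> real CARD('n)"
proof -
  assume u: "u \<in> unit_cube"
  have "norm u \<le> (\<Sum>i\<in>UNIV. \<bar>u $ i\<bar>)" by (rule norm_le_l1_cart)
  also have "\<dots> \<le> (\<Sum>i\<in>(UNIV::'n set). 1)"
    using u by (intro sum_mono) (auto simp: unit_cube_def less_imp_le)
  finally show ?thesis by simp
qed

lemma unit_cube_bounds: "box 0 1 \<subseteq> unit_cube" "unit_cube \<subseteq> cbox 0 1"
  by (auto simp: unit_cube_def mem_box_cart less_imp_le)

lemma unit_cube_borel [measurable]: "(unit_cube :: (real ^ 'n) set) \<in> sets borel"
proof -
  have "unit_cube = (\<Inter>i. {u :: real ^ 'n. 0 \<le> u $ i} \<inter> {u. u $ i < 1})"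
    by (auto simp: unit_cube_def)
  also have "\<dots> \<in> sets borel"
    by (intro sets.countable_INT'' sets.Int borel_closed borel_open closed_Collect_le open_Collect_less
        continuous_intros) auto
  finally show ?thesis .
qed

lemma emeasure_unit_cube: "emeasure lebesgue (unit_cube :: (real ^ 'n) set) = 1"
proof (rule antisym)
  have "(1 :: real ^ 'n) \<bullet> b = 1" if "b \<in> Basis" for b
    using that by (auto simp: Basis_vec_def inner_axis)
  then have box: "emeasure lborel (cbox 0 (1 :: real ^ 'n)) = 1" "emeasure lborel (box 0 (1 :: real ^ 'n)) = 1"
    by (simp_all add: emeasure_lborel_cbox_eq emeasure_lborel_box_eq)
  show "emeasure lebesgue (unit_cube :: (real ^ 'n) set) \<le> 1"
  proof -
    have "emeasure lebesgue (unit_cube :: (real ^ 'n) set) \<le> emeasure lebesgue (cbox 0 (1 :: real ^ 'n))"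
      by (intro emeasure_mono unit_cube_bounds) simp
    then show ?thesis using box by simp
  qed
  show "1 \<le> emeasure lebesgue (unit_cube :: (real ^ 'n) set)"
  proof -
    have "emeasure lebesgue (box 0 (1 :: real ^ 'n)) \<le> emeasure lebesgue (unit_cube :: (real ^ 'n) set)"
      by (intro emeasure_mono unit_cube_bounds) (simp add: unit_cube_borel)
    then show ?thesis using box by simp
  qed
qed

lemma countable_int_vecs: "countable (UNIV :: (int ^ 'n::finite) set)"
proof -
  have "(UNIV :: (int ^ 'n) set) = snd ` index_set"
    by (force simp: index_set_def)
  then show ?thesis using countable_index_set by (metis countable_image)
qed

section \<open>Integration over the cells of the integer lattice\<close>

lemma translation_measurable_lebesgue: "(\<lambda>x. x - v) \<in> lebesgue \<rightarrow>\<^sub>M lebesgue" for v :: "real ^ 'n"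
  using affine_measurable_lebesgue[of "mat 1" v] by (simp add: invertible_def)

lemma nn_integral_lebesgue_translation:
  fixes g :: "real ^ 'n \<Rightarrow> ennreal"
  assumes "g \<in> borel_measurable lebesgue"
  shows "(\<integral>\<^sup>+x. g (x - v) \<partial>lebesgue) = (\<integral>\<^sup>+x. g x \<partial>lebesgue)"
proof -
  have "invertible (mat 1 :: real ^ 'n ^ 'n)" by (auto simp: invertible_def intro: matrix_mul_lid)
  from nn_integral_lebesgue_affine[OF this assms, of v] show ?thesis by simp
qed

lemma distr_lebesgue_translation: "distr lebesgue lebesgue (\<lambda>x. x - v) = lebesgue" for v :: "real ^ 'n"
proof (rule measure_eqI)
  fix A assume "A \<in> sets (distr lebesgue lebesgue (\<lambda>x. x - v))"
  then have A[measurable]: "A \<in> sets lebesgue" by simp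
  have "emeasure (distr lebesgue lebesgue (\<lambda>x. x - v)) A = (\<integral>\<^sup>+x. indicator A x \<partial>distr lebesgue lebesgue (\<lambda>x. x - v))"
    using A by simp
  also have "\<dots> = (\<integral>\<^sup>+x. indicator A (x - v) \<partial>lebesgue)"
    using translation_measurable_lebesgue[of v] by (subst nn_integral_distr) auto
  also have "\<dots> = emeasure lebesgue A"
    by (subst nn_integral_lebesgue_translation) auto
  finally show "emeasure (distr lebesgue lebesgue (\<lambda>x. x - v)) A = emeasure lebesgue A" .
qed simp

lemma integral_lebesgue_translation:
  fixes g :: "real ^ 'n \<Rightarrow> complex"
  assumes "g \<in> borel_measurable lebesgue"
  shows "(\<integral>x. g (x - v) \<partial>lebesgue) = (\<integral>x. g x \<partial>lebesgue)"
  using integral_distr[OF translation_measurable_lebesgue[of v] assms]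
  by (simp add: distr_lebesgue_translation)

lemma floor_vec_measurable: "floor_vec \<in> lebesgue \<rightarrow>\<^sub>M count_space (UNIV :: (int ^ 'n) set)"
proof -
  have "floor_vec -` {k} \<inter> space lebesgue \<in> sets lebesgue" for k :: "int ^ 'n"
  proof -
    have "floor_vec -` {k} \<inter> space lebesgue = (\<lambda>x. x - int_vec k) -` unit_cube \<inter> space lebesgue"
      by (auto simp: floor_vec_eq_iff frac_in_unit_cube)
    also have "\<dots> \<in> sets lebesgue"
      by (rule measurable_sets[OF translation_measurable_lebesgue]) (simp add: unit_cube_borel)
    finally show ?thesis .
  qed
  then show ?thesis
    by (subst measurable_count_space_eq_countable) (auto simp: countable_int_vecs)
qed

lemma floor_frac_measurable:
  assumes "\<And>k. G k \<in> borel_measurable lebesgue"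
  shows "(\<lambda>x::real^'n. G (floor_vec x) (x - int_vec (floor_vec x))) \<in> borel_measurable lebesgue"
  by (rule measurable_compose_countable'[OF _ floor_vec_measurable countable_int_vecs,
      of "\<lambda>k x. G k (x - int_vec k)"])
    (rule measurable_compose[OF translation_measurable_lebesgue assms])

text \<open>The space splits into cells with a fixed integer part, and translation carries each cell
  to the unit cube. When \<open>G\<close> is a product, the right side factors into a lattice sum
  and a cube integral.\<close>

lemma nn_integral_floor_frac:
  fixes G :: "int ^ 'n \<Rightarrow> real ^ 'n \<Rightarrow> ennreal"
  assumes G[measurable]: "\<And>k. G k \<in> borel_measurable lebesgue"
  shows "(\<integral>\<^sup>+x. G (floor_vec x) (x - int_vec (floor_vec x)) \<partial>lebesgue)
    = (\<integral>\<^sup>+k. \<integral>\<^sup>+u. G k u * indicator unit_cube u \<partial>lebesgue \<partial>count_space UNIV)"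
proof -
  have [measurable]: "(\<lambda>u. G k u * indicator unit_cube u) \<in> borel_measurable lebesgue" for k
    by (intro borel_measurable_times_ennreal G borel_measurable_indicator) (simp add: unit_cube_borel)
  have [measurable]: "(\<lambda>x. G k (x - int_vec k) * indicator unit_cube (x - int_vec k)) \<in> borel_measurable lebesgue" for k
    using measurable_compose[OF translation_measurable_lebesgue, of "\<lambda>u. G k u * indicator unit_cube u"] by simp
  have "G (floor_vec x) (x - int_vec (floor_vec x))
      = (\<integral>\<^sup>+k. G k (x - int_vec k) * indicator unit_cube (x - int_vec k) \<partial>count_space UNIV)" for x
    by (subst nn_integral_count_space'[of "{floor_vec x}"])
      (auto simp: indicator_def floor_vec_eq_iff[symmetric])
  then have "(\<integral>\<^sup>+x. G (floor_vec x) (x - int_vec (floor_vec x)) \<partial>lebesgue)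
      = (\<integral>\<^sup>+k. \<integral>\<^sup>+x. G k (x - int_vec k) * indicator unit_cube (x - int_vec k) \<partial>lebesgue \<partial>count_space UNIV)"
    by (simp add: nn_integral_count_space_nn_integral countable_int_vecs)
  also have "\<dots> = (\<integral>\<^sup>+k. \<integral>\<^sup>+u. G k u * indicator unit_cube u \<partial>lebesgue \<partial>count_space UNIV)"
    by (intro nn_integral_cong nn_integral_lebesgue_translation) measurable
  finally show ?thesis .
qed

section \<open>A concavity bound and the contracting factor\<close>

lemma powr_le_linear:
  fixes y :: real
  assumes "0 \<le> r" "r \<le> 1" "0 \<le> y"
  shows "y powr r \<le> 1 + r * (y - 1)"
proof (cases "y = 0")
  case False
  then show ?thesis
    using Youngs_inequality_0[of r "1 - r" y 1] assms by (simp add: algebra_simps)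
qed (use assms in simp)

text \<open>The concave function \<open>y powr (p / 2)\<close> lies below its tangent at
  \<open>1\<close>, and the tangent is evaluated at the squared norm of \<open>1 - z\<close>, which
  is a polynomial in the real and imaginary parts of \<open>z\<close>.\<close>

lemma norm_one_minus_powr_le:
  fixes z :: complex
  assumes "0 < p" "p \<le> 1"
  shows "norm (1 - z) powr p \<le> 1 + p / 2 * ((norm z)\<^sup>2 - 2 * Re z)"
proof -
  have "norm (1 - z) powr p = ((norm (1 - z))\<^sup>2) powr (p / 2)"
    by (simp add: powr_powr flip: powr_numeral)
  also have "\<dots> \<le> 1 + p / 2 * ((norm (1 - z))\<^sup>2 - 1)"
    using assms by (intro powr_le_linear) auto
  also have "(norm (1 - z))\<^sup>2 - 1 = (norm z)\<^sup>2 - 2 * Re z"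
    unfolding cmod_power2 by (simp add: power2_eq_square algebra_simps)
  finally show ?thesis .
qed

text \<open>To first order in \<open>z\<close> the \<open>p\<close>-th power of \<open>norm (1 - z * P x)\<close> is \<open>1 - p * Re (z * P x)\<close>, so a
  small multiple \<open>z\<close> of the conjugate mean of \<open>P\<close> pushes the mean below \<open>1\<close>.\<close>

lemma (in finite_measure) exists_contracting_factor:
  fixes P :: "'a \<Rightarrow> complex"
  assumes p: "0 < p" "p \<le> 1" and prob: "measure M (space M) = 1"
    and P[measurable]: "P \<in> borel_measurable M" and bound: "\<And>x. norm (P x) \<le> K"
    and mean: "(\<integral>x. P x \<partial>M) \<noteq> 0"
  obtains z \<mu> where "0 \<le> \<mu>" "\<mu> < 1" "(\<integral>\<^sup>+x. ennreal (norm (1 - z * P x) powr p) \<partial>M) \<le> ennreal \<mu>"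
proof -
  define w where "w = (\<integral>x. P x \<partial>M)"
  have w: "0 < norm w" using mean by (simp add: w_def)
  have int: "integrable M P" by (intro integrable_const_bound[of _ K]) (auto simp: bound)
  have K: "0 < K"
  proof (rule ccontr)
    assume "\<not> 0 < K"
    then have "norm (P x) \<le> 0" for x using bound[of x] by linarith
    then show False using w by (simp add: w_def)
  qed
  \<comment> \<open>With this \<open>z\<close> the mean of \<open>Re (z * P x)\<close> is
    \<open>(norm w)\<^sup>2 / K\<^sup>2\<close>, and the square of \<open>norm (z * P x)\<close> is
    at most the same number. The linear gain counts twice and so beats the quadratic loss;
    \<open>\<mu>\<close> records what remains.\<close>
  define z where "z = complex_of_real (1 / K\<^sup>2) * cnj w"
  define \<mu> where "\<mu> = 1 - p / 2 * ((norm w)\<^sup>2 / K\<^sup>2)"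
  define B where "B x = 1 + p / 2 * ((norm w)\<^sup>2 / K\<^sup>2 - 2 * Re (z * P x))" for x
  have le: "norm (1 - z * P x) powr p \<le> B x" for x
  proof -
    have "(norm (z * P x))\<^sup>2 \<le> (norm w / K\<^sup>2 * K)\<^sup>2"
      using K bound[of x] by (intro power_mono) (auto simp: z_def norm_mult norm_divide norm_power intro!: divide_right_mono mult_left_mono)
    also have "\<dots> = (norm w)\<^sup>2 / K\<^sup>2"
      using K by (simp add: power2_eq_square field_simps)
    finally have "(norm (z * P x))\<^sup>2 \<le> (norm w)\<^sup>2 / K\<^sup>2" .
    then have "p / 2 * ((norm (z * P x))\<^sup>2 - 2 * Re (z * P x)) \<le> p / 2 * ((norm w)\<^sup>2 / K\<^sup>2 - 2 * Re (z * P x))"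
      using p by (intro mult_left_mono) auto
    then show ?thesis
      using norm_one_minus_powr_le[OF p, of "z * P x"] unfolding B_def by linarith
  qed
  have B_int: "integrable M B" unfolding B_def using int by simp
  have zP: "integrable M (\<lambda>x. z * P x)" using int by simp
  then have ReI: "integrable M (\<lambda>x. Re (z * P x))" by (rule integrable_Re)
  have "(\<integral>x. Re (z * P x) \<partial>M) = Re (\<integral>x. z * P x \<partial>M)" using zP by (rule integral_Re)
  also have "(\<integral>x. z * P x \<partial>M) = z * w" by (simp add: w_def)
  also have "z * w = complex_of_real ((norm w)\<^sup>2 / K\<^sup>2)"
    by (simp add: z_def mult.assoc mult.commute[of "cnj w"] complex_norm_square del: of_real_power)
  finally have Re: "(\<integral>x. Re (z * P x) \<partial>M) = (norm w)\<^sup>2 / K\<^sup>2" by simp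
  have "(\<integral>x. B x \<partial>M) = 1 + p / 2 * ((norm w)\<^sup>2 / K\<^sup>2 - 2 * (\<integral>x. Re (z * P x) \<partial>M))"
    unfolding B_def using ReI by (simp add: prob del: times_complex.sel)
  then have B_eq: "(\<integral>x. B x \<partial>M) = \<mu>"
    unfolding Re by (simp add: \<mu>_def algebra_simps)
  \<comment> \<open>\<open>B\<close> majorizes a p-th power, so it is nonnegative, and so is its
    integral \<open>\<mu>\<close>.\<close>
  have "0 \<le> B x" for x using le[of x] powr_ge_zero order_trans by blast
  then have nn: "(\<integral>\<^sup>+x. ennreal (B x) \<partial>M) = ennreal \<mu>" "0 \<le> \<mu>"
    unfolding B_eq[symmetric] using B_int by (auto intro!: nn_integral_eq_integral integral_nonneg_AE)
  have "(\<integral>\<^sup>+x. ennreal (norm (1 - z * P x) powr p) \<partial>M) \<le> ennreal \<mu>"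
    unfolding nn(1)[symmetric] by (intro nn_integral_mono ennreal_leI le)
  moreover have "\<mu> < 1" using p w K by (simp add: \<mu>_def)
  ultimately show thesis using that nn(2) by blast
qed

section \<open>Approximation by bounded and by continuous functions\<close>

lemma Lp_int_le_const:
  assumes "0 \<le> p" "\<And>x. x \<in> A \<Longrightarrow> norm (f x) \<le> K" "\<And>x. x \<notin> A \<Longrightarrow> f x = 0" and [measurable]: "A \<in> sets lebesgue"
  shows "Lp_int p f \<le> ennreal (K powr p) * emeasure lebesgue A"
proof -
  have "Lp_int p f \<le> (\<integral>\<^sup>+x. ennreal (K powr p) * indicator A x \<partial>lebesgue)"
    unfolding Lp_int_def using assms
    by (intro nn_integral_mono) (auto simp: indicator_def intro!: ennreal_leI powr_mono2)
  then show ?thesis by (simp add: nn_integral_cmult)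
qed

text \<open>Uniform continuity on a compact ball around the support. One \<open>\<eta>\<close>
  serves all displacements \<open>\<rho>\<close> at once; in the application they round points to a
  fine lattice.\<close>

lemma continuous_displacement_approx:
  fixes h :: "'a::euclidean_space \<Rightarrow> complex"
  assumes p: "0 < p" and cont: "continuous_on UNIV h" and supp: "\<And>x. R < norm x \<Longrightarrow> h x = 0" and \<epsilon>: "0 < \<epsilon>"
  obtains \<eta> where "0 < \<eta>"
    "\<And>\<rho>. (\<And>x. norm (\<rho> x - x) \<le> \<eta>) \<Longrightarrow> Lp_int p (\<lambda>x. h (\<rho> x) - h x) \<le> ennreal \<epsilon>"
proof -
  let ?C = "cball 0 (R + 1) :: 'a set"
  define V where "V = measure lebesgue ?C"
  have V: "emeasure lebesgue ?C = ennreal V" "0 \<le> V"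
    using emeasure_eq_measure2[OF lmeasurable_cball[of 0 "R + 1"]] by (simp_all add: V_def)
  \<comment> \<open>Chosen so that \<open>\<kappa> powr p\<close> times the volume \<open>V\<close>
    is at most \<open>\<epsilon>\<close>; \<open>V + 1\<close> keeps the quotient defined.\<close>
  define \<kappa> where "\<kappa> = (\<epsilon> / (V + 1)) powr (1 / p)"
  have \<kappa>: "0 < \<kappa>" "\<kappa> powr p = \<epsilon> / (V + 1)" using \<epsilon> V p by (auto simp: \<kappa>_def powr_powr)
  have "uniformly_continuous_on ?C h"
    by (intro compact_uniformly_continuous continuous_on_subset[OF cont]) auto
  then obtain \<eta> where \<eta>: "0 < \<eta>" "\<And>x y. x \<in> ?C \<Longrightarrow> y \<in> ?C \<Longrightarrow> dist y x < \<eta> \<Longrightarrow> dist (h y) (h x) < \<kappa>"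
    unfolding uniformly_continuous_on_def using \<kappa>(1) by metis
  show thesis
  \<comment> \<open>The bound \<open>1/2\<close> confines the difference to radius
    \<open>R + 1/2\<close> and there keeps \<open>\<rho> x\<close> inside the ball of radius
    \<open>R + 1\<close>; halving \<open>\<eta>\<close> yields the strict inequality of uniform
    continuity.\<close>
  proof (rule that[of "min (\<eta> / 2) (1/2)"])
    fix \<rho> :: "'a \<Rightarrow> 'a" assume \<rho>: "\<And>x. norm (\<rho> x - x) \<le> min (\<eta> / 2) (1/2)"
    have near: "norm (\<rho> x) \<le> norm x + 1/2" "norm x \<le> norm (\<rho> x) + 1/2" for x
      using \<rho>[of x] norm_triangle_ineq2[of "\<rho> x" x] norm_triangle_ineq3[of "\<rho> x" x] by auto
    have zero: "h (\<rho> x) - h x = 0" if "x \<notin> cball 0 (R + 1/2)" for x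
      using that near[of x] supp by (cases "R < norm x \<and> R < norm (\<rho> x)") (auto simp: dist_norm not_less)
    have small: "norm (h (\<rho> x) - h x) \<le> \<kappa>" for x
    proof (cases "x \<in> cball 0 (R + 1/2)")
      case True
      then have "x \<in> ?C" "\<rho> x \<in> ?C" using near[of x] by (auto simp: dist_norm)
      then show ?thesis
        using \<eta>(2)[of x "\<rho> x"] \<rho>[of x] \<eta>(1) by (auto simp: dist_norm)
    next
      case False
      from zero[OF False] show ?thesis using \<kappa> by simp
    qed
    have "Lp_int p (\<lambda>x. h (\<rho> x) - h x) \<le> ennreal (\<kappa> powr p) * emeasure lebesgue ?C"
      using small zero p by (intro Lp_int_le_const) auto
    also have "\<dots> = ennreal (\<epsilon> / (V + 1) * V)"
      unfolding V(1) \<kappa>(2) using V(2) \<epsilon> by (intro ennreal_mult[symmetric]) auto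
    also have "\<dots> \<le> ennreal \<epsilon>"
      using V(2) \<epsilon> by (intro ennreal_leI) (simp add: field_simps)
    finally show "Lp_int p (\<lambda>x. h (\<rho> x) - h x) \<le> ennreal \<epsilon>" .
  qed (use \<eta> in auto)
qed

lemma Lp_int_dominated:
  assumes p: "0 < p" and w: "w \<in> Lp_funs p"
    and [measurable]: "\<And>n. u n \<in> borel_measurable lebesgue"
    and le: "\<And>n x. norm (u n x) \<le> norm (w x)"
    and lim: "AE x in lebesgue. (\<lambda>n. u n x) \<longlonglongrightarrow> 0" and \<epsilon>: "0 < \<epsilon>"
  shows "\<exists>n. Lp_int p (u n) < ennreal \<epsilon>"
proof -
  note [measurable] = Lp_funs_measurable[OF w]
  have "(\<lambda>n. Lp_int p (u n)) \<longlonglongrightarrow> (\<integral>\<^sup>+x. 0 \<partial>(lebesgue :: 'a measure))"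
    unfolding Lp_int_def
  proof (rule nn_integral_dominated_convergence)
    show "(\<integral>\<^sup>+x. ennreal (norm (w x) powr p) \<partial>lebesgue) < \<infinity>"
      using Lp_int_finite[OF w] by (simp add: Lp_int_def)
    show "AE x in lebesgue. (\<lambda>n. ennreal (norm (u n x) powr p)) \<longlonglongrightarrow> 0"
      using lim
    proof eventually_elim
      case (elim x)
      then have "(\<lambda>n. ennreal (norm (u n x) powr p)) \<longlonglongrightarrow> ennreal (norm (0::complex) powr p)"
        using p by (intro tendsto_ennrealI tendsto_powr' tendsto_norm tendsto_const) auto
      then show ?case by simp
    qed
  qed (use le p in \<open>auto intro!: AE_I2 ennreal_leI powr_mono2\<close>)
  then have "\<forall>\<^sub>F n in sequentially. Lp_int p (u n) < ennreal \<epsilon>"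
    using \<epsilon> by (intro order_tendstoD) auto
  then show ?thesis by (auto simp: eventually_sequentially)
qed

definition bounded_supp :: "('a::euclidean_space \<Rightarrow> complex) \<Rightarrow> bool" where
  "bounded_supp f \<longleftrightarrow> (\<exists>K R. \<forall>x. norm (f x) \<le> K \<and> (R < norm x \<longrightarrow> f x = 0))"

lemma bounded_supp_Lp:
  assumes "0 < p" "f \<in> borel_measurable lebesgue" "bounded_supp f"
  shows "f \<in> Lp_funs p"
proof -
  obtain K R where "\<And>x. norm (f x) \<le> K" "\<And>x. R < norm x \<Longrightarrow> f x = 0"
    using assms unfolding bounded_supp_def by metis
  then have "Lp_int p f \<le> ennreal (K powr p) * emeasure lebesgue (cball 0 R :: 'a set)"
    using assms by (intro Lp_int_le_const) auto
  also have "\<dots> < \<infinity>"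
    by (simp add: ennreal_mult_less_top emeasure_lborel_cball_finite[unfolded infinity_ennreal_def])
  finally show ?thesis using assms by (simp add: Lp_funs_iff)
qed

lemma truncation_approx:
  assumes p: "0 < p" and f: "f \<in> Lp_funs p" and \<epsilon>: "0 < \<epsilon>"
  obtains g where "g \<in> borel_measurable lebesgue" "bounded_supp g" "Lp_int p (\<lambda>x. f x - g x) < ennreal \<epsilon>"
proof -
  note [measurable] = Lp_funs_measurable[OF f]
  define A where "A n = {x. norm x \<le> real n \<and> norm (f x) \<le> real n}" for n
  have [measurable]: "A n \<in> sets lebesgue" for n
  proof -
    have "A n = cball 0 (real n) \<inter> {x \<in> space lebesgue. norm (f x) \<le> real n}" by (auto simp: A_def)
    also have "\<dots> \<in> sets lebesgue" by (intro sets.Int) (simp, measurable)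
    finally show ?thesis .
  qed
  define g where "g n x = f x * indicator (A n) x" for n x
  have [measurable]: "g n \<in> borel_measurable lebesgue" for n unfolding g_def by measurable
  have "\<exists>n. Lp_int p (\<lambda>x. f x - g n x) < ennreal \<epsilon>"
  proof (rule Lp_int_dominated[OF p f _ _ _ \<epsilon>])
    show "norm (f x - g n x) \<le> norm (f x)" for n x by (simp add: g_def indicator_def)
    have "(\<lambda>n. f x - g n x) \<longlonglongrightarrow> 0" for x
    proof (rule tendsto_eventually)
      obtain N where N: "max (norm x) (norm (f x)) \<le> real N" using real_arch_simple by blast
      then have "f x - g n x = 0" if "n \<ge> N" for n
        using that of_nat_mono[OF that, where 'a = real] by (auto simp: g_def A_def indicator_def)
      then show "\<forall>\<^sub>F n in sequentially. f x - g n x = 0" by (auto simp: eventually_sequentially)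
    qed
    then show "AE x in lebesgue. (\<lambda>n. f x - g n x) \<longlonglongrightarrow> 0" by simp
  qed measurable
  then obtain n where "Lp_int p (\<lambda>x. f x - g n x) < ennreal \<epsilon>" by blast
  moreover have "bounded_supp (g n)"
    unfolding bounded_supp_def by (rule exI[of _ "real n"], rule exI[of _ "real n"]) (auto simp: g_def A_def indicator_def)
  ultimately show thesis using that[of "g n"] by simp
qed

text \<open>The continuous functions supplied by \<open>measurable_on\<close> converge outside a
  null set but come without any bound. The clipping \<open>cl\<close> of values and the cutoff
  \<open>ct\<close> in space are continuous and leave the limit \<open>f\<close> unchanged, and they
  provide the dominating function \<open>w\<close>.\<close>

lemma continuous_approx_bounded_supp:
  fixes f :: "'a::euclidean_space \<Rightarrow> complex"
  assumes p: "0 < p" and [measurable]: "f \<in> borel_measurable lebesgue" and supp: "bounded_supp f" and \<epsilon>: "0 < \<epsilon>"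
  obtains h where "continuous_on UNIV h" "bounded_supp h" "Lp_int p (\<lambda>x. f x - h x) < ennreal \<epsilon>"
proof -
  obtain K0 R where K0: "\<And>x. norm (f x) \<le> K0" and R: "\<And>x. R < norm x \<Longrightarrow> f x = 0"
    using supp unfolding bounded_supp_def by metis
  define K where "K = max K0 1"
  have K: "norm (f x) \<le> K" "0 < K" for x using K0[of x] by (auto simp: K_def)
  have "f measurable_on UNIV" by (intro lebesgue_measurable_imp_measurable_on) auto
  then obtain N g where N: "negligible N" and g: "\<And>n. continuous_on UNIV (g n)"
    and lim: "\<And>x. x \<notin> N \<Longrightarrow> (\<lambda>n. g n x) \<longlonglongrightarrow> f x"
    unfolding measurable_on_def by auto
  define ct where "ct x = max 0 (min 1 (R + 1 - norm x))" for x :: 'a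
  define cl where "cl z = complex_of_real (K / max K (norm z)) * z" for z
  define h where "h n x = complex_of_real (ct x) * cl (g n x)" for n x
  have cl: "norm (cl z) \<le> K" for z
    using K(2) by (cases "norm z \<le> K") (auto simp: cl_def norm_mult norm_divide max_def)
  have cl_cont: "continuous_on UNIV cl"
    unfolding cl_def using K(2) by (intro continuous_intros) auto
  have ct: "0 \<le> ct x" "ct x \<le> 1" for x by (auto simp: ct_def)
  have h_cont: "continuous_on UNIV (h n)" for n
    unfolding h_def ct_def by (intro continuous_intros continuous_on_compose2[OF cl_cont g]) auto
  have h: "norm (h n x) \<le> K" for n x
    using mult_mono[OF ct(2) cl[of "g n x"]] ct[of x] by (auto simp: h_def norm_mult)
  have h0: "h n x = 0" if "R + 1 < norm x" for n x using that by (simp add: h_def ct_def)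
  have [measurable]: "h n \<in> borel_measurable lebesgue" for n
    using borel_measurable_continuous_onI[OF h_cont[of n]] by (simp add: measurable_completion)
  define w where "w x = complex_of_real (2 * K) * indicator (cball 0 (R + 1)) x" for x :: 'a
  have w: "w \<in> Lp_funs p"
  proof (rule bounded_supp_Lp[OF p])
    show "w \<in> borel_measurable lebesgue" unfolding w_def
      by (intro borel_measurable_times borel_measurable_const borel_measurable_indicator) simp
    show "bounded_supp w" unfolding bounded_supp_def
      by (rule exI[of _ "2 * K"], rule exI[of _ "R + 1"]) (use K in \<open>auto simp: w_def indicator_def norm_mult\<close>)
  qed
  have "\<exists>n. Lp_int p (\<lambda>x. f x - h n x) < ennreal \<epsilon>"
  proof (rule Lp_int_dominated[OF p w _ _ _ \<epsilon>])
    show "norm (f x - h n x) \<le> norm (w x)" for n x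
    proof (cases "norm x \<le> R + 1")
      case True
      have "norm (f x - h n x) \<le> K + K"
        by (rule order_trans[OF norm_triangle_ineq4 add_mono[OF K(1) h]])
      then show ?thesis using True K(2) by (simp add: w_def norm_mult)
    next
      case False
      then show ?thesis using R h0 by simp
    qed
    have "AE x in lebesgue. x \<notin> N"
      using N by (auto simp: eventually_ae_filter_negligible)
    then show "AE x in lebesgue. (\<lambda>n. f x - h n x) \<longlonglongrightarrow> 0"
    proof eventually_elim
      case (elim x)
      have "isCont cl (f x)" using cl_cont by (simp add: continuous_on_eq_continuous_at)
      then have "(\<lambda>n. cl (g n x)) \<longlonglongrightarrow> cl (f x)"
        using lim[OF elim] by (rule isCont_tendsto_compose)
      then have "(\<lambda>n. f x - h n x) \<longlonglongrightarrow> f x - complex_of_real (ct x) * cl (f x)"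
        unfolding h_def by (intro tendsto_intros)
      also have "cl (f x) = f x" using K(1)[of x] K(2) by (simp add: cl_def max_def)
      also have "complex_of_real (ct x) * f x = f x"
        using R[of x] by (cases "R < norm x") (auto simp: ct_def)
      finally show ?case by simp
    qed
  qed measurable
  moreover have "bounded_supp (h n)" for n
    unfolding bounded_supp_def using h h0 by blast
  ultimately show thesis using that h_cont by blast
qed

lemma continuous_approx:
  fixes f :: "'a::euclidean_space \<Rightarrow> complex"
  assumes p: "0 < p" "p \<le> 1" and f: "f \<in> Lp_funs p" and \<epsilon>: "0 < \<epsilon>"
  obtains h where "continuous_on UNIV h" "bounded_supp h" "Lp_int p (\<lambda>x. f x - h x) \<le> ennreal \<epsilon>"
proof -
  obtain g where g[measurable]: "g \<in> borel_measurable lebesgue" "bounded_supp g"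
    and fg: "Lp_int p (\<lambda>x. f x - g x) < ennreal (\<epsilon> / 2)"
    using truncation_approx[OF p(1) f, of "\<epsilon> / 2"] \<epsilon> by auto
  obtain h where h: "continuous_on UNIV h" "bounded_supp h" "Lp_int p (\<lambda>x. g x - h x) < ennreal (\<epsilon> / 2)"
    using continuous_approx_bounded_supp[OF p(1) g, of "\<epsilon> / 2"] \<epsilon> by auto
  have "h \<in> borel_measurable lebesgue"
    using borel_measurable_continuous_onI[OF h(1)] by (simp add: measurable_completion)
  then have "Lp_int p (\<lambda>x. f x - h x) \<le> ennreal (\<epsilon> / 2) + ennreal (\<epsilon> / 2)"
    using fg h f by (intro order_trans[OF Lp_int_triangle[OF p, of f g h] add_mono]) (auto simp: Lp_funs_iff)
  then have "Lp_int p (\<lambda>x. f x - h x) \<le> ennreal \<epsilon>"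
    using \<epsilon> by (simp flip: ennreal_plus)
  with h that show thesis by blast
qed

section \<open>Synthesis from lattice samples\<close>


lemma finite_bounded_int_vecs: "finite {m :: int ^ 'n::finite. \<forall>i. \<bar>m $ i\<bar> \<le> N}"
proof (rule finite_subset)
  show "{m :: int ^ 'n. \<forall>i. \<bar>m $ i\<bar> \<le> N} \<subseteq> vec_lambda ` (PiE UNIV (\<lambda>_. {-N..N}))"
  proof
    fix m :: "int ^ 'n" assume m: "m \<in> {m. \<forall>i. \<bar>m $ i\<bar> \<le> N}"
    have "- N \<le> m $ i \<and> m $ i \<le> N" for i using m[THEN CollectD, THEN spec, of i] by auto
    then show "m \<in> vec_lambda ` (PiE UNIV (\<lambda>_. {-N..N}))"
      by (intro image_eqI[of _ _ "vec_nth m"]) (auto simp: vec_lambda_eta)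
  qed
qed (intro finite_imageI finite_PiE; simp)

lemma bounded_supp_compose_matrix:
  assumes B: "invertible (B :: real ^ 'n ^ 'n)" and "bounded_supp f"
  shows "bounded_supp (\<lambda>x. f (B *v x))"
proof -
  obtain K R where f: "\<And>x. norm (f x) \<le> K" "\<And>x. R < norm x \<Longrightarrow> f x = 0"
    using assms unfolding bounded_supp_def by metis
  let ?L = "onorm ((*v) (matrix_inv B))"
  have "norm x \<le> ?L * norm (B *v x)" for x
    using onorm[OF matrix_vector_mul_bounded_linear, of "matrix_inv B" "B *v x"]
    by (simp add: matrix_inv_mult_vec[OF B])
  moreover have "0 \<le> ?L" by (rule onorm_pos_le[OF matrix_vector_mul_bounded_linear])
  ultimately have "f (B *v x) = 0" if "?L * max R 0 < norm x" for x
    using that f(2)[of "B *v x"] by (metis max.cobounded1 mult_left_mono not_le order_trans max.bounded_iff)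
  then show ?thesis
    unfolding bounded_supp_def using f(1) by blast
qed

lemma integrable_bounded_supp:
  assumes [measurable]: "f \<in> borel_measurable lebesgue" and "bounded_supp f"
  shows "integrable lebesgue f"
proof -
  have "integrable lebesgue (\<lambda>x. norm (f x) powr 1)"
    using bounded_supp_Lp[of 1 f] assms by (simp add: Lp_funs_def)
  then have "integrable lebesgue (\<lambda>x. norm (f x))" by simp
  then show ?thesis by (subst (asm) integrable_norm_iff) auto
qed

lemma finite_measure_unit_cube: "finite_measure (restrict_space lebesgue (unit_cube :: (real ^ 'n) set))"
  by (rule finite_measureI)
    (simp add: emeasure_unit_cube space_restrict_space emeasure_restrict_space unit_cube_borel)

lemma measure_unit_cube_space:
  "measure (restrict_space lebesgue unit_cube) (space (restrict_space lebesgue (unit_cube :: (real ^ 'n) set))) = 1"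
  using emeasure_unit_cube[where 'n = 'n]
  by (simp add: space_restrict_space emeasure_restrict_space unit_cube_borel measure_def)

text \<open>Unfolding: the integer translates of the unit cube tile the space, and by
  \<open>supp\<close> those outside \<open>F\<close> contribute nothing. It turns the nonzero
  integral of a synthesizer into a nonzero mean of its periodization.\<close>

lemma integral_periodization:
  fixes g :: "real ^ 'n \<Rightarrow> complex"
  assumes g[measurable]: "g \<in> borel_measurable lebesgue" "bounded_supp g" and F: "finite F"
    and supp: "\<And>u m. u \<in> unit_cube \<Longrightarrow> m \<notin> F \<Longrightarrow> g (u + int_vec m) = 0"
  shows "(\<integral>u. (\<Sum>m\<in>F. g (u + int_vec m)) \<partial>restrict_space lebesgue unit_cube) = (\<integral>x. g x \<partial>lebesgue)"
proof -
  let ?Q = "unit_cube :: (real ^ 'n) set"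
  let ?M = "restrict_space lebesgue ?Q"
  interpret finite_measure ?M by (rule finite_measure_unit_cube)
  obtain K where K: "\<And>x. norm (g x) \<le> K" using g(2) unfolding bounded_supp_def by blast
  have shift[measurable]: "(\<lambda>u. g (u + v)) \<in> borel_measurable lebesgue" for v
    using measurable_compose[OF translation_measurable_lebesgue[of "- v"] g(1)] by simp
  have Q[simp]: "?Q \<in> sets lebesgue" by (simp add: unit_cube_borel)
  have ind[measurable]: "(\<lambda>x. indicator ?Q (x - v) :: real) \<in> borel_measurable lebesgue" for v
    by (rule measurable_compose[OF translation_measurable_lebesgue]) (rule borel_measurable_indicator, simp)
  have "(\<integral>u. (\<Sum>m\<in>F. g (u + int_vec m)) \<partial>?M) = (\<Sum>m\<in>F. \<integral>u. g (u + int_vec m) \<partial>?M)"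
    by (intro Bochner_Integration.integral_sum integrable_const_bound[of _ K]) (auto simp: K measurable_restrict_space1)
  also have "\<dots> = (\<Sum>m\<in>F. \<integral>x. indicator ?Q (x - int_vec m) *\<^sub>R g x \<partial>lebesgue)"
  proof (rule sum.cong[OF refl])
    fix m
    have "(\<integral>u. g (u + int_vec m) \<partial>?M) = (\<integral>u. indicator ?Q u *\<^sub>R g (u + int_vec m) \<partial>lebesgue)"
      by (subst integral_restrict_space) (auto simp: set_lebesgue_integral_def)
    also have "\<dots> = (\<integral>x. indicator ?Q (x - int_vec m) *\<^sub>R g (x - int_vec m + int_vec m) \<partial>lebesgue)"
      by (rule integral_lebesgue_translation[symmetric])
        (intro borel_measurable_scaleR borel_measurable_indicator shift Q)
    finally show "(\<integral>u. g (u + int_vec m) \<partial>?M) = (\<integral>x. indicator ?Q (x - int_vec m) *\<^sub>R g x \<partial>lebesgue)"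
      by simp
  qed
  also have "\<dots> = (\<integral>x. (\<Sum>m\<in>F. indicator ?Q (x - int_vec m) *\<^sub>R g x) \<partial>lebesgue)"
  proof (rule Bochner_Integration.integral_sum[symmetric])
    fix m
    show "integrable lebesgue (\<lambda>x. indicator ?Q (x - int_vec m) *\<^sub>R g x)"
      by (rule Bochner_Integration.integrable_bound[OF integrable_bounded_supp[OF g]])
        (measurable, auto simp: indicator_def)
  qed
  also have "\<dots> = (\<integral>x. g x \<partial>lebesgue)"
  proof (rule Bochner_Integration.integral_cong[OF refl])
    fix x
    show "(\<Sum>m\<in>F. indicator ?Q (x - int_vec m) *\<^sub>R g x) = g x"
    proof (cases "g x = 0")
      case False
      then have "floor_vec x \<in> F"
        using supp[OF frac_in_unit_cube, of "floor_vec x" x] by auto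
      have "(\<Sum>m\<in>F. indicator ?Q (x - int_vec m) *\<^sub>R g x) = (\<Sum>m\<in>F. if m = floor_vec x then g x else 0)"
        by (intro sum.cong refl) (auto simp: indicator_def floor_vec_eq_iff[symmetric])
      also have "\<dots> = g x" using \<open>floor_vec x \<in> F\<close> F by simp
      finally show ?thesis .
    qed simp
  qed
  finally show ?thesis .
qed

text \<open>An exact form of equidistribution: a factor that depends on the cell and a factor that
  depends on the position within the cell decouple at every scale, with no limit involved.\<close>

lemma Lp_int_floor_frac:
  fixes T :: "real ^ 'n ^ 'n" and W :: "real ^ 'n \<Rightarrow> complex" and H :: "int ^ 'n \<Rightarrow> complex"
  assumes T: "invertible T" and W[measurable]: "W \<in> borel_measurable lebesgue"
  shows "Lp_int p (\<lambda>x. H (floor_vec (T *v x)) * W (T *v x - int_vec (floor_vec (T *v x))))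
    = ennreal (1 / \<bar>det T\<bar>) * ((\<integral>\<^sup>+k. ennreal (norm (H k) powr p) \<partial>count_space UNIV) *
        (\<integral>\<^sup>+u. ennreal (norm (W u) powr p) \<partial>restrict_space lebesgue unit_cube))"
proof -
  let ?Q = "unit_cube :: (real ^ 'n) set"
  define G where "G k u = ennreal (norm (H k * W u) powr p)" for k u
  have G[measurable]: "G k \<in> borel_measurable lebesgue" for k unfolding G_def by measurable
  have det: "det T \<noteq> 0" using T invertible_det_nz by blast
  have Q[measurable]: "?Q \<in> sets lebesgue" by (simp add: unit_cube_borel)
  define A where "A = Lp_int p (\<lambda>x. H (floor_vec (T *v x)) * W (T *v x - int_vec (floor_vec (T *v x))))"
  have "ennreal \<bar>det T\<bar> * A = (\<integral>\<^sup>+s. G (floor_vec s) (s - int_vec (floor_vec s)) \<partial>lebesgue)"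
    using nn_integral_lebesgue_affine[OF T floor_frac_measurable[OF G], where v = 0]
    by (simp add: A_def Lp_int_def G_def)
  also have "\<dots> = (\<integral>\<^sup>+k. \<integral>\<^sup>+u. G k u * indicator ?Q u \<partial>lebesgue \<partial>count_space UNIV)"
    by (rule nn_integral_floor_frac[OF G])
  also have "\<dots> = (\<integral>\<^sup>+k. ennreal (norm (H k) powr p) *
      (\<integral>\<^sup>+u. ennreal (norm (W u) powr p) * indicator ?Q u \<partial>lebesgue) \<partial>count_space UNIV)"
    unfolding G_def
    by (intro nn_integral_cong, subst nn_integral_cmult[symmetric])
      (auto simp: norm_mult powr_mult ennreal_mult mult.assoc)
  also have "\<dots> = (\<integral>\<^sup>+k. ennreal (norm (H k) powr p) \<partial>count_space UNIV) *
      (\<integral>\<^sup>+u. ennreal (norm (W u) powr p) \<partial>restrict_space lebesgue ?Q)"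
    by (subst nn_integral_multc) (auto simp: nn_integral_restrict_space)
  finally have eq: "ennreal \<bar>det T\<bar> * A = (\<integral>\<^sup>+k. ennreal (norm (H k) powr p) \<partial>count_space UNIV) *
      (\<integral>\<^sup>+u. ennreal (norm (W u) powr p) \<partial>restrict_space lebesgue ?Q)" .
  have "A = ennreal (1 / \<bar>det T\<bar>) * (ennreal \<bar>det T\<bar> * A)"
    using det by (simp add: mult.assoc[symmetric] ennreal_mult'[symmetric])
  then show ?thesis unfolding eq unfolding A_def .
qed

context affine_system
begin

text \<open>All mass sits at the single scale \<open>j\<close>. The power of the determinant undoes
  the normalization of the dilates, so that \<open>S\<close> returns \<open>z\<close> times the
  samples weighted by plain translates.\<close>

definition sample_seq :: "complex \<Rightarrow> nat \<Rightarrow> (int ^ 'n \<Rightarrow> complex) \<Rightarrow> nat \<times> (int ^ 'n) \<Rightarrow> complex" where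
  "sample_seq z j H = (\<lambda>(j', k). if j' = j then z * of_real (\<bar>det (a j)\<bar> powr (- 1 / p)) * H k else 0)"

lemma det_powr: "j > 0 \<Longrightarrow> \<bar>det (a j)\<bar> powr (- 1 / p) * \<bar>det (a j)\<bar> powr (1 / p) = 1"
  using inv[of j] invertible_det_nz[of "a j"] by (simp add: powr_add[symmetric])

lemma seq_int_sample_seq:
  assumes j: "j > 0"
  shows "seq_int p (sample_seq z j H)
    = ennreal (norm z powr p / \<bar>det (a j)\<bar>) * (\<integral>\<^sup>+k. ennreal (norm (H k) powr p) \<partial>count_space UNIV)"
proof -
  have "norm (z * of_real (\<bar>det (a j)\<bar> powr (- 1 / p)) * H k) powr p
      = norm z powr p / \<bar>det (a j)\<bar> * norm (H k) powr p" for k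
  proof -
    have "(\<bar>det (a j)\<bar> powr (- 1 / p)) powr p = 1 / \<bar>det (a j)\<bar>"
      using p inv[OF j] invertible_det_nz[of "a j"] by (simp add: powr_powr powr_minus divide_inverse inverse_powr)
    then show ?thesis by (simp add: norm_mult powr_mult)
  qed
  note norm_eq = this
  have "seq_int p (sample_seq z j H)
      = (\<integral>\<^sup>+i. ennreal (norm (sample_seq z j H i) powr p) \<partial>count_space ({j} \<times> UNIV))"
    unfolding seq_int_def using j
    by (intro nn_integral_count_space_eq) (auto simp: sample_seq_def index_set_def split: if_splits)
  also have "\<dots> = (\<integral>\<^sup>+k. ennreal (norm (sample_seq z j H (j, k)) powr p) \<partial>count_space UNIV)"
    by (rule nn_integral_bij_count_space[symmetric, of "\<lambda>k. (j, k)"], rule bij_betwI[of _ _ _ snd]) auto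
  also have "\<dots> = (\<integral>\<^sup>+k. ennreal (norm z powr p / \<bar>det (a j)\<bar>) * ennreal (norm (H k) powr p) \<partial>count_space UNIV)"
    by (intro nn_integral_cong, subst ennreal_mult'[symmetric])
      (simp, simp only: sample_seq_def prod.case simp_thms if_True norm_eq)
  finally show ?thesis by (simp add: nn_integral_cmult)
qed

text \<open>With \<open>k0\<close> and \<open>u\<close> the integer and fractional parts of
  \<open>T *v x\<close>, the argument \<open>a j *v x - b *v int_vec k\<close> equals
  \<open>b *v (u + int_vec (k0 - k))\<close>. Hence only the finitely many \<open>k\<close> with
  \<open>k0 - k\<close> in \<open>F\<close> contribute.\<close>

lemma synthesis_sample_seq:
  assumes j: "j > 0" and b: "invertible b" and F: "finite F"
    and supp: "\<And>u m. u \<in> unit_cube \<Longrightarrow> m \<notin> F \<Longrightarrow> \<psi> (b *v (u + int_vec m)) = 0"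
  defines "T \<equiv> matrix_inv b ** a j"
  shows "S \<psi> (sample_seq z j H) x
    = z * (\<Sum>m\<in>F. H (floor_vec (T *v x) - m) * \<psi> (b *v (T *v x - int_vec (floor_vec (T *v x)) + int_vec m)))"
proof -
  define k0 u where "k0 = floor_vec (T *v x)" and "u = T *v x - int_vec k0"
  have u: "u \<in> unit_cube" unfolding u_def k0_def by (rule frac_in_unit_cube)
  have arg: "a j *v x - b *v int_vec k = b *v (u + int_vec (k0 - k))" for k
  proof -
    have "u + int_vec (k0 - k) = T *v x - int_vec k" by (simp add: u_def int_vec_diff)
    also have "b *v \<dots> = b *v (T *v x) - b *v int_vec k" by (rule matrix_vector_mult_diff_distrib)
    also have "b *v (T *v x) = a j *v x"
      unfolding T_def by (simp add: matrix_vector_mul_assoc[symmetric] matrix_inv_mult_vec[OF b])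
    finally show ?thesis by simp
  qed
  define t where "t i = sample_seq z j H i * dilate_translate p a b \<psi> i x" for i
  have t: "t (j, k) = z * (H k * \<psi> (b *v (u + int_vec (k0 - k))))" for k
  proof -
    have "complex_of_real (\<bar>det (a j)\<bar> powr (- 1 / p)) * complex_of_real (\<bar>det (a j)\<bar> powr (1 / p)) = 1"
      unfolding of_real_mult[symmetric] det_powr[OF j] by simp
    then show ?thesis
      by (simp add: t_def sample_seq_def dilate_translate_def arg mult_ac)
  qed
  have "S \<psi> (sample_seq z j H) x = (\<Sum>\<^sub>\<infinity>i\<in>(\<lambda>m. (j, k0 - m)) ` F. t i)"
    unfolding synthesis_fun_def t_def[symmetric]
  proof (rule infsum_cong_neutral)
    fix i assume i: "i \<in> index_set - (\<lambda>m. (j, k0 - m)) ` F"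
    show "t i = 0"
    proof (cases "fst i = j")
      case True
      then have "i = (j, snd i)" by auto
      moreover have "k0 - snd i \<notin> F"
      proof
        assume "k0 - snd i \<in> F"
        then have "(j, k0 - (k0 - snd i)) \<in> (\<lambda>m. (j, k0 - m)) ` F" by (rule imageI)
        then show False using i \<open>i = (j, snd i)\<close> by simp
      qed
      ultimately show ?thesis using t supp[OF u] by (metis mult_zero_right)
    qed (auto simp: t_def sample_seq_def case_prod_unfold)
  qed (use j in \<open>auto simp: index_set_def\<close>)
  also have "\<dots> = (\<Sum>m\<in>F. t (j, k0 - m))"
    using F by (simp add: sum.reindex inj_on_def)
  finally show ?thesis
    by (simp add: t u_def k0_def sum_distrib_left)
qed

end

locale expanding_affine_system = affine_system a b p
  for a :: "nat \<Rightarrow> real ^ 'n ^ 'n" and b :: "real ^ 'n ^ 'n" and p :: real +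
  assumes expanding: "(\<lambda>j. onorm ((*v) (matrix_inv (a j)))) \<longlonglongrightarrow> 0"
    and b: "invertible b"
begin

text \<open>The integral of \<open>\<psi> (b *v x)\<close> is a nonzero multiple of that of
  \<open>\<psi>\<close>. In this form it is the mean over the unit cube of the periodization of
  \<open>\<psi>\<close> along \<open>b\<close>.\<close>

definition nice :: "(real ^ 'n \<Rightarrow> complex) \<Rightarrow> bool" where
  "nice \<psi> \<longleftrightarrow> \<psi> \<in> borel_measurable lebesgue \<and> bounded_supp \<psi> \<and> (\<integral>x. \<psi> (b *v x) \<partial>lebesgue) \<noteq> 0"

lemma nice_Lp: "nice \<psi> \<Longrightarrow> \<psi> \<in> Lp_funs p"
  using bounded_supp_Lp p unfolding nice_def by blast

lemma compose_b_measurable: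
  assumes "\<psi> \<in> borel_measurable lebesgue"
  shows "(\<lambda>x. \<psi> (b *v (x + v))) \<in> borel_measurable lebesgue"
  using measurable_compose[OF affine_measurable_lebesgue[OF b, of "- (b *v v)"] assms]
  by (simp add: matrix_vector_right_distrib)

lemma finite_support_set:
  assumes "bounded_supp \<psi>"
  obtains F :: "(int ^ 'n) set" where "finite F"
    "\<And>u m. u \<in> unit_cube \<Longrightarrow> m \<notin> F \<Longrightarrow> \<psi> (b *v (u + int_vec m)) = 0"
proof -
  obtain R where R: "\<And>x. R < norm x \<Longrightarrow> \<psi> (b *v x) = 0"
    using bounded_supp_compose_matrix[OF b assms] unfolding bounded_supp_def by blast
  \<comment> \<open>The margin \<open>1\<close> absorbs the coordinates of \<open>u\<close>, which
    lie between \<open>0\<close> and \<open>1\<close>.\<close>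
  let ?F = "{m :: int ^ 'n. \<forall>i. \<bar>m $ i\<bar> \<le> \<lceil>R + 1\<rceil>}"
  show thesis
  proof (rule that[of ?F])
    fix u :: "real ^ 'n" and m :: "int ^ 'n" assume u: "u \<in> unit_cube" and m: "m \<notin> ?F"
    then obtain i where i: "\<lceil>R + 1\<rceil> < \<bar>m $ i\<bar>" by (auto simp: not_le)
    have "R + 1 < \<bar>real_of_int (m $ i)\<bar>"
      using i by linarith
    also have "\<bar>real_of_int (m $ i)\<bar> = \<bar>(u + int_vec m) $ i - u $ i\<bar>" by (simp add: int_vec_def)
    also have "\<dots> \<le> \<bar>(u + int_vec m) $ i\<bar> + 1"
      using u by (auto simp: unit_cube_def abs_if dest!: spec[of _ i])
    also have "\<bar>(u + int_vec m) $ i\<bar> \<le> norm (u + int_vec m)" by (rule component_le_norm_cart)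
    finally show "\<psi> (b *v (u + int_vec m)) = 0" by (intro R) simp
  qed (rule finite_bounded_int_vecs)
qed

text \<open>Sampling a continuous \<open>h\<close> on the lattice \<open>a\<^sub>j\<^sup>-\<^sup>1 b \<int>\<^sup>d\<close> gives a synthesis close to \<open>h\<close> times the dilated
  periodization of \<open>z \<psi>\<close>, so the remaining error is about \<open>\<mu> < 1\<close> times the size of \<open>h\<close>.\<close>

lemma nice_imp_approx_onto:
  assumes nice: "nice \<psi>"
  shows "approx_onto \<psi>"
proof -
  have \<psi>[measurable]: "\<psi> \<in> borel_measurable lebesgue" and supp: "bounded_supp \<psi>"
    and mean: "(\<integral>x. \<psi> (b *v x) \<partial>lebesgue) \<noteq> 0"
    using nice by (simp_all add: nice_def)
  obtain K where K: "\<And>x. norm (\<psi> x) \<le> K" using supp unfolding bounded_supp_def by blast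
  obtain F :: "(int ^ 'n) set" where F: "finite F"
    and F0: "\<And>u m. u \<in> unit_cube \<Longrightarrow> m \<notin> F \<Longrightarrow> \<psi> (b *v (u + int_vec m)) = 0"
    using finite_support_set[OF supp] by blast
  note [measurable] = compose_b_measurable[OF \<psi>]
  define P where "P u = (\<Sum>m\<in>F. \<psi> (b *v (u + int_vec m)))" for u
  have P[measurable]: "P \<in> borel_measurable lebesgue" unfolding P_def by measurable
  have P_bound: "norm (P u) \<le> real (card F) * K" for u
    unfolding P_def by (rule sum_norm_bound) (rule K)
  let ?M = "restrict_space lebesgue (unit_cube :: (real ^ 'n) set)"
  have "(\<integral>u. P u \<partial>?M) \<noteq> 0"
    unfolding P_def using mean compose_b_measurable[OF \<psi>, of 0] bounded_supp_compose_matrix[OF b supp] F F0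
    by (subst integral_periodization) auto
  then obtain z \<mu> where \<mu>: "0 \<le> \<mu>" "\<mu> < 1"
    and contract: "(\<integral>\<^sup>+u. ennreal (norm (1 - z * P u) powr p) \<partial>?M) \<le> ennreal \<mu>"
    using finite_measure.exists_contracting_factor[OF finite_measure_unit_cube p measure_unit_cube_space
        measurable_restrict_space1[OF P] P_bound] by blast
  define L where "L = norm z powr p * K powr p"
  \<comment> \<open>The final error is
    \<open>\<mu> * I + \<epsilon> * (2 + 2 * \<mu> + 2 * card F * L)\<close>. As
    \<open>\<mu> < 1\<close>, the last bracket is at most \<open>E\<close>, so the
    \<open>\<epsilon>\<close> chosen below uses up half of the gap between \<open>\<mu>\<close> and
    \<open>1\<close>.\<close>
  define E where "E = 4 + 2 * (real (card F) * L)"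
  have E: "4 \<le> E" "0 \<le> L" by (simp_all add: E_def L_def)
  \<comment> \<open>The factor \<open>3\<close> comes from
    \<open>I + 2 * \<epsilon> \<le> 3 * I\<close>, a bound for the sampled function. The division by
    \<open>\<bar>det b\<bar>\<close> reflects the cell volume of the sampling lattice after
    normalization by \<open>det (a j)\<close>.\<close>
  define C where "C = 3 * (norm z powr p / \<bar>det b\<bar>)"
  have C: "0 \<le> C" by (simp add: C_def)
  have "\<exists>c. seq_int p c \<le> ennreal C * Lp_int p f \<and>
      Lp_int p (\<lambda>x. f x - S \<psi> c x) \<le> ennreal ((1 + \<mu>) / 2) * Lp_int p f"
    if f: "f \<in> Lp_funs p" for f :: "real ^ 'n \<Rightarrow> complex"
  proof (cases "Lp_int p f = 0")
    case True
    have "seq_int p (\<lambda>_. 0) = 0" "S \<psi> (\<lambda>_. 0) x = 0" for x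
      by (simp_all add: seq_int_def synthesis_fun_def)
    with True show ?thesis by (intro exI[of _ "\<lambda>_. 0"]) simp
  next
    case False
    note [measurable] = Lp_funs_measurable[OF f]
    obtain I where I: "Lp_int p f = ennreal I" "0 < I"
      using Lp_int_finite[OF f] False by (cases "Lp_int p f") (auto simp: less_le)
    define \<epsilon> where "\<epsilon> = (1 - \<mu>) / 2 * I / E"
    have \<epsilon>: "0 < \<epsilon>" "\<epsilon> * E = (1 - \<mu>) / 2 * I"
      using \<mu> I E by (simp_all add: \<epsilon>_def)
    have "\<epsilon> * 1 \<le> \<epsilon> * E" using \<epsilon>(1) E(1) by (intro mult_left_mono) auto
    also have "\<dots> \<le> 1 * I" unfolding \<epsilon>(2) using \<mu> I by (intro mult_right_mono) auto
    finally have \<epsilon>_le: "\<epsilon> \<le> I" by simp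
    obtain h where h: "continuous_on UNIV h" "bounded_supp h" and fh: "Lp_int p (\<lambda>x. f x - h x) \<le> ennreal \<epsilon>"
      using continuous_approx[OF p f \<epsilon>(1)] by blast
    have [measurable]: "h \<in> borel_measurable lebesgue"
      using borel_measurable_continuous_onI[OF h(1)] by (simp add: measurable_completion)
    obtain R where "\<And>x. R < norm x \<Longrightarrow> h x = 0"
      using h(2) unfolding bounded_supp_def by blast
    from continuous_displacement_approx[OF p(1) h(1) this \<epsilon>(1)] obtain \<eta> where \<eta>: "0 < \<eta>"
      "\<And>\<rho>. (\<And>x. norm (\<rho> x - x) \<le> \<eta>) \<Longrightarrow> Lp_int p (\<lambda>x. h (\<rho> x) - h x) \<le> ennreal \<epsilon>"
      by blast
    obtain D where D: "\<And>m. m \<in> insert 0 F \<Longrightarrow> norm (int_vec m :: real ^ 'n) \<le> D"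
      using F finite_imp_bounded[of "int_vec ` insert 0 F"] unfolding bounded_iff by auto
    \<comment> \<open>Bounds the norm of \<open>b *v (u + int_vec m)\<close> for \<open>u\<close> in
      the cube and \<open>m\<close> in \<open>insert 0 F\<close>. Times the norm of
      \<open>matrix_inv (a j)\<close> it bounds every displacement that occurs, so a large
      \<open>j\<close> brings them all below \<open>\<eta>\<close>.\<close>
    define B' where "B' = onorm ((*v) b) * (real CARD('n) + D)"
    have B': "0 \<le> B'"
    proof -
      have "0 \<le> D" using D[of 0] norm_ge_zero order_trans by blast
      then show ?thesis unfolding B'_def by (intro mult_nonneg_nonneg onorm_pos_le matrix_vector_mul_bounded_linear) auto
    qed
    have "(\<lambda>j. onorm ((*v) (matrix_inv (a j))) * B') \<longlonglongrightarrow> 0 * B'"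
      by (intro tendsto_mult expanding tendsto_const)
    then have "\<forall>\<^sub>F j in sequentially. onorm ((*v) (matrix_inv (a j))) * B' < \<eta> \<and> 0 < j"
      using \<eta>(1) by (intro eventually_conj order_tendstoD(2) eventually_gt_at_top) auto
    then obtain j where j: "0 < j" and small: "onorm ((*v) (matrix_inv (a j))) * B' < \<eta>"
      by (auto simp: eventually_sequentially)
    \<comment> \<open>\<open>T\<close> carries the sampling lattice to the integer lattice, and
      \<open>B\<close> is its inverse: the sampling points are
      \<open>B *v int_vec k\<close>.\<close>
    define T where "T = matrix_inv b ** a j"
    define B where "B = matrix_inv (a j) ** b"
    have det: "det T = det (a j) / det b" "det b \<noteq> 0" "det (a j) \<noteq> 0"
      using b inv[OF j] invertible_det_nz by (auto simp: T_def det_mul det_matrix_inv)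
    then have T: "invertible T" by (simp add: invertible_det_nz)
    have BT: "B *v (T *v x) = x" for x
      unfolding B_def T_def by (simp add: matrix_vector_mul_assoc[symmetric] matrix_inv_mult_vec[OF b] matrix_inv_mult_vec[OF inv[OF j]])
    define fl u where "fl x = floor_vec (T *v x)" and "u x = T *v x - int_vec (fl x)" for x
    have u: "u x \<in> unit_cube" for x unfolding u_def fl_def by (rule frac_in_unit_cube)
    define H where "H k = h (B *v int_vec k)" for k
    \<comment> \<open>\<open>g m\<close> takes the sample of \<open>h\<close> at the lattice point
      \<open>m\<close> steps away from the cell of \<open>x\<close>. It is constant on cells and,
      for \<open>m\<close> in \<open>insert 0 F\<close>, has distance at most
      \<open>\<epsilon>\<close> from \<open>h\<close>.\<close>
    define g where "g m x = H (fl x - m)" for m x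
    have fl_meas: "fl \<in> lebesgue \<rightarrow>\<^sub>M count_space UNIV"
      using measurable_compose[OF affine_measurable_lebesgue[OF T, of 0] floor_vec_measurable] by (simp add: fl_def[abs_def])
    have g_meas[measurable]: "g m \<in> borel_measurable lebesgue" for m
      unfolding g_def by (rule measurable_compose[OF fl_meas]) simp
    have frac_meas: "(\<lambda>x. W (u x)) \<in> borel_measurable lebesgue" if "W \<in> borel_measurable lebesgue" for W :: "_ \<Rightarrow> complex"
      using measurable_compose[OF affine_measurable_lebesgue[OF T, of 0] floor_frac_measurable[of "\<lambda>_. W"]] that
      by (simp add: u_def fl_def)
    have gh: "Lp_int p (\<lambda>x. g m x - h x) \<le> ennreal \<epsilon>" if m: "m \<in> insert 0 F" for m
      unfolding g_def H_def
    proof (rule \<eta>(2))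
      fix x
      have "B *v int_vec (fl x - m) - x = - (B *v (u x + int_vec m))"
        using BT[of x] by (simp add: u_def int_vec_diff matrix_vector_mult_diff_distrib matrix_vector_right_distrib)
      then have "norm (B *v int_vec (fl x - m) - x) = norm (matrix_inv (a j) *v (b *v (u x + int_vec m)))"
        by (simp add: B_def matrix_vector_mul_assoc)
      also have "\<dots> \<le> onorm ((*v) (matrix_inv (a j))) * norm (b *v (u x + int_vec m))"
        by (rule onorm[OF matrix_vector_mul_bounded_linear])
      also have "\<dots> \<le> onorm ((*v) (matrix_inv (a j))) * B'"
      proof (intro mult_left_mono onorm_pos_le matrix_vector_mul_bounded_linear)
        have "norm (b *v (u x + int_vec m)) \<le> onorm ((*v) b) * norm (u x + int_vec m)"
          by (rule onorm[OF matrix_vector_mul_bounded_linear])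
        also have "\<dots> \<le> B'"
          unfolding B'_def using norm_unit_cube_le[OF u[of x]] D[OF m]
          by (intro mult_left_mono order_trans[OF norm_triangle_ineq add_mono] onorm_pos_le matrix_vector_mul_bounded_linear)
        finally show "norm (b *v (u x + int_vec m)) \<le> B'" .
      qed
      finally show "norm (B *v int_vec (fl x - m) - x) \<le> \<eta>" using small by simp
    qed
    have hg: "Lp_int p (\<lambda>x. h x - g m x) \<le> ennreal \<epsilon>" if "m \<in> insert 0 F" for m
      using gh[OF that] by (simp add: Lp_int_minus_commute)
    have gg: "Lp_int p (\<lambda>x. g 0 x - g m x) \<le> ennreal (2 * \<epsilon>)" if "m \<in> insert 0 F" for m
    proof -
      have "Lp_int p (\<lambda>x. g 0 x - g m x) \<le> ennreal \<epsilon> + ennreal \<epsilon>"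
        using gh hg that by (intro order_trans[OF Lp_int_triangle[OF p, of "g 0" h "g m"] add_mono]) auto
      then show ?thesis using \<epsilon> by (simp flip: ennreal_plus)
    qed
    define J where "J = (\<integral>\<^sup>+k. ennreal (norm (H k) powr p) \<partial>count_space UNIV)"
    have exact: "Lp_int p (\<lambda>x. g 0 x * W (u x))
        = ennreal (1 / \<bar>det T\<bar>) * (J * (\<integral>\<^sup>+u. ennreal (norm (W u) powr p) \<partial>?M))"
      if "W \<in> borel_measurable lebesgue" for W
      using Lp_int_floor_frac[OF T that, of p H] by (simp add: g_def J_def u_def fl_def)
    have "(\<integral>\<^sup>+u. 1 \<partial>?M) = 1"
      using emeasure_unit_cube[where 'n = 'n] by (simp add: emeasure_restrict_space space_restrict_space unit_cube_borel)
    then have g0: "Lp_int p (g 0) = ennreal (1 / \<bar>det T\<bar>) * J"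
      using exact[of "\<lambda>_. 1"] by simp
    have g0_le: "Lp_int p (g 0) \<le> ennreal (I + 2 * \<epsilon>)"
    proof -
      have "Lp_int p (g 0) = Lp_int p (\<lambda>x. (g 0 x - h x) + ((h x - f x) + f x))" by simp
      also have "\<dots> \<le> Lp_int p (\<lambda>x. g 0 x - h x) + Lp_int p (\<lambda>x. (h x - f x) + f x)"
        by (intro Lp_int_add_le p) measurable
      also have "\<dots> \<le> Lp_int p (\<lambda>x. g 0 x - h x) + (Lp_int p (\<lambda>x. h x - f x) + Lp_int p f)"
        by (intro add_left_mono Lp_int_add_le p) measurable
      also have "\<dots> \<le> ennreal \<epsilon> + (ennreal \<epsilon> + ennreal I)"
        using gh fh I by (intro add_mono) (auto simp: Lp_int_minus_commute[of p h f])
      also have "\<dots> = ennreal (I + 2 * \<epsilon>)" using \<epsilon> I by (simp flip: ennreal_plus)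
      finally show ?thesis .
    qed
    define c where "c = sample_seq z j H"
    have "J = ennreal (\<bar>det (a j)\<bar> / \<bar>det b\<bar>) * Lp_int p (g 0)"
      unfolding g0 using det by (simp add: mult.assoc[symmetric] ennreal_mult'[symmetric])
    then have "seq_int p c = ennreal (norm z powr p / \<bar>det b\<bar>) * Lp_int p (g 0)"
      unfolding c_def seq_int_sample_seq[OF j] J_def[symmetric] using det
      by (simp add: mult.assoc[symmetric] ennreal_mult'[symmetric])
    also have "\<dots> \<le> ennreal (norm z powr p / \<bar>det b\<bar>) * ennreal (3 * I)"
      using \<epsilon>_le by (intro mult_left_mono order_trans[OF g0_le] ennreal_leI) auto
    also have "\<dots> = ennreal C * Lp_int p f"
      using I by (simp add: C_def ennreal_mult'[symmetric] mult_ac)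
    finally have c_le: "seq_int p c \<le> ennreal C * Lp_int p f" .
    have Sc: "S \<psi> c x = z * (\<Sum>m\<in>F. g m x * \<psi> (b *v (u x + int_vec m)))" for x
      unfolding c_def using synthesis_sample_seq[where \<psi> = \<psi>, OF j b F F0]
      by (simp add: g_def u_def fl_def T_def)
    define q where "q m x = g 0 x - g m x" for m x
    define e where "e m x = z * (q m x * \<psi> (b *v (u x + int_vec m)))" for m x
    have [measurable]: "q m \<in> borel_measurable lebesgue" for m unfolding q_def by measurable
    have [measurable]: "(\<lambda>x. \<psi> (b *v (u x + int_vec m))) \<in> borel_measurable lebesgue" for m
      by (rule frac_meas[of "\<lambda>s. \<psi> (b *v (s + int_vec m))"]) measurable
    have [measurable]: "(\<lambda>x. 1 - z * P (u x)) \<in> borel_measurable lebesgue"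
      by (rule frac_meas[of "\<lambda>s. 1 - z * P s"]) measurable
    have [measurable]: "e m \<in> borel_measurable lebesgue" for m unfolding e_def by measurable
    \<comment> \<open>The synthesis mixes samples from several neighbouring cells. Replacing all of
      them by \<open>g 0\<close> collects the translates into \<open>P\<close> and leaves a product
      to which the exact factorization applies; \<open>e m\<close> is the cost of the
      replacement.\<close>
    have split: "f x - S \<psi> c x = (f x - h x) + ((h x - g 0 x) + (g 0 x * (1 - z * P (u x)) + (\<Sum>m\<in>F. e m x)))" for x
      unfolding Sc P_def e_def q_def
      by (simp add: algebra_simps sum_distrib_left sum_subtractf)
    have main: "Lp_int p (\<lambda>x. g 0 x * (1 - z * P (u x))) \<le> ennreal \<mu> * ennreal (I + 2 * \<epsilon>)"
    proof -
      have "Lp_int p (\<lambda>x. g 0 x * (1 - z * P (u x)))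
          = ennreal (1 / \<bar>det T\<bar>) * (J * (\<integral>\<^sup>+u. ennreal (norm (1 - z * P u) powr p) \<partial>?M))"
        by (rule exact[of "\<lambda>s. 1 - z * P s"]) measurable
      also have "\<dots> \<le> ennreal (1 / \<bar>det T\<bar>) * (J * ennreal \<mu>)"
        by (intro mult_left_mono contract) auto
      also have "\<dots> = ennreal \<mu> * Lp_int p (g 0)"
        unfolding g0 by (simp add: mult_ac)
      also have "\<dots> \<le> ennreal \<mu> * ennreal (I + 2 * \<epsilon>)"
        by (intro mult_left_mono g0_le) auto
      finally show ?thesis .
    qed
    have err: "Lp_int p (\<lambda>x. \<Sum>m\<in>F. e m x) \<le> ennreal (real (card F) * (L * (2 * \<epsilon>)))"
    proof -
      have "Lp_int p (e m) \<le> ennreal (L * (2 * \<epsilon>))" if "m \<in> F" for m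
      proof -
        have "norm (e m x) \<le> norm ((z * of_real K) * q m x)" for x
        proof -
          have "norm (e m x) = norm z * norm (q m x) * norm (\<psi> (b *v (u x + int_vec m)))"
            by (simp add: e_def norm_mult)
          also have "\<dots> \<le> norm z * norm (q m x) * K" by (intro mult_left_mono K) auto
          also have "\<dots> = norm ((z * of_real K) * q m x)"
            using order_trans[OF norm_ge_zero K] by (simp add: norm_mult)
          finally show ?thesis .
        qed
        then have "Lp_int p (e m) \<le> Lp_int p (\<lambda>x. (z * of_real K) * q m x)"
          using p by (intro Lp_int_mono) auto
        also have "\<dots> = ennreal L * Lp_int p (q m)"
          using order_trans[OF norm_ge_zero K] by (simp add: Lp_int_cmult L_def norm_mult powr_mult)
        also have "\<dots> \<le> ennreal L * ennreal (2 * \<epsilon>)"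
          unfolding q_def using that by (intro mult_left_mono gg) auto
        finally show ?thesis using E by (simp add: ennreal_mult'[symmetric])
      qed
      then have "(\<Sum>m\<in>F. Lp_int p (e m)) \<le> (\<Sum>m\<in>F. ennreal (L * (2 * \<epsilon>)))"
        by (rule sum_mono)
      also have "\<dots> = ennreal (real (card F) * (L * (2 * \<epsilon>)))"
        by (simp add: ennreal_mult' ennreal_of_nat_eq_real_of_nat)
      finally show ?thesis
        by (intro order_trans[OF Lp_int_sum_le[OF p]]) auto
    qed
    have "Lp_int p (\<lambda>x. f x - S \<psi> c x)
        \<le> Lp_int p (\<lambda>x. f x - h x) + (Lp_int p (\<lambda>x. h x - g 0 x) +
          (Lp_int p (\<lambda>x. g 0 x * (1 - z * P (u x))) + Lp_int p (\<lambda>x. \<Sum>m\<in>F. e m x)))"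
      unfolding split
      by (intro order_trans[OF Lp_int_add_le[OF p]] add_left_mono) measurable
    also have "\<dots> \<le> ennreal \<epsilon> + (ennreal \<epsilon> + (ennreal \<mu> * ennreal (I + 2 * \<epsilon>) + ennreal (real (card F) * (L * (2 * \<epsilon>)))))"
      by (intro add_mono fh hg main err) simp
    also have "\<dots> = ennreal (\<epsilon> + (\<epsilon> + (\<mu> * (I + 2 * \<epsilon>) + real (card F) * (L * (2 * \<epsilon>)))))"
      using \<epsilon> \<mu> I E by (simp add: ennreal_mult'[symmetric] flip: ennreal_plus)
    also have "\<dots> \<le> ennreal ((1 + \<mu>) / 2 * I)"
    proof (rule ennreal_leI)
      have "\<epsilon> * (2 + 2 * \<mu> + 2 * (real (card F) * L)) \<le> \<epsilon> * E"
        using \<epsilon> \<mu> by (intro mult_left_mono) (auto simp: E_def)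
      then show "\<epsilon> + (\<epsilon> + (\<mu> * (I + 2 * \<epsilon>) + real (card F) * (L * (2 * \<epsilon>)))) \<le> (1 + \<mu>) / 2 * I"
        unfolding \<epsilon>(2) by (simp add: algebra_simps)
    qed
    also have "\<dots> = ennreal ((1 + \<mu>) / 2) * Lp_int p f"
      unfolding I(1) using \<mu> I by (intro ennreal_mult) auto
    finally show ?thesis using c_le by blast
  qed
  then show ?thesis
    unfolding approx_onto_def using C \<mu> by (intro exI[of _ C] exI[of _ "(1 + \<mu>) / 2"]) auto
qed

end

section \<open>Density, openness and path connectedness\<close>


lemma bounded_supp_combination:
  assumes "bounded_supp f" "bounded_supp g"
  shows "bounded_supp (\<lambda>x. s * f x + t * g x)"
proof -
  obtain K R K' R' where f: "\<And>x. norm (f x) \<le> K" "\<And>x. R < norm x \<Longrightarrow> f x = 0"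
    and g: "\<And>x. norm (g x) \<le> K'" "\<And>x. R' < norm x \<Longrightarrow> g x = 0"
    using assms unfolding bounded_supp_def by metis
  have "norm (s * f x + t * g x) \<le> norm s * K + norm t * K'" for x
    by (rule order_trans[OF norm_triangle_ineq add_mono]) (auto simp: norm_mult f g intro!: mult_left_mono)
  moreover have "s * f x + t * g x = 0" if "max R R' < norm x" for x
    using that f g by simp
  ultimately show ?thesis unfolding bounded_supp_def by blast
qed

lemma pathin_Lp_combination:
  fixes f g :: "'a::euclidean_space \<Rightarrow> complex"
  assumes p: "0 < p" "p \<le> 1" and f: "f \<in> Lp_funs p" and g: "g \<in> Lp_funs p"
    and \<alpha>: "continuous_on {0..1} \<alpha>" and \<beta>: "continuous_on {0..1} \<beta>"
  shows "pathin (Lp_topology p) (\<lambda>t. Lp_class p (\<lambda>x. \<alpha> t * f x + \<beta> t * g x))"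
proof -
  interpret Metric_space "Lp p :: ('a \<Rightarrow> complex) set set" "Lp_dist p"
    by (rule Metric_space_Lp[OF p])
  note [measurable] = Lp_funs_measurable[OF f] Lp_funs_measurable[OF g]
  have comb: "(\<lambda>x. \<alpha> t * f x + \<beta> t * g x) \<in> Lp_funs p" for t
    by (intro Lp_funs_add Lp_funs_cmult p f g)
  obtain I J where I: "Lp_int p f = ennreal I" "0 \<le> I" and J: "Lp_int p g = ennreal J" "0 \<le> J"
    using Lp_int_finite[OF f] Lp_int_finite[OF g] by (cases "Lp_int p f"; cases "Lp_int p g") auto
  show ?thesis
    unfolding pathin_def Lp_topology_def continuous_map_to_metric
  proof (intro ballI allI impI)
    fix t \<epsilon> :: real assume t: "t \<in> topspace (top_of_set {0..1})" and \<epsilon>: "0 < \<epsilon>"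
    \<comment> \<open>Bounds the distance between the points of the path at \<open>t\<close> and
      \<open>s\<close>; it is continuous in \<open>s\<close> and vanishes at
      \<open>s = t\<close>.\<close>
    define \<phi> where "\<phi> s = norm (\<alpha> t - \<alpha> s) powr p * I + norm (\<beta> t - \<beta> s) powr p * J" for s
    have "continuous_on {0..1} \<phi>"
      unfolding \<phi>_def using p by (intro continuous_intros continuous_on_powr' \<alpha> \<beta>) auto
    then have "openin (top_of_set {0..1}) ({0..1} \<inter> \<phi> -` {..<\<epsilon>})"
      by (rule continuous_openin_preimage_gen) simp
    moreover have "t \<in> {0..1} \<inter> \<phi> -` {..<\<epsilon>}" using t \<epsilon> p by (simp add: \<phi>_def)
    moreover have "Lp_class p (\<lambda>x. \<alpha> s * f x + \<beta> s * g x) \<in> mball (Lp_class p (\<lambda>x. \<alpha> t * f x + \<beta> t * g x)) \<epsilon>"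
      if s: "s \<in> {0..1} \<inter> \<phi> -` {..<\<epsilon>}" for s
    proof -
      have "Lp_int p (\<lambda>x. (\<alpha> t * f x + \<beta> t * g x) - (\<alpha> s * f x + \<beta> s * g x))
          = Lp_int p (\<lambda>x. (\<alpha> t - \<alpha> s) * f x + (\<beta> t - \<beta> s) * g x)"
        by (simp add: algebra_simps)
      also have "\<dots> \<le> Lp_int p (\<lambda>x. (\<alpha> t - \<alpha> s) * f x) + Lp_int p (\<lambda>x. (\<beta> t - \<beta> s) * g x)"
        by (intro Lp_int_add_le p) measurable
      also have "\<dots> = ennreal (\<phi> s)"
        using I J by (simp add: Lp_int_cmult \<phi>_def ennreal_mult'[symmetric] flip: ennreal_plus)
      also have "\<dots> < ennreal \<epsilon>"
        using s I J by (intro ennreal_lessI) (auto simp: \<epsilon>)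
      finally show ?thesis
        by (simp add: Lp_class_mem comb Lp_dist_class_less_iff[OF p])
    qed
    ultimately show "\<exists>U. openin (top_of_set {0..1}) U \<and> t \<in> U \<and>
        (\<forall>s\<in>U. Lp_class p (\<lambda>x. \<alpha> s * f x + \<beta> s * g x) \<in> mball (Lp_class p (\<lambda>x. \<alpha> t * f x + \<beta> t * g x)) \<epsilon>)"
      by blast
  qed
qed

context affine_system
begin

text \<open>Functions that agree almost everywhere are at distance zero, so stability under small
  perturbations already covers this case.\<close>

lemma approx_onto_cong_AE:
  assumes \<psi>: "\<psi> \<in> Lp_funs p" and \<phi>: "\<phi> \<in> Lp_funs p" and eq: "AE x in lebesgue. \<psi> x = \<phi> x"
    and approx: "approx_onto \<psi>"
  shows "approx_onto \<phi>"
proof -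
  obtain \<epsilon> where \<epsilon>: "0 < \<epsilon>"
    "\<And>\<phi>. \<phi> \<in> Lp_funs p \<Longrightarrow> Lp_int p (\<lambda>x. \<psi> x - \<phi> x) \<le> ennreal \<epsilon> \<Longrightarrow> approx_onto \<phi>"
    using approx_onto_stable[OF \<psi> approx] by blast
  have "Lp_int p (\<lambda>x. \<psi> x - \<phi> x) = Lp_int p (\<lambda>x::real^'n. 0::complex)"
    using eq by (intro Lp_int_cong_AE) (auto elim: eventually_mono)
  also have "\<dots> = 0" by (simp add: Lp_int_def)
  finally show ?thesis using \<epsilon> \<phi> by simp
qed

text \<open>The definition of \<open>synthesis\<close> works with a chosen representative
  \<open>\<phi>\<close>. The passage from \<open>\<phi>\<close> to \<open>\<psi>\<close> goes
  through \<open>approx_onto\<close>, which depends only on the class.\<close>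

lemma synthesis_onto_iff:
  assumes \<psi>: "\<psi> \<in> Lp_funs p"
  shows "Lp_class p \<psi> \<in> synthesis_onto p a b \<longleftrightarrow> approx_onto \<psi>"
proof -
  define \<phi> where "\<phi> = Lp_rep (Lp_class p \<psi>)"
  have \<phi>: "\<phi> \<in> Lp_funs p" unfolding \<phi>_def by (intro Lp_rep_funs Lp_class_mem \<psi>)
  have synth: "synthesis p a b (Lp_class p \<psi>) c = Lp_class p (S \<phi> c)" for c
    by (simp add: synthesis_def \<phi>_def)
  have Sc: "S \<phi> c \<in> Lp_funs p" if "c \<in> lp_seqs p" for c
    using that \<phi> by (intro synthesis_fun_Lp) (simp_all add: lp_seqs_iff)
  have "Lp_class p \<psi> \<in> synthesis_onto p a b \<longleftrightarrow> (\<lambda>c. Lp_class p (S \<phi> c)) ` lp_seqs p = Lp p"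
    using \<psi> by (simp add: synthesis_onto_def Lp_class_mem synth)
  also have "\<dots> \<longleftrightarrow> Lp p \<subseteq> (\<lambda>c. Lp_class p (S \<phi> c)) ` lp_seqs p"
    using Sc by (auto intro!: subset_antisym Lp_class_mem)
  also have "\<dots> \<longleftrightarrow> (\<forall>F\<in>Lp p. \<exists>c\<in>lp_seqs p. F = Lp_class p (S \<phi> c))"
    unfolding subset_eq image_iff ..
  also have "\<dots> \<longleftrightarrow> onto \<phi>"
  proof
    assume L: "\<forall>F\<in>Lp p. \<exists>c\<in>lp_seqs p. F = Lp_class p (S \<phi> c)"
    show "onto \<phi>" unfolding onto_def
    proof
      fix f :: "real ^ 'n \<Rightarrow> complex" assume f: "f \<in> Lp_funs p"
      obtain c where c: "c \<in> lp_seqs p" "Lp_class p f = Lp_class p (S \<phi> c)"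
        using L Lp_class_mem[OF f] by blast
      then show "\<exists>c. seq_int p c < \<infinity> \<and> (AE x in lebesgue. S \<phi> c x = f x)"
        using Lp_class_eq_iff[OF Sc[OF c(1)] f] by (auto simp: lp_seqs_iff)
    qed
  next
    assume R: "onto \<phi>"
    show "\<forall>F\<in>Lp p. \<exists>c\<in>lp_seqs p. F = Lp_class p (S \<phi> c)"
    proof
      fix F :: "(real ^ 'n \<Rightarrow> complex) set" assume F: "F \<in> Lp p"
      obtain c where c: "c \<in> lp_seqs p" "AE x in lebesgue. S \<phi> c x = Lp_rep F x"
        using R Lp_rep_funs[OF F] unfolding onto_def lp_seqs_iff by blast
      then have "Lp_class p (S \<phi> c) = F"
        using Lp_class_eq_iff[OF Sc[OF c(1)] Lp_rep_funs[OF F]] Lp_class_rep[OF F] by simp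
      with c(1) show "\<exists>c\<in>lp_seqs p. F = Lp_class p (S \<phi> c)" by blast
    qed
  qed
  also have "\<dots> \<longleftrightarrow> approx_onto \<phi>" by (rule onto_iff_approx_onto[OF \<phi>])
  also have "\<dots> \<longleftrightarrow> approx_onto \<psi>"
    using Lp_rep_class_AE[OF \<psi>] approx_onto_cong_AE[OF \<phi> \<psi>] approx_onto_cong_AE[OF \<psi> \<phi>]
    by (auto simp: \<phi>_def eq_commute)
  finally show ?thesis .
qed

lemma synthesis_onto_subset: "synthesis_onto p a b \<subseteq> Lp p"
  by (auto simp: synthesis_onto_def)

lemma synthesis_onto_obtain:
  assumes "F \<in> synthesis_onto p a b"
  obtains \<psi> where "\<psi> \<in> Lp_funs p" "approx_onto \<psi>" "F = Lp_class p \<psi>"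
proof -
  have F: "F \<in> Lp p" using assms synthesis_onto_subset by blast
  show thesis
    using that[OF Lp_rep_funs[OF F]] synthesis_onto_iff[OF Lp_rep_funs[OF F]] assms
    by (simp add: Lp_class_rep[OF F])
qed

lemma openin_synthesis_onto: "openin (Lp_topology p) (synthesis_onto p a b)"
proof -
  interpret M: Metric_space "Lp p :: (real ^ 'n \<Rightarrow> complex) set set" "Lp_dist p"
    by (rule Metric_space_Lp[OF p])
  show ?thesis
    unfolding Lp_topology_def M.openin_mtopology
  proof (intro conjI allI impI synthesis_onto_subset)
    fix F :: "(real ^ 'n \<Rightarrow> complex) set" assume "F \<in> synthesis_onto p a b"
    then obtain \<psi> where \<psi>: "\<psi> \<in> Lp_funs p" "approx_onto \<psi>" "F = Lp_class p \<psi>"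
      by (rule synthesis_onto_obtain)
    obtain \<epsilon> where \<epsilon>: "0 < \<epsilon>"
      "\<And>\<phi>. \<phi> \<in> Lp_funs p \<Longrightarrow> Lp_int p (\<lambda>x. \<psi> x - \<phi> x) \<le> ennreal \<epsilon> \<Longrightarrow> approx_onto \<phi>"
      using approx_onto_stable[OF \<psi>(1,2)] by blast
    have "G \<in> synthesis_onto p a b" if "G \<in> M.mball F \<epsilon>" for G
    proof -
      have G: "G \<in> Lp p" "Lp_dist p (Lp_class p \<psi>) G < \<epsilon>" using that \<psi>(3) by auto
      have "G = Lp_class p (Lp_rep G)" by (simp add: Lp_class_rep G)
      with G have "Lp_int p (\<lambda>x. \<psi> x - Lp_rep G x) < ennreal \<epsilon>"
        using Lp_dist_class_less_iff[OF p \<psi>(1) Lp_rep_funs[OF G(1)]] by simp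
      then have "approx_onto (Lp_rep G)" by (intro \<epsilon>(2) Lp_rep_funs G less_imp_le)
      then show ?thesis
        using synthesis_onto_iff[OF Lp_rep_funs[OF G(1)]] by (simp add: Lp_class_rep G)
    qed
    then show "\<exists>r>0. M.mball F r \<subseteq> synthesis_onto p a b" using \<epsilon>(1) by blast
  qed
qed

text \<open>Every path used below is a combination of two fixed functions with continuous complex
  coefficients, so only the approximate property along it remains to be checked.\<close>

lemma path_component_of_synthesis_onto:
  fixes \<alpha> \<beta> :: "real \<Rightarrow> complex"
  assumes f: "f \<in> Lp_funs p" and g: "g \<in> Lp_funs p"
    and \<alpha>: "continuous_on {0..1} \<alpha>" and \<beta>: "continuous_on {0..1} \<beta>"
    and approx: "\<And>t. 0 \<le> t \<Longrightarrow> t \<le> 1 \<Longrightarrow> approx_onto (\<lambda>x. \<alpha> t * f x + \<beta> t * g x)"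
  shows "path_component_of (subtopology (Lp_topology p) (synthesis_onto p a b))
    (Lp_class p (\<lambda>x. \<alpha> 0 * f x + \<beta> 0 * g x)) (Lp_class p (\<lambda>x. \<alpha> 1 * f x + \<beta> 1 * g x))"
  unfolding path_component_of_def pathin_subtopology
  using pathin_Lp_combination[OF p f g \<alpha> \<beta>] approx
  by (intro exI[of _ "\<lambda>t. Lp_class p (\<lambda>x. \<alpha> t * f x + \<beta> t * g x)"])
    (auto simp: synthesis_onto_iff Lp_funs_add Lp_funs_cmult p f g)

end

context expanding_affine_system
begin

lemma nice_integrable: "nice \<psi> \<Longrightarrow> integrable lebesgue (\<lambda>x. \<psi> (b *v x))"
  using compose_b_measurable[of \<psi> 0] bounded_supp_compose_matrix[OF b]
  by (auto simp: nice_def intro!: integrable_bounded_supp)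

lemma nice_combination:
  assumes "nice \<psi>" "nice \<phi>"
    and "s * (\<integral>x. \<psi> (b *v x) \<partial>lebesgue) + t * (\<integral>x. \<phi> (b *v x) \<partial>lebesgue) \<noteq> 0"
  shows "nice (\<lambda>x. s * \<psi> x + t * \<phi> x)"
proof -
  have [measurable]: "\<psi> \<in> borel_measurable lebesgue" "\<phi> \<in> borel_measurable lebesgue"
    using assms by (auto simp: nice_def)
  have "(\<integral>x. s * \<psi> (b *v x) + t * \<phi> (b *v x) \<partial>lebesgue)
      = s * (\<integral>x. \<psi> (b *v x) \<partial>lebesgue) + t * (\<integral>x. \<phi> (b *v x) \<partial>lebesgue)"
    using nice_integrable assms by simp
  with assms show ?thesis
    by (auto simp: nice_def bounded_supp_combination)
qed

text \<open>Composed with \<open>b\<close> it is the indicator of the unit cube, so its relevant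
  integral is \<open>1\<close>; a small multiple of it repairs a vanishing integral.\<close>

definition tile :: "real ^ 'n \<Rightarrow> complex" where
  "tile x = indicator unit_cube (matrix_inv b *v x)"

lemma nice_tile: "nice tile" and integral_tile: "(\<integral>x. tile (b *v x) \<partial>lebesgue) = 1"
proof -
  have inv_b: "invertible (matrix_inv b)"
    using b invertible_det_nz[of b] invertible_det_nz[of "matrix_inv b"] by (simp add: det_matrix_inv)
  have Q: "(indicator unit_cube :: real ^ 'n \<Rightarrow> complex) \<in> borel_measurable lebesgue"
    by (intro borel_measurable_indicator) (simp add: unit_cube_borel)
  have "measure lebesgue (unit_cube :: (real ^ 'n) set) = 1"
    using emeasure_unit_cube[where 'n = 'n] by (simp add: measure_def)
  moreover have "(indicator unit_cube x :: complex) = complex_of_real (indicator unit_cube x)" for x :: "real ^ 'n"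
    by (simp add: indicator_def)
  ultimately show int: "(\<integral>x. tile (b *v x) \<partial>lebesgue) = 1"
    by (simp add: tile_def matrix_inv_mult_vec[OF b])
  have "bounded_supp (indicator (unit_cube :: (real ^ 'n) set) :: _ \<Rightarrow> complex)"
    unfolding bounded_supp_def
    by (rule exI[of _ 1], rule exI[of _ "real CARD('n)"]) (use norm_unit_cube_le in \<open>fastforce simp: indicator_def\<close>)
  from bounded_supp_compose_matrix[OF inv_b this] have "bounded_supp tile" by (simp add: tile_def[abs_def])
  moreover have "tile \<in> borel_measurable lebesgue"
    using measurable_compose[OF affine_measurable_lebesgue[OF inv_b, of 0] Q] by (simp add: tile_def[abs_def])
  ultimately show "nice tile" using int by (simp add: nice_def)
qed

lemma nice_dense:
  assumes f: "f \<in> Lp_funs p" and r: "0 < r"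
  obtains g where "nice g" "Lp_int p (\<lambda>x. f x - g x) < ennreal r"
proof -
  obtain g0 where g0: "g0 \<in> borel_measurable lebesgue" "bounded_supp g0"
    and close: "Lp_int p (\<lambda>x. f x - g0 x) < ennreal (r / 2)"
    using truncation_approx[OF p(1) f, of "r / 2"] r by auto
  show thesis
  proof (cases "(\<integral>x. g0 (b *v x) \<partial>lebesgue) = 0")
    case False
    moreover have "Lp_int p (\<lambda>x. f x - g0 x) < ennreal r"
      using close r by (elim less_le_trans) (auto intro: ennreal_leI)
    ultimately show thesis using that g0 by (simp add: nice_def)
  next
    case True
    note tile = nice_tile[unfolded nice_def]
    note [measurable] = g0(1) Lp_funs_measurable[OF f] tile[THEN conjunct1]
    obtain I where I: "Lp_int p tile = ennreal I" "0 \<le> I"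
      using Lp_int_finite[OF nice_Lp[OF nice_tile]] by (cases "Lp_int p tile") auto
    \<comment> \<open>Makes the added multiple of \<open>tile\<close> have size
      \<open>r / 2 * I / (I + 1)\<close>, which fits into the half of \<open>r\<close> left over by
      the truncation.\<close>
    define t where "t = (r / 2 / (I + 1)) powr (1 / p)"
    have t: "0 < t" "t powr p = r / 2 / (I + 1)" using r I p by (auto simp: t_def powr_powr)
    define g where "g x = 1 * g0 x + complex_of_real t * tile x" for x
    have "integrable lebesgue (\<lambda>x. g0 (b *v x))"
      using compose_b_measurable[OF g0(1), of 0] bounded_supp_compose_matrix[OF b g0(2)]
      by (auto intro!: integrable_bounded_supp)
    then have "(\<integral>x. g (b *v x) \<partial>lebesgue) = complex_of_real t"
      using nice_integrable[OF nice_tile] by (simp add: g_def True integral_tile)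
    moreover have "g \<in> borel_measurable lebesgue" unfolding g_def by measurable
    moreover have "bounded_supp g" unfolding g_def by (intro bounded_supp_combination g0(2)) (use tile in blast)
    ultimately have "nice g" using t by (simp add: nice_def)
    have "Lp_int p (\<lambda>x. f x - g x) = Lp_int p (\<lambda>x. (f x - g0 x) + (- complex_of_real t) * tile x)"
      by (simp add: g_def algebra_simps)
    also have "\<dots> \<le> Lp_int p (\<lambda>x. f x - g0 x) + Lp_int p (\<lambda>x. (- complex_of_real t) * tile x)"
      by (intro Lp_int_add_le p) measurable
    also have "Lp_int p (\<lambda>x. (- complex_of_real t) * tile x) = ennreal (r / 2 / (I + 1) * I)"
    proof -
      have "norm (- complex_of_real t) powr p = r / 2 / (I + 1)"
        unfolding norm_minus_cancel norm_of_real using t by simp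
      then show ?thesis
        using I r by (subst Lp_int_cmult, measurable) (simp only: I(1), rule ennreal_mult'[symmetric], simp)
    qed
    also have "Lp_int p (\<lambda>x. f x - g0 x) + ennreal (r / 2 / (I + 1) * I)
        \<le> Lp_int p (\<lambda>x. f x - g0 x) + ennreal (r / 2)"
      using r I by (intro add_left_mono ennreal_leI) (simp add: field_simps)
    also have "\<dots> < ennreal (r / 2) + ennreal (r / 2)"
      using close by (simp add: add.commute ennreal_add_left_cancel_less)
    also have "\<dots> = ennreal r" using r by (simp flip: ennreal_plus)
    finally show thesis using that \<open>nice g\<close> by blast
  qed
qed

lemma synthesis_onto_dense: "Lp_topology p closure_of synthesis_onto p a b = topspace (Lp_topology p)"
proof -
  interpret M: Metric_space "Lp p :: (real ^ 'n \<Rightarrow> complex) set set" "Lp_dist p"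
    by (rule Metric_space_Lp[OF p])
  have "\<exists>G\<in>synthesis_onto p a b. G \<in> M.mball F r" if F: "F \<in> Lp p" and r: "0 < r" for F r
  proof -
    obtain g where g: "nice g" "Lp_int p (\<lambda>x. Lp_rep F x - g x) < ennreal r"
      using nice_dense[OF Lp_rep_funs[OF F] r] by blast
    have "Lp_dist p (Lp_class p (Lp_rep F)) (Lp_class p g) < r"
      using g by (simp add: Lp_dist_class_less_iff[OF p Lp_rep_funs[OF F] nice_Lp])
    then have "Lp_class p g \<in> M.mball F r"
      using F g(1) by (simp add: Lp_class_rep Lp_class_mem nice_Lp)
    moreover have "Lp_class p g \<in> synthesis_onto p a b"
      using g(1) by (simp add: synthesis_onto_iff nice_Lp nice_imp_approx_onto)
    ultimately show ?thesis by blast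
  qed
  then show ?thesis
    unfolding Lp_topology_def M.metric_closure_of M.topspace_mtopology by blast
qed

abbreviation connected_by_path :: "(real ^ 'n \<Rightarrow> complex) \<Rightarrow> (real ^ 'n \<Rightarrow> complex) \<Rightarrow> bool" where
  "connected_by_path f g \<equiv> path_component_of (subtopology (Lp_topology p) (synthesis_onto p a b))
    (Lp_class p f) (Lp_class p g)"

text \<open>For \<open>p < 1\<close> balls need not be convex, but a segment that starts at the
  centre stays inside: its points differ from \<open>f\<close> by \<open>t * (f x - g x)\<close>,
  which is pointwise no larger than \<open>f x - g x\<close>.\<close>

lemma path_to_nice:
  assumes f: "f \<in> Lp_funs p" and approx: "approx_onto f"
  obtains g where "nice g" "connected_by_path f g"
proof -
  obtain \<epsilon> where \<epsilon>: "0 < \<epsilon>"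
    "\<And>\<phi>. \<phi> \<in> Lp_funs p \<Longrightarrow> Lp_int p (\<lambda>x. f x - \<phi> x) \<le> ennreal \<epsilon> \<Longrightarrow> approx_onto \<phi>"
    using approx_onto_stable[OF f approx] by blast
  obtain g where g: "nice g" "Lp_int p (\<lambda>x. f x - g x) < ennreal \<epsilon>"
    using nice_dense[OF f \<epsilon>(1)] by blast
  note gL = nice_Lp[OF g(1)]
  note [measurable] = Lp_funs_measurable[OF f] Lp_funs_measurable[OF gL]
  have "approx_onto (\<lambda>x. complex_of_real (1 - t) * f x + complex_of_real t * g x)" if t: "0 \<le> t" "t \<le> 1" for t
  proof (intro \<epsilon>(2) Lp_funs_add Lp_funs_cmult p f gL)
    have "Lp_int p (\<lambda>x. f x - (complex_of_real (1 - t) * f x + complex_of_real t * g x))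
        = Lp_int p (\<lambda>x. complex_of_real t * (f x - g x))"
      by (simp add: algebra_simps)
    also have "\<dots> \<le> Lp_int p (\<lambda>x. f x - g x)"
      using t p by (intro Lp_int_mono) (auto simp: norm_mult intro: mult_left_le_one_le)
    also have "\<dots> \<le> ennreal \<epsilon>" using g by simp
    finally show "Lp_int p (\<lambda>x. f x - (complex_of_real (1 - t) * f x + complex_of_real t * g x)) \<le> ennreal \<epsilon>" .
  qed
  then have "connected_by_path f g"
    using path_component_of_synthesis_onto[OF f gL, of "\<lambda>t. complex_of_real (1 - t)" "\<lambda>t. complex_of_real t"]
    by (simp add: continuous_intros)
  with g that show thesis by blast
qed

text \<open>After rescaling one of two nice functions their means agree, so the segment between them stays
  nice; the rescaling itself runs through nonzero complex factors.\<close>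

lemma nice_connected:
  assumes f: "nice f" and g: "nice g"
  shows "connected_by_path f g"
proof -
  define w v where "w = (\<integral>x. f (b *v x) \<partial>lebesgue)" and "v = (\<integral>x. g (b *v x) \<partial>lebesgue)"
  have wv: "w \<noteq> 0" "v \<noteq> 0" using f g by (auto simp: nice_def w_def v_def)
  define z where "z = w / v"
  have z: "z \<noteq> 0" "z * v = w" using wv by (auto simp: z_def)
  note fL = nice_Lp[OF f] and gL = nice_Lp[OF g]
  have "approx_onto (\<lambda>x. complex_of_real (1 - t) * f x + (complex_of_real t * z) * g x)" for t
  proof (intro nice_imp_approx_onto nice_combination f g)
    have "complex_of_real (1 - t) * w + (complex_of_real t * z) * v = w"
      using z by (simp add: mult.assoc algebra_simps)
    then show "complex_of_real (1 - t) * (\<integral>x. f (b *v x) \<partial>lebesgue)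
        + (complex_of_real t * z) * (\<integral>x. g (b *v x) \<partial>lebesgue) \<noteq> 0"
      using wv by (simp add: w_def v_def)
  qed
  then have 1: "connected_by_path f (\<lambda>x. z * g x)"
    using path_component_of_synthesis_onto[OF fL gL, of "\<lambda>t. complex_of_real (1 - t)" "\<lambda>t. complex_of_real t * z"]
    by (simp add: continuous_intros)
  \<comment> \<open>\<open>exp\<close> never vanishes, so this factor runs from \<open>z\<close> to
    \<open>1\<close> inside the nonzero complex numbers. The term \<open>0 * g x\<close> gives the
    combination the shape of the path lemma.\<close>
  have "approx_onto (\<lambda>x. exp (complex_of_real (1 - t) * Ln z) * g x + 0 * g x)" for t
    using wv by (intro nice_imp_approx_onto nice_combination g) (simp add: v_def)
  then have 2: "connected_by_path (\<lambda>x. z * g x) g"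
    using path_component_of_synthesis_onto[OF gL gL, of "\<lambda>t. exp (complex_of_real (1 - t) * Ln z)" "\<lambda>_. 0"] z(1)
    by (simp add: continuous_intros)
  show ?thesis using 1 2 by (rule path_component_of_trans)
qed

lemma path_connectedin_synthesis_onto: "path_connectedin (Lp_topology p) (synthesis_onto p a b)"
proof -
  have "path_component_of (subtopology (Lp_topology p) (synthesis_onto p a b)) F G"
    if "F \<in> synthesis_onto p a b" "G \<in> synthesis_onto p a b" for F G
  proof -
    obtain f where f: "f \<in> Lp_funs p" "approx_onto f" "F = Lp_class p f"
      using \<open>F \<in> _\<close> by (rule synthesis_onto_obtain)
    obtain g where g: "g \<in> Lp_funs p" "approx_onto g" "G = Lp_class p g"
      using \<open>G \<in> _\<close> by (rule synthesis_onto_obtain)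
    obtain f' where f': "nice f'" "connected_by_path f f'" using path_to_nice[OF f(1,2)] by blast
    obtain g' where g': "nice g'" "connected_by_path g g'" using path_to_nice[OF g(1,2)] by blast
    show ?thesis
      using f'(2) nice_connected[OF f'(1) g'(1)] g'(2) f(3) g(3)
      by (metis path_component_of_trans path_component_of_sym)
  qed
  moreover have "synthesis_onto p a b \<subseteq> topspace (Lp_topology p)"
    using synthesis_onto_subset p by (simp add: topspace_Lp_topology)
  ultimately show ?thesis
    unfolding path_connectedin_def path_connected_space_iff_path_component by auto
qed

end

theorem theorem11:
  fixes a :: "nat \<Rightarrow> real ^ 'n ^ 'n" and b :: "real ^ 'n ^ 'n" and p :: real
  assumes "\<And>j. j > 0 \<Longrightarrow> invertible (a j)"
    and "(\<lambda>j. onorm ((*v) (matrix_inv (a j)))) \<longlonglongrightarrow> 0"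
    and "invertible b"
    and "0 < p" and "p \<le> 1"
  shows "Lp_topology p closure_of synthesis_onto p a b = topspace (Lp_topology p)
    \<and> openin (Lp_topology p) (synthesis_onto p a b)
    \<and> path_connectedin (Lp_topology p) (synthesis_onto p a b)"
proof -
  interpret expanding_affine_system a b p
    using assms by unfold_locales
  show ?thesis
    by (intro conjI synthesis_onto_dense openin_synthesis_onto path_connectedin_synthesis_onto)
qed

end
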